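(* The Grothendieck constant of order four satisfies $K_G(4)\geq 1.48579$.
   Context: For a positive integer $d$, let $S^{d-1}=\{v\in\mathbb{R}^d : \|v\|=1\}$ be the Euclidean unit sphere (so $S^0=\{-1,1\}$). For a real matrix $M$ of size $m_1\times m_2$ define $$\mathrm{SDP}_d(M)=\max\Big\{\sum_{x=1}^{m_1}\sum_{y=1}^{m_2}M_{xy}\langle a_x,b_y\rangle : a_1,\dots,a_{m_1},b_1,\dots,b_{m_2}\in S^{d-1}\Big\}.$$ The Grothendieck constant of order $d$ is $$K_G(d)=\sup\Big\{\frac{\mathrm{SDP}_d(M)}{\mathrm{SDP}_1(M)} : m_1,m_2\in\mathbb{N},\ M\in\mathbb{R}^{m_1\times m_2},\ M\neq 0\Big\},$$ i.e. the smallest constant $K$ such that $\mathrm{SDP}_d(M)\leq K\,\mathrm{SDP}_1(M)$ for all real matrices $M$ of all sizes. *)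

theory Defs
  imports Complex_Main "Jordan_Normal_Form.Matrix"
begin

text \<open>The sphere \<open>S\<close> of dimension \<open>d - 1\<close>, as vectors of length \<open>d\<close>.\<close>

definition unit_sphere :: "nat \<Rightarrow> real vec set" where
  "unit_sphere d = {v \<in> carrier_vec d. sqrt (v \<bullet> v) = 1}"

text \<open>
  For \<open>d \<ge> 1\<close> the supremum is a maximum: the objective is continuous on a nonempty compact set,
  a finite product of spheres. Values of \<open>a\<close> and \<open>b\<close> outside the index ranges are irrelevant.
\<close>

definition SDP :: "nat \<Rightarrow> real mat \<Rightarrow> real" where
  "SDP d M =
     Sup {(\<Sum>x<dim_row M. \<Sum>y<dim_col M. M $$ (x, y) * (a x \<bullet> b y)) | a b.
            (\<forall>x<dim_row M. a x \<in> unit_sphere d) \<and> (\<forall>y<dim_col M. b y \<in> unit_sphere d)}"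

text \<open>
  The type \<^typ>\<open>real mat\<close> contains the matrices of all sizes. A nonzero \<open>M\<close> has
  \<open>SDP 1 M > 0\<close>, and the set of ratios is bounded above: treating the \<open>d\<close> coordinates
  of the inner product separately gives \<open>SDP d M \<le> d * SDP 1 M\<close>.
  So the supremum in \<open>real\<close> is the genuine one.
\<close>

definition grothendieck_constant :: "nat \<Rightarrow> real" ("K\<^sub>G") where
  "K\<^sub>G d = Sup {SDP d M / SDP 1 M | M. M \<noteq> 0\<^sub>m (dim_row M) (dim_col M)}"

end

theory Submission
  imports Defs "HOL-Probability.Probability"
begin

text \<open>
  The matrix is a discretisation of the kernel \<open>k(s) = 4 s - \<lambda> K\<^sub>3(s)\<close>, \<open>s = x \<bullet> y\<close>, on the sphere
  \<open>S\<^sup>3\<close> with \<open>K\<^sub>3\<close> the reproducing kernel of the harmonics of degree 3 and \<open>\<lambda> = 0.4168\<close>. The vectors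
  \<open>a\<^sub>x = x\<close>, \<open>b\<^sub>y = y\<close> give the value 1. For sign functions \<open>f\<close>, \<open>g\<close> put \<open>p = (f + g) / 2\<close> and
  \<open>m = (f - g) / 2\<close>, so that \<open>\<bar>p\<bar> + \<bar>m\<bar> = 1\<close> and the bilinear form is \<open>Q(p) - Q(m)\<close> with
  \<open>Q(h) = 4 \<bar>E h x\<bar>\<^sup>2 - \<lambda> \<parallel>h * K\<^sub>3\<parallel>\<^sup>2\<close>. The term \<open>\<lambda> \<parallel>m * K\<^sub>3\<parallel>\<^sup>2\<close> is the dangerous one.
  Linearising \<open>Q(p)\<close> shows that \<open>p\<close> is worth at least \<open>2 S \<bar>t\<bar>\<close> at \<open>x\<close>, where \<open>t\<close> is the coordinate of
  \<open>x\<close> along \<open>E p x\<close> and \<open>S = 1.1704\<close>, so \<open>m\<close> gains only where the cubic harmonic \<open>e = m * K\<^sub>3\<close> satisfies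
  \<open>\<lambda> \<bar>e\<bar> > S \<bar>t\<bar>\<close>. The key inequality \<open>2 E (\<lambda> \<bar>e\<bar> - S \<bar>t\<bar>)\<^sub>+ \<le> \<lambda> E e\<^sup>2\<close>, valid for every cubic
  harmonic, is proved in polar coordinates around \<open>t\<close>; it leaves a quadratic optimisation with maximum below
  \<open>0.67304 < 1 / 1.48579\<close>.
\<close>

text \<open>Convolution with \<open>K3\<close> is an orthogonal projection, so the pairing of
  \<open>m\<close> with its projection \<open>e\<close> equals the mean of \<open>e^2\<close>. The
  linearised estimate therefore contains \<open>\<lambda>\<close> times that mean twice; the key
  inequality pays for one copy, and the other is the term of the quadratic form itself. This
  dictates the right-hand side of the key inequality. For small \<open>e\<close> the excess lives in
  a band around the equator \<open>t = 0\<close> whose width is proportional to the size of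
  \<open>e\<close>, so both sides are of second order. There the even part with coefficient
  \<open>D\<close> costs \<open>2 / pi * D^2\<close>, about 0.637, against an allowance of about
  0.768. The difference between these two numbers has to cover the remaining coefficients and all
  larger \<open>e\<close>. \<open>S\<close> is under pressure from both sides: at its maximum the
  final quadratic bound increases with \<open>S\<close>, while the key inequality becomes harder as
  \<open>S\<close> decreases. With the constants chosen, the comparison of coefficients that proves
  the key inequality is nearly an equality for three of the four coefficients.\<close>

section \<open>Rotations preserve Lebesgue measure\<close>

text \<open>Four-dimensional space with the pole of the polar coordinates split off as first component.\<close>

type_synonym V = "real \<times> (real^3)"

text \<open>Boxes suffice: the preimage of a box is its image under the inverse rotation, and
  orthogonal images keep their Lebesgue measure.\<close>

lemma lborel_distr_orthogonal:
  fixes T :: "real^4 \<Rightarrow> real^4"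
  assumes T: "orthogonal_transformation T"
  shows "distr lborel borel T = lborel"
proof (rule lborel_eqI[symmetric])
  have lin: "linear T" by (rule orthogonal_transformation_linear[OF T])
  then have [measurable]: "T \<in> borel_measurable borel"
    by (intro borel_measurable_continuous_onI linear_continuous_on) (simp add: linear_linear)
  have inv: "orthogonal_transformation (inv_into UNIV T)" by (rule orthogonal_transformation_inv[OF T])
  have bij: "bij T" by (rule orthogonal_transformation_bij[OF T])
  fix l u :: "real^4" assume le: "\<And>b. b \<in> Basis \<Longrightarrow> inner l b \<le> inner u b"
  have vim: "T -` box l u = inv_into UNIV T ` box l u" by (rule bij_vimage_eq_inv_image[OF bij])
  have lm: "box l u \<in> lmeasurable" by simp
  have lm2: "inv_into UNIV T ` box l u \<in> lmeasurable" by (rule measurable_orthogonal_image[OF inv lm])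
  have sb: "T -` box l u \<in> sets lborel"
    using measurable_sets[OF \<open>T \<in> borel_measurable borel\<close>, of "box l u"] by simp
  have "emeasure (distr lborel borel T) (box l u) = emeasure lborel (T -` box l u)"
    by (subst emeasure_distr) auto
  also have "\<dots> = emeasure lebesgue (T -` box l u)" using sb by simp
  also have "\<dots> = ennreal (measure lebesgue (inv_into UNIV T ` box l u))"
    unfolding vim using lm2 by (simp add: emeasure_eq_measure2 fmeasurableD2 lmeasurable_iff_integrable)
  also have "\<dots> = ennreal (measure lebesgue (box l u))"
    by (simp add: measure_orthogonal_image[OF inv lm])
  also have "\<dots> = (\<Prod>b\<in>Basis. inner (u - l) b)"
    using le by simp
  finally show "emeasure (distr lborel borel T) (box l u) = (\<Prod>b\<in>Basis. inner (u - l) b)" .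
qed simp

section \<open>The isometry between \<open>V\<close> and \<open>real^4\<close>\<close>

definition to4 :: "V \<Rightarrow> real^4" where
  "to4 x = (\<chi> i. if i = 1 then fst x else if i = 2 then vec_nth (snd x) 1
      else if i = 3 then vec_nth (snd x) 2 else vec_nth (snd x) 3)"

definition of4 :: "real^4 \<Rightarrow> V" where
  "of4 v = (vec_nth v 1, vector [vec_nth v 2, vec_nth v 3, vec_nth v 4])"

lemma to4_nth: "vec_nth (to4 x) 1 = fst x" "vec_nth (to4 x) 2 = vec_nth (snd x) 1"
  "vec_nth (to4 x) 3 = vec_nth (snd x) 2" "vec_nth (to4 x) 4 = vec_nth (snd x) 3"
  by (simp_all add: to4_def)

lemma of4_to4: "of4 (to4 x) = x"
  by (simp add: of4_def to4_nth prod_eq_iff Finite_Cartesian_Product.vec_eq_iff forall_3)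

lemma to4_of4: "to4 (of4 v) = v"
  by (simp add: of4_def to4_nth Finite_Cartesian_Product.vec_eq_iff forall_4)

lemma inner_to4: "inner (to4 x) (to4 y) = inner x y"
  by (simp add: inner_vec_def sum_4 sum_3 to4_nth inner_prod_def)

lemma linear_to4: "linear to4"
  by (rule linearI) (simp_all add: Finite_Cartesian_Product.vec_eq_iff forall_4 to4_nth)

lemma linear_of4: "linear of4"
  by (rule linearI) (simp_all add: of4_def Finite_Cartesian_Product.vec_eq_iff forall_3 prod_eq_iff)

lemma inner_of4: "inner (of4 x) (of4 y) = inner x y"
  using inner_to4[of "of4 x" "of4 y"] by (simp add: to4_of4)

lemma norm_to4: "norm (to4 x) = norm x"
  by (simp add: norm_eq_sqrt_inner inner_to4)

lemma measurable_to4 [measurable]: "to4 \<in> borel_measurable borel"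
  by (intro borel_measurable_continuous_onI linear_continuous_on) (simp add: linear_to4 linear_linear)

lemma measurable_of4 [measurable]: "of4 \<in> borel_measurable borel"
  by (intro borel_measurable_continuous_onI linear_continuous_on) (simp add: linear_of4 linear_linear)

lemma vimage_of4_box: "of4 -` box l u = box (to4 l) (to4 u)"
  by (auto simp: box_def of4_def Basis_prod_def Basis_vec_def inner_axis forall_3 forall_4 to4_nth
      inner_prod_def)

lemma prod_Basis_V: "(\<Prod>b\<in>(Basis::V set). inner w b) = fst w * (vec_nth (snd w) 1 * vec_nth (snd w) 2 * vec_nth (snd w) 3)"
proof -
  have U3: "(UNIV::3 set) = {1,2,3}" by (auto simp: UNIV_3)
  have B3: "(Basis :: (real^3) set) = {axis 1 1, axis 2 1, axis 3 1}"
    unfolding Basis_vec_def by (auto simp: U3)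
  have ne: "axis i (1::real) = axis j 1 \<longleftrightarrow> i = j" for i j :: 3 by (simp add: axis_eq_axis)
  have n0: "axis i (1::real) \<noteq> 0" for i :: 3 by (simp add: axis_eq_0_iff)
  have BV: "(Basis :: V set) = {(1,0), (0, axis 1 1), (0, axis 2 1), (0, axis 3 1)}"
    unfolding Basis_prod_def B3 by auto
  show ?thesis
    unfolding BV by (simp add: ne n0 inner_prod_def inner_axis)
qed

lemma prod_Basis_4: "(\<Prod>b\<in>(Basis::(real^4) set). inner w b) = vec_nth w 1 * vec_nth w 2 * vec_nth w 3 * vec_nth w 4"
proof -
  have U4: "(UNIV::4 set) = {1,2,3,4}" by (auto simp: UNIV_4)
  have B4: "(Basis :: (real^4) set) = {axis 1 1, axis 2 1, axis 3 1, axis 4 1}"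
    unfolding Basis_vec_def by (auto simp: U4)
  show ?thesis unfolding B4
    by (simp add: axis_eq_axis inner_axis)
qed

lemma lborel_of4: "distr lborel borel of4 = (lborel :: V measure)"
proof (rule lborel_eqI[symmetric])
  fix l u :: V assume le: "\<And>b. b \<in> Basis \<Longrightarrow> inner l b \<le> inner u b"
  have le': "vec_nth (to4 l) i \<le> vec_nth (to4 u) i" for i
  proof -
    have "inner (to4 l) (axis i 1) \<le> inner (to4 u) (axis i 1)"
    proof -
      have "of4 (axis i 1) \<in> Basis"
        using exhaust_4[of i]
        by (auto simp: of4_def Basis_prod_def Basis_vec_def axis_def Finite_Cartesian_Product.vec_eq_iff forall_3
            intro!: image_eqI)
      from le[OF this] show ?thesis
        by (metis inner_of4 of4_to4)
    qed
    then show ?thesis by (simp add: inner_axis)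
  qed
  have "emeasure (distr lborel borel of4) (box l u) = emeasure lborel (box (to4 l) (to4 u))"
    by (subst emeasure_distr) (auto simp: vimage_of4_box)
  also have "\<dots> = (\<Prod>b\<in>Basis. inner (to4 u - to4 l) b)"
    by (subst emeasure_lborel_box) (auto simp: Basis_vec_def inner_axis le')
  also have "\<dots> = (\<Prod>b\<in>Basis. inner (u - l) b)"
    unfolding prod_Basis_V prod_Basis_4 by (simp add: to4_nth mult.assoc)
  finally show "emeasure (distr lborel borel of4) (box l u) = (\<Prod>b\<in>Basis. inner (u - l) b)" .
qed simp

text \<open>Rotations act transitively on spheres. This moves any direction to the pole
  \<open>(1, 0)\<close>, where the polar coordinates apply; the rotation itself is found in
  \<open>real^4\<close> and carried over by the isometry.\<close>

lemma rotation_V: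
  fixes a b :: V
  assumes "norm a = norm b"
  obtains T where "linear T" "T \<in> borel_measurable borel" "\<And>x y. inner (T x) (T y) = inner x y"
    "T a = b" "distr lborel borel T = lborel"
proof -
  obtain R :: "real^4 \<Rightarrow> real^4" where R: "orthogonal_transformation R" "R (to4 a) = to4 b"
    using rotation_exists[of "to4 a" "to4 b"] assms by (auto simp: norm_to4)
  have lin: "linear R" by (rule orthogonal_transformation_linear[OF R(1)])
  then have [measurable]: "R \<in> borel_measurable borel"
    by (intro borel_measurable_continuous_onI linear_continuous_on) (simp add: linear_linear)
  define T where "T x = of4 (R (to4 x))" for x
  have lT: "linear T"
    using linear_compose[OF linear_compose[OF linear_to4 lin] linear_of4]
    by (simp add: T_def[abs_def] o_def)
  have mT [measurable]: "T \<in> borel_measurable borel"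
    unfolding T_def[abs_def] by measurable
  have "distr lborel borel T = distr (distr lborel borel of4) borel T"
    by (simp add: lborel_of4)
  also have "\<dots> = distr lborel borel (\<lambda>v. of4 (R v))"
    by (subst distr_distr) (auto simp: T_def o_def to4_of4)
  also have "\<dots> = distr (distr lborel borel R) borel of4"
    by (subst distr_distr) (auto simp: o_def)
  also have "\<dots> = lborel"
    by (simp add: lborel_distr_orthogonal[OF R(1)] lborel_of4)
  finally have d: "distr lborel borel T = lborel" .
  show thesis
    by (rule that[of T]) (use lT d R in \<open>auto simp: T_def inner_of4 inner_to4 of4_to4 orthogonal_transformation_def\<close>)
qed

section \<open>Polar coordinates\<close>

definition Th :: "real \<Rightarrow> real^3 \<Rightarrow> V" where
  "Th \<tau> \<xi> = (1 / sqrt (1 + \<tau>\<^sup>2)) *\<^sub>R (\<tau>, \<xi>)"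

lemma Th_measurable [measurable]: "(\<lambda>x. Th (f x) (g x)) \<in> borel_measurable M"
  if [measurable]: "f \<in> borel_measurable M" "g \<in> borel_measurable M"
  unfolding Th_def by measurable

lemma sqrt1_pos: "0 < sqrt (1 + (\<tau>::real)\<^sup>2)"
  by (simp add: add_pos_nonneg)

lemma sgn_scaled: "sgn (norm \<zeta> * \<tau>, \<zeta>) = Th \<tau> (sgn \<zeta>)" if "\<zeta> \<noteq> (0::real^3)"
proof -
  have n: "norm \<zeta> > 0" using that by simp
  have "norm (norm \<zeta> * \<tau>, \<zeta>) = norm \<zeta> * sqrt (1 + \<tau>\<^sup>2)"
  proof -
    have "norm (norm \<zeta> * \<tau>, \<zeta>) = sqrt ((norm \<zeta>)\<^sup>2 * (1 + \<tau>\<^sup>2))"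
      by (simp add: norm_prod_def power_mult_distrib algebra_simps)
    then show ?thesis by (simp add: real_sqrt_mult)
  qed
  then show ?thesis
    using n sqrt1_pos[of \<tau>] by (simp add: sgn_div_norm Th_def field_simps)
qed

lemma in_ball_scaled: "(norm \<zeta> * \<tau>, \<zeta>) \<in> ball 0 1 \<longleftrightarrow> norm \<zeta> * sqrt (1 + \<tau>\<^sup>2) < 1"
  for \<zeta> :: "real^3"
proof -
  have "norm (norm \<zeta> * \<tau>, \<zeta>) = sqrt ((norm \<zeta>)\<^sup>2 * (1 + \<tau>\<^sup>2))"
    by (simp add: norm_prod_def power_mult_distrib algebra_simps)
  then show ?thesis unfolding mem_ball_0 by (simp add: real_sqrt_mult)
qed

lemma AE_lborel_nonzero: "AE x in (lborel :: 'a::euclidean_space measure). x \<noteq> 0"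
  by (rule AE_I'[of "{0}"]) auto

lemma ball_borel [measurable]: "ball (0::'a::euclidean_space) 1 \<in> sets borel"
  by (rule borel_open) simp

lemma nn_integral_lborel_scale:
  fixes f :: "real^3 \<Rightarrow> ennreal"
  assumes [measurable]: "f \<in> borel_measurable borel" and c: "c > 0"
  shows "(\<integral>\<^sup>+x. f x \<partial>lborel) = ennreal (c^3) * (\<integral>\<^sup>+x. f (c *\<^sub>R x) \<partial>lborel)"
  by (subst lborel_affine[of c 0]) (use c in \<open>simp_all add: nn_integral_density nn_integral_distr nn_integral_cmult\<close>)

text \<open>Folding the line at 0 pairs the latitudes \<open>\<tau>\<close> and
  \<open>-\<tau>\<close>, so that even and odd parts in the latitude can later be separated
  pointwise.\<close>

lemma nn_integral_even_split:
  fixes h :: "real \<Rightarrow> ennreal"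
  assumes [measurable]: "h \<in> borel_measurable borel"
  shows "(\<integral>\<^sup>+\<tau>. h \<tau> \<partial>lborel) = (\<integral>\<^sup>+\<tau>. (h \<tau> + h (-\<tau>)) * indicator {0..} \<tau> \<partial>lborel)"
proof -
  have "(\<integral>\<^sup>+\<tau>. h \<tau> \<partial>lborel) = (\<integral>\<^sup>+\<tau>. h \<tau> * indicator {0..} \<tau> + h \<tau> * indicator {..<0} \<tau> \<partial>lborel)"
    by (intro nn_integral_cong) (auto simp: indicator_def)
  also have "\<dots> = (\<integral>\<^sup>+\<tau>. h \<tau> * indicator {0..} \<tau> \<partial>lborel) + (\<integral>\<^sup>+\<tau>. h \<tau> * indicator {..<0} \<tau> \<partial>lborel)"
    by (intro nn_integral_add) auto
  also have "(\<integral>\<^sup>+\<tau>. h \<tau> * indicator {..<0} \<tau> \<partial>lborel) = (\<integral>\<^sup>+\<tau>. h (-\<tau>) * indicator {..<0} (-\<tau>) \<partial>lborel)"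
    by (subst nn_integral_real_affine[where c="-1" and t=0]) auto
  also have "\<dots> = (\<integral>\<^sup>+\<tau>. h (-\<tau>) * indicator {0..} \<tau> \<partial>lborel)"
    by (rule nn_integral_cong_AE, rule AE_mp[OF AE_lborel_nonzero[where 'a=real]])
       (auto simp: indicator_def)
  also have "(\<integral>\<^sup>+\<tau>. h \<tau> * indicator {0..} \<tau> \<partial>lborel) + \<dots> = (\<integral>\<^sup>+\<tau>. (h \<tau> + h (-\<tau>)) * indicator {0..} \<tau> \<partial>lborel)"
    by (subst nn_integral_add[symmetric]) (auto simp: distrib_right)
  finally show ?thesis .
qed

text \<open>Integrating over the solid ball reduces polar coordinates to Fubini and linear
  substitutions: for fixed \<open>\<zeta>\<close> put \<open>t = norm \<zeta> * \<tau>\<close>,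
  exchange the integrals, then rescale \<open>\<zeta>\<close> for fixed \<open>\<tau>\<close> so
  that the condition of lying in the ball no longer involves \<open>\<tau>\<close>.\<close>

lemma nn_polar:
  fixes F :: "V \<Rightarrow> ennreal"
  assumes [measurable]: "F \<in> borel_measurable borel"
  shows "(\<integral>\<^sup>+x. F (sgn x) * indicator (ball 0 1) x \<partial>lborel) =
    (\<integral>\<^sup>+\<tau>. ennreal (1 / (1 + \<tau>\<^sup>2)\<^sup>2) * indicator {0..} \<tau> *
      (\<integral>\<^sup>+\<zeta>. (F (Th \<tau> (sgn \<zeta>)) + F (Th (-\<tau>) (sgn \<zeta>))) * (ennreal (norm \<zeta>) * indicator (ball 0 1) \<zeta>) \<partial>lborel) \<partial>lborel)"
proof -
  have [measurable]: "Measurable.pred (lborel \<Otimes>\<^sub>M lborel) (\<lambda>(t::real, \<zeta>::real^3). (t, \<zeta>) \<in> ball 0 1)"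
  proof -
    have "(\<lambda>(t::real, \<zeta>::real^3). (t, \<zeta>) \<in> ball 0 1) = (\<lambda>x. x \<in> ball 0 1)" by auto
    moreover have "Measurable.pred borel (\<lambda>x::V. x \<in> ball 0 1)" by measurable
    ultimately show ?thesis unfolding lborel_prod by simp
  qed
  define G where "G \<zeta> \<tau> = F (Th \<tau> (sgn \<zeta>)) * ennreal (norm \<zeta>) * indicator {x. norm \<zeta> * sqrt (1 + x\<^sup>2) < 1} \<tau>" for \<zeta> \<tau>
  have G_meas [measurable]: "(\<lambda>(\<zeta>, \<tau>). G \<zeta> \<tau>) \<in> borel_measurable (lborel \<Otimes>\<^sub>M lborel)"
    unfolding G_def by (simp add: indicator_def) measurable
  have G_meas' [measurable]: "(\<lambda>(\<tau>, \<zeta>). G \<zeta> \<tau>) \<in> borel_measurable (lborel \<Otimes>\<^sub>M lborel)"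
    unfolding G_def by (simp add: indicator_def) measurable
  have "(\<integral>\<^sup>+x. F (sgn x) * indicator (ball 0 1) x \<partial>lborel) =
    (\<integral>\<^sup>+x. F (sgn x) * indicator (ball 0 1) x \<partial>(lborel \<Otimes>\<^sub>M lborel))"
    by (simp add: lborel_prod)
  also have "\<dots> = (\<integral>\<^sup>+\<zeta>. (\<integral>\<^sup>+t. F (sgn (t, \<zeta>)) * indicator (ball 0 1) (t, \<zeta>) \<partial>lborel) \<partial>lborel)"
    by (subst lborel_pair.nn_integral_snd[symmetric]) (auto simp: lborel_prod)
  also have "\<dots> = (\<integral>\<^sup>+\<zeta>. (\<integral>\<^sup>+\<tau>. G \<zeta> \<tau> \<partial>lborel) \<partial>lborel)"
  proof (rule nn_integral_cong_AE, rule AE_mp[OF AE_lborel_nonzero[where 'a="real^3"]], rule AE_I2, rule impI)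
    fix \<zeta> :: "real^3" assume z: "\<zeta> \<noteq> 0"
    have "(\<integral>\<^sup>+t. F (sgn (t, \<zeta>)) * indicator (ball 0 1) (t, \<zeta>) \<partial>lborel) =
      ennreal (norm \<zeta>) * (\<integral>\<^sup>+\<tau>. F (sgn (norm \<zeta> * \<tau>, \<zeta>)) * indicator (ball 0 1) (norm \<zeta> * \<tau>, \<zeta>) \<partial>lborel)"
      using z by (subst nn_integral_real_affine[where c="norm \<zeta>" and t=0]) auto
    also have "\<dots> = (\<integral>\<^sup>+\<tau>. ennreal (norm \<zeta>) * (F (sgn (norm \<zeta> * \<tau>, \<zeta>)) * indicator (ball 0 1) (norm \<zeta> * \<tau>, \<zeta>)) \<partial>lborel)"
      by (subst nn_integral_cmult) auto
    also have "\<dots> = (\<integral>\<^sup>+\<tau>. G \<zeta> \<tau> \<partial>lborel)"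
    proof (intro nn_integral_cong)
      fix \<tau> :: real
      have "indicator (ball 0 1) (norm \<zeta> * \<tau>, \<zeta>) = (indicator {x. norm \<zeta> * sqrt (1 + x\<^sup>2) < 1} \<tau> :: ennreal)"
        by (simp only: indicator_def in_ball_scaled mem_Collect_eq)
      then show "ennreal (norm \<zeta>) * (F (sgn (norm \<zeta> * \<tau>, \<zeta>)) * indicator (ball 0 1) (norm \<zeta> * \<tau>, \<zeta>)) = G \<zeta> \<tau>"
        unfolding G_def sgn_scaled[OF z] by (simp only: mult_ac)
    qed
    finally show "(\<integral>\<^sup>+t. F (sgn (t, \<zeta>)) * indicator (ball 0 1) (t, \<zeta>) \<partial>lborel) = (\<integral>\<^sup>+\<tau>. G \<zeta> \<tau> \<partial>lborel)" .
  qed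
  also have "\<dots> = (\<integral>\<^sup>+\<tau>. (\<integral>\<^sup>+\<zeta>. G \<zeta> \<tau> \<partial>lborel) \<partial>lborel)"
    by (rule lborel_pair.Fubini') (rule G_meas')
  also have "\<dots> = (\<integral>\<^sup>+\<tau>. ennreal (1 / (1 + \<tau>\<^sup>2)\<^sup>2) *
      (\<integral>\<^sup>+\<zeta>. F (Th \<tau> (sgn \<zeta>)) * (ennreal (norm \<zeta>) * indicator (ball 0 1) \<zeta>) \<partial>lborel) \<partial>lborel)"
  proof (rule nn_integral_cong)
    fix \<tau> :: real
    let ?c = "1 / sqrt (1 + \<tau>\<^sup>2)"
    have c: "?c > 0" using sqrt1_pos[of \<tau>] by simp
    \<comment> \<open>Three factors come from scaling three-dimensional space, the fourth from the
      weight \<open>norm \<zeta>\<close>.\<close>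
    have c4: "?c ^ 3 * ?c = 1 / (1 + \<tau>\<^sup>2)\<^sup>2"
    proof -
      have "?c ^ 3 * ?c = (?c\<^sup>2)\<^sup>2" by (simp add: power2_eq_square power3_eq_cube)
      then show ?thesis by (simp add: power_divide)
    qed
    have "(\<integral>\<^sup>+\<zeta>. G \<zeta> \<tau> \<partial>lborel) = ennreal (?c ^ 3) * (\<integral>\<^sup>+\<zeta>. G (?c *\<^sub>R \<zeta>) \<tau> \<partial>lborel)"
      by (rule nn_integral_lborel_scale[OF _ c]) measurable
    also have "(\<integral>\<^sup>+\<zeta>. G (?c *\<^sub>R \<zeta>) \<tau> \<partial>lborel) =
      (\<integral>\<^sup>+\<zeta>. ennreal ?c * (F (Th \<tau> (sgn \<zeta>)) * (ennreal (norm \<zeta>) * indicator (ball 0 1) \<zeta>)) \<partial>lborel)"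
    proof (intro nn_integral_cong)
      fix \<zeta> :: "real^3"
      have s: "sgn (?c *\<^sub>R \<zeta>) = sgn \<zeta>" using c by (simp add: sgn_scaleR)
      have n: "norm (?c *\<^sub>R \<zeta>) = ?c * norm \<zeta>" using c by simp
      have i: "?c * norm \<zeta> * sqrt (1 + \<tau>\<^sup>2) = norm \<zeta>" using sqrt1_pos[of \<tau>] by simp
      show "G (?c *\<^sub>R \<zeta>) \<tau> = ennreal ?c * (F (Th \<tau> (sgn \<zeta>)) * (ennreal (norm \<zeta>) * indicator (ball 0 1) \<zeta>))"
      proof -
        have e: "ennreal (?c * norm \<zeta>) = ennreal ?c * ennreal (norm \<zeta>)"
          using c by (intro ennreal_mult) auto
        have ind: "indicator {x. ?c * norm \<zeta> * sqrt (1 + x\<^sup>2) < 1} \<tau> = (indicator (ball 0 1) \<zeta> :: ennreal)"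
          unfolding indicator_def mem_Collect_eq i mem_ball_0 ..
        show ?thesis unfolding G_def s n e ind by (simp only: mult_ac)
      qed
    qed
    also have "\<dots> = ennreal ?c * (\<integral>\<^sup>+\<zeta>. F (Th \<tau> (sgn \<zeta>)) * (ennreal (norm \<zeta>) * indicator (ball 0 1) \<zeta>) \<partial>lborel)"
      by (rule nn_integral_cmult) measurable
    finally show "(\<integral>\<^sup>+\<zeta>. G \<zeta> \<tau> \<partial>lborel) = ennreal (1 / (1 + \<tau>\<^sup>2)\<^sup>2) *
      (\<integral>\<^sup>+\<zeta>. F (Th \<tau> (sgn \<zeta>)) * (ennreal (norm \<zeta>) * indicator (ball 0 1) \<zeta>) \<partial>lborel)"
      using c by (simp add: mult.assoc[symmetric] ennreal_mult[symmetric] c4 del: times_divide_eq_left times_divide_eq_right)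
  qed
  also have "\<dots> = (\<integral>\<^sup>+\<tau>. ennreal (1 / (1 + \<tau>\<^sup>2)\<^sup>2) * indicator {0..} \<tau> *
      (\<integral>\<^sup>+\<zeta>. (F (Th \<tau> (sgn \<zeta>)) + F (Th (-\<tau>) (sgn \<zeta>))) * (ennreal (norm \<zeta>) * indicator (ball 0 1) \<zeta>) \<partial>lborel) \<partial>lborel)"
  proof (subst nn_integral_even_split, measurable, intro nn_integral_cong)
    fix \<tau> :: real
    let ?v = "\<lambda>\<zeta>::real^3. ennreal (norm \<zeta>) * indicator (ball 0 1) \<zeta>"
    have a: "(\<integral>\<^sup>+\<zeta>. (F (Th \<tau> (sgn \<zeta>)) + F (Th (-\<tau>) (sgn \<zeta>))) * ?v \<zeta> \<partial>lborel) =
      (\<integral>\<^sup>+\<zeta>. F (Th \<tau> (sgn \<zeta>)) * ?v \<zeta> \<partial>lborel) + (\<integral>\<^sup>+\<zeta>. F (Th (-\<tau>) (sgn \<zeta>)) * ?v \<zeta> \<partial>lborel)"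
      unfolding distrib_right by (rule nn_integral_add) measurable
    show "(ennreal (1 / (1 + \<tau>\<^sup>2)\<^sup>2) * (\<integral>\<^sup>+\<zeta>. F (Th \<tau> (sgn \<zeta>)) * ?v \<zeta> \<partial>lborel) +
        ennreal (1 / (1 + (-\<tau>)\<^sup>2)\<^sup>2) * (\<integral>\<^sup>+\<zeta>. F (Th (-\<tau>) (sgn \<zeta>)) * ?v \<zeta> \<partial>lborel)) * indicator {0..} \<tau> =
      ennreal (1 / (1 + \<tau>\<^sup>2)\<^sup>2) * indicator {0..} \<tau> *
        (\<integral>\<^sup>+\<zeta>. (F (Th \<tau> (sgn \<zeta>)) + F (Th (-\<tau>) (sgn \<zeta>))) * ?v \<zeta> \<partial>lborel)"
      unfolding a by (simp add: distrib_left distrib_right mult_ac)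
  qed
  finally show ?thesis .
qed

section \<open>The probability measures on the sphere, the latitude and the equator\<close>

definition wt3 :: real where
  "wt3 = enn2real (\<integral>\<^sup>+\<zeta>. ennreal (norm \<zeta>) * indicator (ball 0 1) \<zeta> \<partial>(lborel :: (real^3) measure))"

text \<open>
  Only \<open>sgn x\<close> is ever evaluated: under \<open>mu\<close> it is uniformly distributed on the sphere
  (\<open>sgn 0 = 0\<close> is a null event). In the coordinates \<open>Th \<tau> \<xi>\<close>, where \<open>\<tau>\<close> is the
  tangent of the latitude, \<open>kap\<close> is the law of \<open>\<bar>\<tau>\<bar>\<close>, and \<open>nu\<close> makes
  \<open>sgn \<zeta>\<close> uniform on the equator. The weight \<open>norm \<zeta>\<close> in \<open>nu\<close> is
  what remains of the ball after the substitution \<open>x = (norm \<zeta> * \<tau>, \<zeta>)\<close>.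
\<close>

definition mu :: "V measure" where
  "mu = uniform_measure lborel (ball 0 1)"

definition kap :: "real measure" where
  "kap = density lborel (\<lambda>\<tau>. ennreal (4 / pi * (1 / (1 + \<tau>\<^sup>2)\<^sup>2)) * indicator {0..} \<tau>)"

definition nu :: "(real^3) measure" where
  "nu = density lborel (\<lambda>\<zeta>. ennreal (norm \<zeta> / wt3) * indicator (ball 0 1) \<zeta>)"

lemma sets_mu [simp, measurable_cong]: "sets mu = sets borel" by (simp add: mu_def)
lemma sets_kap [simp, measurable_cong]: "sets kap = sets borel" by (simp add: kap_def)
lemma sets_nu [simp, measurable_cong]: "sets nu = sets borel" by (simp add: nu_def)
lemma space_mu [simp]: "space mu = UNIV" by (simp add: mu_def)
lemma space_kap [simp]: "space kap = UNIV" by (simp add: kap_def)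
lemma space_nu [simp]: "space nu = UNIV" by (simp add: nu_def)

lemma wt3: "wt3 > 0" "(\<integral>\<^sup>+\<zeta>. ennreal (norm \<zeta>) * indicator (ball 0 1) \<zeta> \<partial>(lborel :: (real^3) measure)) = ennreal wt3"
proof -
  let ?I = "\<integral>\<^sup>+\<zeta>. ennreal (norm \<zeta>) * indicator (ball 0 1) \<zeta> \<partial>(lborel :: (real^3) measure)"
  have "?I \<le> (\<integral>\<^sup>+\<zeta>. indicator (ball 0 1) \<zeta> \<partial>(lborel :: (real^3) measure))"
    by (intro nn_integral_mono) (auto simp: indicator_def dist_norm)
  also have "\<dots> = emeasure lborel (ball (0::real^3) 1)" by simp
  also have "\<dots> < \<infinity>" using emeasure_bounded_finite[OF bounded_ball] by blast
  finally have fin: "?I < \<infinity>" .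
  have "?I \<noteq> 0"
  proof
    assume "?I = 0"
    then have "AE \<zeta> in (lborel :: (real^3) measure). ennreal (norm \<zeta>) * indicator (ball 0 1) \<zeta> = 0"
      by (subst (asm) nn_integral_0_iff_AE) auto
    with AE_lborel_nonzero[where 'a="real^3"] have "AE \<zeta> in (lborel :: (real^3) measure). \<zeta> \<notin> ball 0 1"
      by eventually_elim (auto simp: indicator_def split: if_splits)
    then have "emeasure lborel (ball (0::real^3) 1) = 0"
      by (rule AE_iff_measurable[THEN iffD1, rotated 2]) auto
    moreover have "unit_ball_vol 3 \<noteq> 0" using unit_ball_vol_pos[of 3] by linarith
    ultimately show False by (simp add: emeasure_ball)
  qed
  with fin show "?I = ennreal wt3" "wt3 > 0"
    by (auto simp: wt3_def enn2real_positive_iff less_top zero_less_iff_neq_zero)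
qed

lemma kap_total: "(\<integral>\<^sup>+\<tau>. ennreal (4 / pi * (1 / (1 + \<tau>\<^sup>2)\<^sup>2)) * indicator {0..} \<tau> \<partial>lborel) = 1"
proof -
  let ?F = "\<lambda>\<tau>::real. 2 / pi * (arctan \<tau> + \<tau> / (1 + \<tau>\<^sup>2))"
  have nz: "1 + x\<^sup>2 \<noteq> 0" for x :: real by (smt (verit) zero_le_power2)
  have D: "(?F has_real_derivative 4 / pi * (1 / (1 + x\<^sup>2)\<^sup>2)) (at x)" for x
  proof -
    define s where "s = 1 + x\<^sup>2"
    have s: "s \<noteq> 0" "x * x = s - 1" using nz[of x] by (auto simp: s_def power2_eq_square)
    have "((\<lambda>\<tau>. \<tau> / (1 + \<tau>\<^sup>2)) has_real_derivative (1 * (1 + x\<^sup>2) - x * (2 * x)) / ((1 + x\<^sup>2) * (1 + x\<^sup>2))) (at x)"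
      by (rule DERIV_divide) (use nz[of x] in \<open>auto intro!: derivative_eq_intros\<close>)
    from DERIV_cmult[OF DERIV_add[OF DERIV_arctan this], of "2 / pi"]
    have "(?F has_real_derivative 2 / pi * (inverse s + (1 * s - x * (2 * x)) / (s * s))) (at x)"
      by (simp only: s_def)
    also have "2 / pi * (inverse s + (1 * s - x * (2 * x)) / (s * s)) = 4 / pi * (1 / s\<^sup>2)"
    proof -
      have "1 * s - x * (2 * x) = 2 - s" using s(2) by (simp add: algebra_simps)
      then have "inverse s + (1 * s - x * (2 * x)) / (s * s) = 2 * (1 / s\<^sup>2)"
        using s(1) by (simp add: field_simps power2_eq_square)
      then show ?thesis by simp
    qed
    finally show ?thesis by (simp only: s_def)
  qed
  have "((\<lambda>\<tau>::real. \<tau> / (1 + \<tau>\<^sup>2)) \<longlongrightarrow> 0) at_top" by real_asymp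
  then have "(?F \<longlongrightarrow> 2 / pi * (pi / 2 + 0)) at_top"
    by (intro tendsto_intros tendsto_arctan_at_top)
  then have L: "(?F \<longlongrightarrow> 1) at_top" by simp
  have "(\<integral>\<^sup>+\<tau>. ennreal (4 / pi * (1 / (1 + \<tau>\<^sup>2)\<^sup>2)) * indicator {0..} \<tau> \<partial>lborel) = ennreal (1 - ?F 0)"
    by (rule nn_integral_FTC_atLeast[OF _ D _ L]) auto
  then show ?thesis by simp
qed

lemma prob_space_kap: "prob_space kap"
  by (rule prob_spaceI) (use kap_total in \<open>simp add: kap_def emeasure_density\<close>)

lemma prob_space_nu: "prob_space nu"
proof (rule prob_spaceI)
  have "emeasure nu (space nu) = (\<integral>\<^sup>+\<zeta>. ennreal (1 / wt3) * (ennreal (norm \<zeta>) * indicator (ball 0 1) \<zeta>) \<partial>(lborel :: (real^3) measure))"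
    using wt3(1) by (simp add: nu_def emeasure_density ennreal_mult[symmetric] mult.assoc[symmetric])
  also have "\<dots> = ennreal (1 / wt3) * ennreal wt3"
    by (subst nn_integral_cmult) (simp_all add: wt3)
  also have "\<dots> = 1" using wt3(1) by (simp add: ennreal_mult[symmetric])
  finally show "emeasure nu (space nu) = 1" .
qed

lemma prob_space_mu: "prob_space mu"
  unfolding mu_def
proof (rule prob_space_uniform_measure)
  have "unit_ball_vol 4 \<noteq> 0" using unit_ball_vol_pos[of 4] by linarith
  then show "emeasure lborel (ball (0::V) 1) \<noteq> 0" by (simp add: emeasure_ball)
  show "emeasure lborel (ball (0::V) 1) \<noteq> \<infinity>"
    using emeasure_bounded_finite[OF bounded_ball, of "0::V" 1] by simp
qed

interpretation mu: prob_space mu by (rule prob_space_mu)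
interpretation kap: prob_space kap by (rule prob_space_kap)
interpretation nu: prob_space nu by (rule prob_space_nu)

lemma nn_polar':
  fixes F :: "V \<Rightarrow> ennreal"
  assumes [measurable]: "F \<in> borel_measurable borel"
  shows "(\<integral>\<^sup>+x. F (sgn x) \<partial>mu) =
    (\<integral>\<^sup>+\<tau>. (\<integral>\<^sup>+\<zeta>. (F (Th \<tau> (sgn \<zeta>)) + F (Th (-\<tau>) (sgn \<zeta>))) / 2 \<partial>nu) \<partial>kap)"
proof -
  define H where "H \<tau> \<zeta> = F (Th \<tau> (sgn \<zeta>)) + F (Th (-\<tau>) (sgn \<zeta>))" for \<tau> \<zeta>
  have [measurable]: "(\<lambda>(\<tau>, \<zeta>). H \<tau> \<zeta>) \<in> borel_measurable (borel \<Otimes>\<^sub>M borel)"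
    unfolding H_def by measurable
  let ?w = "\<lambda>\<tau>::real. ennreal (1 / (1 + \<tau>\<^sup>2)\<^sup>2) * indicator {0..} \<tau>"
  let ?v = "\<lambda>\<zeta>::real^3. ennreal (norm \<zeta>) * indicator (ball 0 1) \<zeta>"
  have w: "ennreal (4 / pi * (1 / (1 + \<tau>\<^sup>2)\<^sup>2)) * indicator {0..} \<tau> = ennreal (4 / pi) * ?w \<tau>" for \<tau>
    by (simp add: ennreal_mult mult.assoc del: times_divide_eq_left times_divide_eq_right)
  have w': "ennreal (4 / pi * (1 / (1 + \<tau>\<^sup>2)\<^sup>2)) = ennreal (4 / pi) * ennreal (1 / (1 + \<tau>\<^sup>2)\<^sup>2)" for \<tau> :: real
    by (simp add: ennreal_mult del: times_divide_eq_left times_divide_eq_right)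
  have v: "ennreal (norm \<zeta> / wt3) * indicator (ball 0 1) \<zeta> = ennreal (1 / wt3) * ?v \<zeta>" for \<zeta>
    using wt3(1) by (simp add: ennreal_mult[symmetric] mult.assoc[symmetric])
  have R: "(\<integral>\<^sup>+\<tau>. (\<integral>\<^sup>+\<zeta>. H \<tau> \<zeta> / 2 \<partial>nu) \<partial>kap) =
    ennreal (4 / pi) * (ennreal (1 / wt3) * ((\<integral>\<^sup>+\<tau>. ?w \<tau> * (\<integral>\<^sup>+\<zeta>. H \<tau> \<zeta> * ?v \<zeta> \<partial>lborel) \<partial>lborel) / 2))"
  proof -
    have i: "(\<integral>\<^sup>+\<zeta>. H \<tau> \<zeta> / 2 \<partial>nu) = ennreal (1 / wt3) * (\<integral>\<^sup>+\<zeta>. H \<tau> \<zeta> * ?v \<zeta> \<partial>lborel) / 2" for \<tau>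
    proof -
      have "(\<integral>\<^sup>+\<zeta>. H \<tau> \<zeta> / 2 \<partial>nu) = (\<integral>\<^sup>+\<zeta>. H \<tau> \<zeta> \<partial>nu) / 2"
        by (rule nn_integral_divide) measurable
      also have "(\<integral>\<^sup>+\<zeta>. H \<tau> \<zeta> \<partial>nu) = (\<integral>\<^sup>+\<zeta>. ennreal (1 / wt3) * (H \<tau> \<zeta> * ?v \<zeta>) \<partial>lborel)"
        unfolding nu_def by (subst nn_integral_density) (auto simp: v mult_ac)
      also have "\<dots> = ennreal (1 / wt3) * (\<integral>\<^sup>+\<zeta>. H \<tau> \<zeta> * ?v \<zeta> \<partial>lborel)"
        by (rule nn_integral_cmult) measurable
      finally show ?thesis .
    qed
    have "(\<integral>\<^sup>+\<tau>. (\<integral>\<^sup>+\<zeta>. H \<tau> \<zeta> / 2 \<partial>nu) \<partial>kap) =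
      (\<integral>\<^sup>+\<tau>. ennreal (4 / pi) * (ennreal (1 / wt3) * (?w \<tau> * (\<integral>\<^sup>+\<zeta>. H \<tau> \<zeta> * ?v \<zeta> \<partial>lborel) / 2)) \<partial>lborel)"
      unfolding i unfolding kap_def
      by (subst nn_integral_density, measurable, intro nn_integral_cong) (simp only: w' mult_ac divide_ennreal_def)
    also have "\<dots> = ennreal (4 / pi) * (ennreal (1 / wt3) * ((\<integral>\<^sup>+\<tau>. ?w \<tau> * (\<integral>\<^sup>+\<zeta>. H \<tau> \<zeta> * ?v \<zeta> \<partial>lborel) \<partial>lborel) / 2))"
      by (subst nn_integral_cmult, measurable, subst nn_integral_cmult, measurable, subst nn_integral_divide, measurable)
    finally show ?thesis .
  qed
  have L: "(\<integral>\<^sup>+x. F (sgn x) \<partial>mu) = (\<integral>\<^sup>+\<tau>. ?w \<tau> * (\<integral>\<^sup>+\<zeta>. H \<tau> \<zeta> * ?v \<zeta> \<partial>lborel) \<partial>lborel) / emeasure lborel (ball (0::V) 1)"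
    unfolding mu_def by (subst nn_integral_uniform_measure) (auto simp: nn_polar H_def)
  have w1: "(\<integral>\<^sup>+\<tau>. ?w \<tau> \<partial>lborel) = ennreal (pi / 4)"
  proof -
    have "ennreal (4 / pi) * (\<integral>\<^sup>+\<tau>. ?w \<tau> \<partial>lborel) = 1"
      using kap_total unfolding w by (subst (asm) nn_integral_cmult) auto
    then have "ennreal (pi / 4) * (ennreal (4 / pi) * (\<integral>\<^sup>+\<tau>. ?w \<tau> \<partial>lborel)) = ennreal (pi / 4)" by simp
    then show ?thesis by (simp add: mult.assoc[symmetric] ennreal_mult[symmetric])
  qed
  \<comment> \<open>The volume is obtained from the polar formula itself with constant integrand, so
    the normalising constants of \<open>mu\<close>, \<open>kap\<close> and \<open>nu\<close> match
    automatically.\<close>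
  have "emeasure lborel (ball (0::V) 1) = (\<integral>\<^sup>+x. (\<lambda>_. 1) (sgn x) * indicator (ball (0::V) 1) x \<partial>lborel)"
    by simp
  also have "\<dots> = (\<integral>\<^sup>+\<tau>. ?w \<tau> * (\<integral>\<^sup>+\<zeta>. 2 * ?v \<zeta> \<partial>lborel) \<partial>lborel)"
    by (subst nn_polar) (auto simp: one_add_one)
  also have "\<dots> = (\<integral>\<^sup>+\<tau>. ?w \<tau> \<partial>lborel) * (2 * ennreal wt3)"
    by (subst nn_integral_cmult, measurable, subst wt3(2), rule nn_integral_multc, measurable)
  finally have vol: "emeasure lborel (ball (0::V) 1) = ennreal (pi / 4) * (2 * ennreal wt3)"
    unfolding w1 .
  have inv: "X / (ennreal (pi / 4) * (2 * ennreal wt3)) = ennreal (4 / pi) * (ennreal (1 / wt3) * (X / 2))" for X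
  proof -
    have "ennreal (pi / 4) * (2 * ennreal wt3) = ennreal (pi / 2 * wt3)"
      using wt3(1) by (simp add: ennreal_mult[symmetric] ennreal_numeral[symmetric] del: ennreal_numeral)
    moreover have "X / ennreal (pi / 2 * wt3) = X * ennreal (2 / (pi * wt3))"
      using wt3(1) by (simp add: divide_ennreal_def inverse_ennreal field_simps)
    moreover have "ennreal (4 / pi) * (ennreal (1 / wt3) * (X / 2)) = X * ennreal (2 / (pi * wt3))"
    proof -
      have "X / 2 = X * ennreal (1/2)"
        by (metis divide_ennreal_def ennreal_numeral inverse_ennreal inverse_eq_divide zero_less_numeral zero_le_numeral)
      then show ?thesis using wt3(1)
        by (simp add: mult_ac ennreal_mult[symmetric] del: ennreal_half)
    qed
    ultimately show ?thesis by simp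
  qed
  show ?thesis unfolding L vol inv R[unfolded H_def, symmetric] H_def ..
qed

lemma norm_Th_sgn: "norm (Th \<tau> (sgn \<zeta>)) \<le> 1"
proof -
  have "norm (\<tau>, sgn \<zeta>) \<le> sqrt (1 + \<tau>\<^sup>2)"
    by (auto simp: norm_prod_def norm_sgn intro!: real_sqrt_le_mono)
  then show ?thesis
    unfolding Th_def norm_scaleR using sqrt1_pos[of \<tau>] by (simp add: field_simps)
qed

text \<open>Adding the bound \<open>K\<close> reduces this to the nonnegative case. As
  \<open>F\<close> is only bounded on the unit ball, the shifted function is cut off outside it,
  where neither side looks.\<close>

lemma polar:
  fixes F :: "V \<Rightarrow> real"
  assumes [measurable]: "F \<in> borel_measurable borel" and bd: "\<And>x. norm x \<le> 1 \<Longrightarrow> \<bar>F x\<bar> \<le> K"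
  shows "(\<integral>x. F (sgn x) \<partial>mu) =
    (\<integral>\<tau>. (\<integral>\<zeta>. (F (Th \<tau> (sgn \<zeta>)) + F (Th (-\<tau>) (sgn \<zeta>))) / 2 \<partial>nu) \<partial>kap)"
proof -
  define G where "G x = (if norm x \<le> 1 then F x + K else 0)" for x
  have K: "K \<ge> 0" using bd[of 0] by simp
  have G [measurable]: "G \<in> borel_measurable borel" unfolding G_def by measurable
  have G0: "0 \<le> G x" "G x \<le> 2 * K" for x
    using bd[of x] K by (auto simp: G_def abs_le_iff)
  have Gabs: "\<bar>G x\<bar> \<le> 2 * K" for x using G0[of x] by simp
  have s1: "norm (sgn x) \<le> 1" for x :: V by (simp add: norm_sgn)
  have GF: "G (sgn x) = F (sgn x) + K" for x by (simp add: G_def s1)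
  have GT: "G (Th \<tau> (sgn \<zeta>)) = F (Th \<tau> (sgn \<zeta>)) + K" for \<tau> \<zeta> by (simp add: G_def norm_Th_sgn)
  let ?H = "\<lambda>\<tau> \<zeta>. (G (Th \<tau> (sgn \<zeta>)) + G (Th (-\<tau>) (sgn \<zeta>))) / 2"
  have H: "0 \<le> ?H \<tau> \<zeta>" "?H \<tau> \<zeta> \<le> 2 * K" for \<tau> \<zeta>
    using G0[of "Th \<tau> (sgn \<zeta>)"] G0[of "Th (-\<tau>) (sgn \<zeta>)"] by auto
  have Hi: "integrable nu (?H \<tau>)" for \<tau>
    by (rule nu.integrable_const_bound[where B="2*K"]) (use H in auto)
  have Hm [measurable]: "(\<lambda>\<tau>. \<integral>\<zeta>. ?H \<tau> \<zeta> \<partial>nu) \<in> borel_measurable borel"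
    by measurable
  have H2: "0 \<le> (\<integral>\<zeta>. ?H \<tau> \<zeta> \<partial>nu)" "(\<integral>\<zeta>. ?H \<tau> \<zeta> \<partial>nu) \<le> 2 * K" for \<tau>
     apply (rule integral_nonneg_AE, rule AE_I2, rule H(1))
    apply (rule nu.integral_le_const[OF Hi], rule AE_I2, rule H(2))
    done
  have "ennreal (\<integral>x. G (sgn x) \<partial>mu) = (\<integral>\<^sup>+x. ennreal (G (sgn x)) \<partial>mu)"
    by (rule nn_integral_eq_integral[symmetric], rule mu.integrable_const_bound[where B="2*K"]) (simp_all only: real_norm_def Gabs G0 AE_I2, measurable)
  also have "\<dots> = (\<integral>\<^sup>+\<tau>. (\<integral>\<^sup>+\<zeta>. (ennreal (G (Th \<tau> (sgn \<zeta>))) + ennreal (G (Th (-\<tau>) (sgn \<zeta>)))) / 2 \<partial>nu) \<partial>kap)"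
    by (rule nn_polar') measurable
  also have "\<dots> = (\<integral>\<^sup>+\<tau>. (\<integral>\<^sup>+\<zeta>. ennreal (?H \<tau> \<zeta>) \<partial>nu) \<partial>kap)"
    by (intro nn_integral_cong) (simp add: G0 ennreal_plus[symmetric] divide_ennreal[symmetric] del: ennreal_plus)
  also have "\<dots> = (\<integral>\<^sup>+\<tau>. ennreal (\<integral>\<zeta>. ?H \<tau> \<zeta> \<partial>nu) \<partial>kap)"
    by (intro nn_integral_cong nn_integral_eq_integral Hi) (use H in auto)
  also have "\<dots> = ennreal (\<integral>\<tau>. (\<integral>\<zeta>. ?H \<tau> \<zeta> \<partial>nu) \<partial>kap)"
    by (rule nn_integral_eq_integral)
       (use H2 in \<open>auto intro!: kap.integrable_const_bound[where B="2*K"]\<close>)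
  finally have "(\<integral>x. G (sgn x) \<partial>mu) = (\<integral>\<tau>. (\<integral>\<zeta>. ?H \<tau> \<zeta> \<partial>nu) \<partial>kap)"
    by (subst (asm) ennreal_inj) (use G0 H2 in \<open>auto intro!: integral_nonneg_AE\<close>)
  moreover have "(\<integral>x. G (sgn x) \<partial>mu) = (\<integral>x. F (sgn x) \<partial>mu) + K"
  proof -
    have Fs: "\<bar>F (sgn x)\<bar> \<le> K" for x by (rule bd[OF s1])
    have "integrable mu (\<lambda>x. F (sgn x))"
      by (rule mu.integrable_const_bound[where B=K]) (simp_all only: real_norm_def Fs AE_I2, measurable)
    then show ?thesis unfolding GF using mu.prob_space by simp
  qed
  moreover have "(\<integral>\<tau>. (\<integral>\<zeta>. ?H \<tau> \<zeta> \<partial>nu) \<partial>kap) =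
    (\<integral>\<tau>. (\<integral>\<zeta>. (F (Th \<tau> (sgn \<zeta>)) + F (Th (-\<tau>) (sgn \<zeta>))) / 2 \<partial>nu) \<partial>kap) + K"
  proof -
    let ?F = "\<lambda>\<tau> \<zeta>. (F (Th \<tau> (sgn \<zeta>)) + F (Th (-\<tau>) (sgn \<zeta>))) / 2"
    have avg: "\<bar>(a + b) / 2\<bar> \<le> K" if "\<bar>a\<bar> \<le> K" "\<bar>b\<bar> \<le> K" for a b :: real
      using that by (intro abs_leI) (auto simp: abs_le_iff field_simps)
    have Fb: "\<bar>?F \<tau> \<zeta>\<bar> \<le> K" for \<tau> \<zeta>
      by (rule avg[OF bd[OF norm_Th_sgn[of \<tau> \<zeta>]] bd[OF norm_Th_sgn[of "-\<tau>" \<zeta>]]])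
    have Fi: "integrable nu (?F \<tau>)" for \<tau>
      by (rule nu.integrable_const_bound[where B=K]) (use Fb in auto)
    have "?H \<tau> \<zeta> = ?F \<tau> \<zeta> + K" for \<tau> \<zeta> unfolding GT by simp
    then have HF: "?H \<tau> = (\<lambda>\<zeta>. ?F \<tau> \<zeta> + K)" for \<tau> by blast
    have "(\<integral>\<zeta>. ?H \<tau> \<zeta> \<partial>nu) = (\<integral>\<zeta>. ?F \<tau> \<zeta> \<partial>nu) + K" for \<tau>
      unfolding HF by (subst Bochner_Integration.integral_add[OF Fi])
        (use nu.prob_space in simp_all)
    moreover have "integrable kap (\<lambda>\<tau>. \<integral>\<zeta>. ?F \<tau> \<zeta> \<partial>nu)"
    proof (rule kap.integrable_const_bound[where B=K])
      show "AE \<tau> in kap. norm (\<integral>\<zeta>. ?F \<tau> \<zeta> \<partial>nu) \<le> K"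
      proof (rule AE_I2)
        fix \<tau>
        have "norm (\<integral>\<zeta>. ?F \<tau> \<zeta> \<partial>nu) \<le> (\<integral>\<zeta>. norm (?F \<tau> \<zeta>) \<partial>nu)" by (rule integral_norm_bound)
        also have "\<dots> \<le> K" using Fb by (intro nu.integral_le_const integrable_norm Fi) auto
        finally show "norm (\<integral>\<zeta>. ?F \<tau> \<zeta> \<partial>nu) \<le> K" .
      qed
    qed measurable
    ultimately show ?thesis
      by (simp only:) (subst Bochner_Integration.integral_add, use kap.prob_space in simp_all)
  qed
  ultimately show ?thesis by linarith
qed

lemma mu_rotation:
  fixes T :: "V \<Rightarrow> V"
  assumes [measurable]: "T \<in> borel_measurable borel" "F \<in> borel_measurable borel"
    and i: "\<And>x y. inner (T x) (T y) = inner x y" and d: "distr lborel borel T = lborel"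
  shows "(\<integral>x. F (T x) \<partial>mu) = (\<integral>x. (F x :: real) \<partial>mu)"
proof -
  have n: "norm (T x) = norm x" for x by (simp add: norm_eq_sqrt_inner i)
  have "distr mu borel T = mu"
  proof (rule measure_eqI)
    fix A :: "V set" assume "A \<in> sets (distr mu borel T)"
    then have A [measurable]: "A \<in> sets borel" by simp
    have "T -` A \<inter> space lborel \<in> sets lborel" by measurable
    then have TA [measurable]: "T -` A \<in> sets borel" by simp
    have "ball 0 1 \<inter> T -` A = T -` (ball 0 1 \<inter> A)"
      by (rule Set.set_eqI) (simp only: Int_iff vimage_eq mem_ball_0 n)
    then have "emeasure lborel (ball 0 1 \<inter> T -` A) = emeasure (distr lborel borel T) (ball 0 1 \<inter> A)"
      by (subst emeasure_distr) auto
    then show "emeasure (distr mu borel T) A = emeasure mu A"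
      by (simp add: emeasure_distr mu_def d)
  qed simp
  then have "(\<integral>x. F x \<partial>mu) = (\<integral>x. F x \<partial>distr mu borel T)" by simp
  also have "\<dots> = (\<integral>x. F (T x) \<partial>mu)" by (rule integral_distr) auto
  finally show ?thesis by simp
qed

lemma AE_mu_nonzero: "AE x in mu. x \<noteq> 0"
  unfolding mu_def by (rule AE_uniform_measureI) (use AE_lborel_nonzero[where 'a=V] in auto)

lemma AE_kap_nonneg: "AE x in kap. 0 \<le> x"
  unfolding kap_def by (subst AE_density) (auto simp: indicator_def split: if_splits)

section \<open>Moments of the sphere\<close>

lemma measurable_sgn_V [measurable]: "(sgn :: 'a::euclidean_space \<Rightarrow> 'a) \<in> borel_measurable borel"
  unfolding sgn_div_norm[abs_def] by measurable

lemma bounded_on_unit: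
  fixes F :: "V \<Rightarrow> real"
  assumes "continuous_on UNIV F"
  obtains K where "\<And>x. norm x \<le> 1 \<Longrightarrow> \<bar>F x\<bar> \<le> K"
proof -
  have "compact (F ` cball 0 1)"
    by (rule compact_continuous_image[OF continuous_on_subset[OF assms] compact_cball]) (rule subset_UNIV)
  then have "bounded (F ` cball 0 1)" by (rule compact_imp_bounded)
  then obtain K where K: "\<And>y. y \<in> F ` cball 0 1 \<Longrightarrow> norm y \<le> K" unfolding bounded_iff by blast
  show thesis
  proof (rule that)
    fix x :: V assume "norm x \<le> 1"
    then have "x \<in> cball 0 1" unfolding mem_cball_0 .
    from K[OF imageI[OF this]] show "\<bar>F x\<bar> \<le> K" unfolding real_norm_def .
  qed
qed

lemma integrable_mu_cont [intro]:
  fixes F :: "V \<Rightarrow> real"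
  assumes "continuous_on UNIV F"
  shows "integrable mu (\<lambda>x. F (sgn x))"
proof -
  obtain K where K: "\<And>x. norm x \<le> 1 \<Longrightarrow> \<bar>F x\<bar> \<le> K" using bounded_on_unit[OF assms] by blast
  have n: "norm (sgn x) \<le> 1" for x :: V by (simp add: norm_sgn)
  have [measurable]: "F \<in> borel_measurable borel" by (rule borel_measurable_continuous_onI[OF assms])
  have "norm (F (sgn x)) \<le> K" for x unfolding real_norm_def by (rule K[OF n])
  then show ?thesis by (intro mu.integrable_const_bound[where B=K] AE_I2) measurable
qed

lemma mu_direction:
  fixes \<phi> :: "real \<Rightarrow> real" and y :: V
  assumes [measurable]: "\<phi> \<in> borel_measurable borel"
  shows "(\<integral>x. \<phi> (inner (sgn x) y) \<partial>mu) = (\<integral>x. \<phi> (norm y * fst (sgn x)) \<partial>mu)"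
proof -
  have "norm (norm y, 0::real^3) = norm y" by (simp add: norm_prod_def)
  then obtain T :: "V \<Rightarrow> V" where T: "linear T" "T \<in> borel_measurable borel" "\<And>x y. inner (T x) (T y) = inner x y"
    "T (norm y, 0) = y" "distr lborel borel T = lborel"
    using rotation_V[of "(norm y, 0)" y] by blast
  have nT: "norm (T x) = norm x" for x by (simp add: norm_eq_sqrt_inner T(3))
  have sT: "sgn (T x) = T (sgn x)" for x
    by (simp only: sgn_div_norm nT linear_scale[OF T(1)])
  have "(\<integral>x. \<phi> (inner (sgn x) y) \<partial>mu) = (\<integral>x. \<phi> (inner (sgn (T x)) y) \<partial>mu)"
    by (rule mu_rotation[symmetric, where F="\<lambda>x. \<phi> (inner (sgn x) y)"]) (use T in \<open>auto intro: measurable_compose\<close>)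
  moreover have "inner (sgn (T x)) y = norm y * fst (sgn x)" for x
  proof -
    have "inner (sgn (T x)) y = inner (T (sgn x)) (T (norm y, 0))" by (simp only: sT T(4))
    also have "\<dots> = inner (sgn x) (norm y, 0)" by (rule T(3))
    finally show ?thesis by (simp add: inner_prod_def)
  qed
  ultimately show ?thesis by simp
qed

lemma moment_direction:
  fixes y :: V
  shows "(\<integral>x. inner (sgn x) y ^ (2 * k) \<partial>mu) = (inner y y) ^ k * (\<integral>x. fst (sgn x) ^ (2 * k) \<partial>mu)"
proof -
  have "(\<integral>x. inner (sgn x) y ^ (2 * k) \<partial>mu) = (\<integral>x. (norm y * fst (sgn x)) ^ (2 * k) \<partial>mu)"
    by (rule mu_direction[where \<phi>="\<lambda>z. z ^ (2 * k)"]) measurable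
  also have "\<dots> = (\<integral>x. (inner y y) ^ k * fst (sgn x) ^ (2 * k) \<partial>mu)"
    by (simp add: power_mult_distrib power_mult power2_norm_eq_inner)
  finally show ?thesis by simp
qed

definition crd :: "nat \<Rightarrow> V" where
  "crd i = (if i = 0 then (1, 0) else if i = 1 then (0, axis 1 1) else if i = 2 then (0, axis 2 1) else (0, axis 3 1))"

lemma inner_crd:
  assumes "i < 4" "j < 4"
  shows "inner (crd i) (crd j) = (if i = j then 1 else 0)"
proof -
  have "i = 0 \<or> i = 1 \<or> i = 2 \<or> i = 3" "j = 0 \<or> j = 1 \<or> j = 2 \<or> j = 3" using assms by arith+
  then show ?thesis by (elim disjE) (simp_all add: crd_def inner_prod_def inner_axis_axis)
qed

lemma sum_crd: "(inner x (crd 0))\<^sup>2 + (inner x (crd 1))\<^sup>2 + (inner x (crd 2))\<^sup>2 + (inner x (crd 3))\<^sup>2 = inner x x"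
  by (simp add: crd_def inner_prod_def inner_axis inner_vec_def sum_3 power2_eq_square axis_def)

lemma AE_inner_sgn: "AE x in mu. inner (sgn x) (sgn x) = 1"
  using AE_mu_nonzero by eventually_elim (simp only: power2_norm_eq_inner[symmetric] norm_sgn, simp)

lemma power_sums46:
  fixes a b c d :: real
  shows "(a ^ 4 + b ^ 4 + c ^ 4 + d ^ 4) * (a\<^sup>2 + b\<^sup>2 + c\<^sup>2 + d\<^sup>2) = (a ^ 6 + b ^ 6 + c ^ 6 + d ^ 6) +
    ((a ^ 4 * b\<^sup>2 + a\<^sup>2 * b ^ 4) + (a ^ 4 * c\<^sup>2 + a\<^sup>2 * c ^ 4) + (a ^ 4 * d\<^sup>2 + a\<^sup>2 * d ^ 4) +
     (b ^ 4 * c\<^sup>2 + b\<^sup>2 * c ^ 4) + (b ^ 4 * d\<^sup>2 + b\<^sup>2 * d ^ 4) + (c ^ 4 * d\<^sup>2 + c\<^sup>2 * d ^ 4))"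
proof -
  have 6: "x ^ 6 = x ^ 4 * x\<^sup>2" for x :: real by (simp flip: power_add)
  show ?thesis unfolding 6 by (simp only: distrib_left distrib_right add_ac mult_ac)
qed

text \<open>By rotation invariance every unit vector has the same moments \<open>c2\<close>,
  \<open>c4\<close>, \<open>c6\<close>. Applying this to sums and differences of two coordinate
  vectors, of squared length 2, expresses the mixed moments through the pure ones; multiplying by
  the sum of the squared coordinates, which is 1, then gives \<open>c2 = 2 * c4\<close> and
  \<open>4 * c4 = 32 / 5 * c6\<close>.\<close>

lemma moments:
  shows moment2: "(\<integral>x. (fst (sgn x))\<^sup>2 \<partial>mu) = 1/4"
    and moment4: "(\<integral>x. fst (sgn x) ^ 4 \<partial>mu) = 1/8"
    and moment6: "(\<integral>x. fst (sgn x) ^ 6 \<partial>mu) = 5/64"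
proof -
  define a where "a i x = inner (sgn x) (crd i)" for i and x :: V
  define c2 c4 c6 where "c2 = (\<integral>x. (fst (sgn x))\<^sup>2 \<partial>mu)" and "c4 = (\<integral>x. fst (sgn x) ^ 4 \<partial>mu)"
    and "c6 = (\<integral>x. fst (sgn x) ^ 6 \<partial>mu)"
  have m2: "(\<integral>x. (inner (sgn x) y)\<^sup>2 \<partial>mu) = inner y y * c2" for y
    using moment_direction[of y 1] by (simp add: c2_def)
  have m4: "(\<integral>x. (inner (sgn x) y)^4 \<partial>mu) = (inner y y)\<^sup>2 * c4" for y
    using moment_direction[of y 2] by (simp add: c4_def)
  have m6: "(\<integral>x. (inner (sgn x) y)^6 \<partial>mu) = (inner y y)^3 * c6" for y
    using moment_direction[of y 3] by (simp add: c6_def)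
  have ci: "inner (crd i) (crd i) = 1" if "i < 4" for i using inner_crd[OF that that] by simp
  have cp: "inner (crd i + crd j) (crd i + crd j) = 2" "inner (crd i - crd j) (crd i - crd j) = 2"
    if "i < 4" "j < 4" "i \<noteq> j" for i j
    using inner_crd[of i j] inner_crd[of j i] ci[of i] ci[of j] that
    by (simp_all add: inner_add_left inner_add_right inner_diff_left inner_diff_right)
  have int: "integrable mu (\<lambda>x. a i x ^ m * a j x ^ n)" for i j m n
    unfolding a_def by (rule integrable_mu_cont) (intro continuous_intros)
  have int1: "integrable mu (\<lambda>x. a i x ^ m)" for i m
    unfolding a_def by (rule integrable_mu_cont) (intro continuous_intros)
  have s1: "AE x in mu. (a 0 x)\<^sup>2 + (a 1 x)\<^sup>2 + (a 2 x)\<^sup>2 + (a 3 x)\<^sup>2 = 1"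
    using AE_inner_sgn by eventually_elim (simp only: a_def sum_crd)
  have E2: "(\<integral>x. (a i x)\<^sup>2 \<partial>mu) = c2" if "i < 4" for i unfolding a_def m2 by (simp add: ci that)
  have E4: "(\<integral>x. a i x ^ 4 \<partial>mu) = c4" if "i < 4" for i unfolding a_def m4 by (simp add: ci that)
  have E6: "(\<integral>x. a i x ^ 6 \<partial>mu) = c6" if "i < 4" for i unfolding a_def m6 by (simp add: ci that)
  have "1 = (\<integral>x. (a 0 x)\<^sup>2 + (a 1 x)\<^sup>2 + (a 2 x)\<^sup>2 + (a 3 x)\<^sup>2 \<partial>mu)"
    using s1 mu.prob_space by (subst integral_cong_AE[where g="\<lambda>_. 1"]) (auto simp: a_def)
  also have "\<dots> = 4 * c2" by (simp add: int1 E2)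
  finally have c2: "c2 = 1/4" by simp
  have E22: "(\<integral>x. (a i x)\<^sup>2 * (a j x)\<^sup>2 \<partial>mu) = c4 / 3" if ij: "i < 4" "j < 4" "i \<noteq> j" for i j
  proof -
    have "8 * c4 = (\<integral>x. (inner (sgn x) (crd i + crd j))^4 \<partial>mu) + (\<integral>x. (inner (sgn x) (crd i - crd j))^4 \<partial>mu)"
      unfolding m4 using cp[OF ij] by simp
    also have "\<dots> = (\<integral>x. (inner (sgn x) (crd i + crd j))^4 + (inner (sgn x) (crd i - crd j))^4 \<partial>mu)"
      by (subst Bochner_Integration.integral_add) (auto intro!: integrable_mu_cont continuous_intros)
    also have "\<dots> = (\<integral>x. 2 * a i x ^ 4 + 12 * ((a i x)\<^sup>2 * (a j x)\<^sup>2) + 2 * a j x ^ 4 \<partial>mu)"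
      by (intro Bochner_Integration.integral_cong refl) (simp add: a_def inner_add_right inner_diff_right eval_nat_numeral algebra_simps)
    also have "\<dots> = 4 * c4 + 12 * (\<integral>x. (a i x)\<^sup>2 * (a j x)\<^sup>2 \<partial>mu)"
      by (simp add: int int1 E4 ij)
    finally show ?thesis by simp
  qed
  have "c2 = (\<integral>x. (a 0 x)\<^sup>2 * ((a 0 x)\<^sup>2 + (a 1 x)\<^sup>2 + (a 2 x)\<^sup>2 + (a 3 x)\<^sup>2) \<partial>mu)"
    unfolding E2[of 0, symmetric, simplified] by (rule integral_cong_AE) (use s1 in \<open>auto simp: a_def\<close>)
  also have "\<dots> = (\<integral>x. a 0 x ^ 4 + (a 0 x)\<^sup>2 * (a 1 x)\<^sup>2 + (a 0 x)\<^sup>2 * (a 2 x)\<^sup>2 + (a 0 x)\<^sup>2 * (a 3 x)\<^sup>2 \<partial>mu)"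
    by (intro Bochner_Integration.integral_cong refl) (simp add: algebra_simps power2_eq_square power4_eq_xxxx)
  also have "\<dots> = c4 + c4 / 3 + c4 / 3 + c4 / 3"
    by (simp add: int int1 E4 E22)
  finally have c4: "c4 = 1/8" using c2 by simp
  have E42: "(\<integral>x. a i x ^ 4 * (a j x)\<^sup>2 \<partial>mu) + (\<integral>x. (a i x)\<^sup>2 * a j x ^ 4 \<partial>mu) = 2 / 5 * c6"
    if ij: "i < 4" "j < 4" "i \<noteq> j" for i j
  proof -
    have "16 * c6 = (\<integral>x. (inner (sgn x) (crd i + crd j))^6 \<partial>mu) + (\<integral>x. (inner (sgn x) (crd i - crd j))^6 \<partial>mu)"
      unfolding m6 using cp[OF ij] by simp
    also have "\<dots> = (\<integral>x. (inner (sgn x) (crd i + crd j))^6 + (inner (sgn x) (crd i - crd j))^6 \<partial>mu)"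
      by (subst Bochner_Integration.integral_add) (auto intro!: integrable_mu_cont continuous_intros)
    also have "\<dots> = (\<integral>x. 2 * a i x ^ 6 + 30 * (a i x ^ 4 * (a j x)\<^sup>2) + 30 * ((a i x)\<^sup>2 * a j x ^ 4) + 2 * a j x ^ 6 \<partial>mu)"
      by (intro Bochner_Integration.integral_cong refl) (simp add: a_def inner_add_right inner_diff_right eval_nat_numeral algebra_simps)
    also have "\<dots> = 4 * c6 + 30 * ((\<integral>x. a i x ^ 4 * (a j x)\<^sup>2 \<partial>mu) + (\<integral>x. (a i x)\<^sup>2 * a j x ^ 4 \<partial>mu))"
      by (simp add: int int1 E6 ij)
    finally show ?thesis by simp
  qed
  have "4 * c4 = (\<integral>x. a 0 x ^ 4 + a 1 x ^ 4 + a 2 x ^ 4 + a 3 x ^ 4 \<partial>mu)"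
    by (simp add: int1 E4)
  also have "\<dots> = (\<integral>x. (a 0 x ^ 4 + a 1 x ^ 4 + a 2 x ^ 4 + a 3 x ^ 4) * ((a 0 x)\<^sup>2 + (a 1 x)\<^sup>2 + (a 2 x)\<^sup>2 + (a 3 x)\<^sup>2) \<partial>mu)"
    by (rule integral_cong_AE) (use s1 in \<open>auto simp: a_def\<close>)
  also have "\<dots> = (\<integral>x. (a 0 x ^ 6 + a 1 x ^ 6 + a 2 x ^ 6 + a 3 x ^ 6) +
    ((a 0 x ^ 4 * (a 1 x)\<^sup>2 + (a 0 x)\<^sup>2 * a 1 x ^ 4) + (a 0 x ^ 4 * (a 2 x)\<^sup>2 + (a 0 x)\<^sup>2 * a 2 x ^ 4) +
     (a 0 x ^ 4 * (a 3 x)\<^sup>2 + (a 0 x)\<^sup>2 * a 3 x ^ 4) + (a 1 x ^ 4 * (a 2 x)\<^sup>2 + (a 1 x)\<^sup>2 * a 2 x ^ 4) +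
     (a 1 x ^ 4 * (a 3 x)\<^sup>2 + (a 1 x)\<^sup>2 * a 3 x ^ 4) + (a 2 x ^ 4 * (a 3 x)\<^sup>2 + (a 2 x)\<^sup>2 * a 3 x ^ 4)) \<partial>mu)"
    by (intro Bochner_Integration.integral_cong refl) (rule power_sums46)
  also have "\<dots> = 4 * c6 + 6 * (2 / 5 * c6)"
    using E42[of 0 1] E42[of 0 2] E42[of 0 3] E42[of 1 2] E42[of 1 3] E42[of 2 3]
    by (simp add: int int1 E6)
  finally have c6: "c6 = 5/64" using c4 by simp
  show "(\<integral>x. (fst (sgn x))\<^sup>2 \<partial>mu) = 1/4" "(\<integral>x. fst (sgn x) ^ 4 \<partial>mu) = 1/8" "(\<integral>x. fst (sgn x) ^ 6 \<partial>mu) = 5/64"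
    using c2 c4 c6 by (auto simp: c2_def c4_def c6_def)
qed

lemma inner_moments:
  fixes y :: V
  shows "(\<integral>x. (inner (sgn x) y)\<^sup>2 \<partial>mu) = inner y y / 4"
    and "(\<integral>x. (inner (sgn x) y)^4 \<partial>mu) = (inner y y)\<^sup>2 / 8"
    and "(\<integral>x. (inner (sgn x) y)^6 \<partial>mu) = (inner y y)^3 * (5/64)"
proof -
  have "(\<integral>x. inner (sgn x) y ^ (2 * 1) \<partial>mu) = (inner y y) ^ 1 * (\<integral>x. fst (sgn x) ^ (2 * 1) \<partial>mu)"
    "(\<integral>x. inner (sgn x) y ^ (2 * 2) \<partial>mu) = (inner y y) ^ 2 * (\<integral>x. fst (sgn x) ^ (2 * 2) \<partial>mu)"
    "(\<integral>x. inner (sgn x) y ^ (2 * 3) \<partial>mu) = (inner y y) ^ 3 * (\<integral>x. fst (sgn x) ^ (2 * 3) \<partial>mu)"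
    by (rule moment_direction)+
  moreover have "2 * 1 = (2::nat)" "2 * 2 = (4::nat)" "2 * 3 = (6::nat)" by simp_all
  ultimately show "(\<integral>x. (inner (sgn x) y)\<^sup>2 \<partial>mu) = inner y y / 4"
    "(\<integral>x. (inner (sgn x) y)^4 \<partial>mu) = (inner y y)\<^sup>2 / 8"
    "(\<integral>x. (inner (sgn x) y)^6 \<partial>mu) = (inner y y)^3 * (5/64)"
    by (simp_all only: moment2 moment4 moment6 power_one_right times_divide_eq_right mult_1_right)
qed

lemma integral_inner11:
  "(\<integral>x. inner (sgn x) y * inner (sgn x) z \<partial>mu) = inner y z / 4" for y z :: V
proof -
  have "4 * (\<integral>x. inner (sgn x) y * inner (sgn x) z \<partial>mu) = (\<integral>x. 4 * (inner (sgn x) y * inner (sgn x) z) \<partial>mu)" by simp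
  also have "\<dots> = (\<integral>x. (inner (sgn x) (y + z))\<^sup>2 - (inner (sgn x) (y - z))\<^sup>2 \<partial>mu)"
    by (intro Bochner_Integration.integral_cong refl) (simp add: inner_add_right inner_diff_right power2_eq_square algebra_simps)
  also have "\<dots> = inner (y + z) (y + z) / 4 - inner (y - z) (y - z) / 4"
    by (subst Bochner_Integration.integral_diff)
       (auto intro!: integrable_mu_cont continuous_intros simp: inner_moments)
  also have "\<dots> = inner y z"
    using inner_commute[of y z] by (simp add: inner_add_left inner_add_right inner_diff_left inner_diff_right field_simps)
  finally show ?thesis by simp
qed

text \<open>Polarisation of the fourth moment. The value is the sum over the 3 pairings of the four
  factors, divided by \<open>4 * 6\<close>.\<close>

lemma integral_inner31:
  fixes y z :: V
  shows "(\<integral>x. (inner (sgn x) y)^3 * inner (sgn x) z \<partial>mu) = inner y y * inner y z / 8"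
proof -
  let ?a = "\<lambda>x. inner (sgn x) y" and ?b = "\<lambda>x. inner (sgn x) z"
  have p: "48 * (a^3 * b) = ((2 *a + b)^4 - (2*a - b)^4) - 2 * ((a + b)^4 - (a - b)^4)" for a b :: real
    by (simp add: eval_nat_numeral algebra_simps)
  have "48 * (\<integral>x. (?a x)^3 * ?b x \<partial>mu) = (\<integral>x. 48 * ((?a x)^3 * ?b x) \<partial>mu)" by simp
  also have "\<dots> = (\<integral>x. (inner (sgn x) (2 *\<^sub>R y + z)^4 - inner (sgn x) (2 *\<^sub>R y - z)^4) -
      2 * (inner (sgn x) (y + z)^4 - inner (sgn x) (y - z)^4) \<partial>mu)"
    unfolding p by (simp add: inner_add_right inner_diff_right)
  also have "\<dots> = ((inner (2 *\<^sub>R y + z) (2 *\<^sub>R y + z))\<^sup>2 / 8 - (inner (2 *\<^sub>R y - z) (2 *\<^sub>R y - z))\<^sup>2 / 8) -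
      2 * ((inner (y + z) (y + z))\<^sup>2 / 8 - (inner (y - z) (y - z))\<^sup>2 / 8)"
    unfolding inner_moments[symmetric]
    by (subst Bochner_Integration.integral_diff Bochner_Integration.integral_mult_right | auto intro!: integrable_mu_cont continuous_intros)+
  also have "\<dots> = 6 * (inner y y * inner y z)"
  proof -
    have e: "inner (y + z) (y + z) = inner y y + inner z z + 2 * inner y z"
      "inner (y - z) (y - z) = inner y y + inner z z - 2 * inner y z"
      "inner (2 *\<^sub>R y + z) (2 *\<^sub>R y + z) = 4 * inner y y + inner z z + 4 * inner y z"
      "inner (2 *\<^sub>R y - z) (2 *\<^sub>R y - z) = 4 * inner y y + inner z z - 4 * inner y z"
      by (simp_all add: inner_simps inner_commute)
    show ?thesis unfolding e by (simp add: power2_eq_square field_simps)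
  qed
  finally show ?thesis by simp
qed

text \<open>Polarisation of the sixth moment. Of the 15 pairings of the six factors, 9 contain one
  pair \<open>y\<close>-\<open>z\<close> and 6 contain three; the normalisation is
  \<open>4 * 6 * 8 = 192\<close>.\<close>

lemma integral_inner33:
  fixes y z :: V
  shows "(\<integral>x. (inner (sgn x) y)^3 * (inner (sgn x) z)^3 \<partial>mu) = (9 * inner y y * inner z z * inner y z + 6 * (inner y z)^3) / 192"
proof -
  let ?a = "\<lambda>x. inner (sgn x) y" and ?b = "\<lambda>x. inner (sgn x) z"
  have p: "720 * (a^3 * b^3) = 34 * ((a + b)^6 - (a - b)^6) - ((2*a + b)^6 - (2*a - b)^6) - ((a + 2*b)^6 - (a - 2*b)^6)" for a b :: real
    by (simp add: eval_nat_numeral algebra_simps)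
  have "720 * (\<integral>x. (?a x)^3 * (?b x)^3 \<partial>mu) = (\<integral>x. 720 * ((?a x)^3 * (?b x)^3) \<partial>mu)" by simp
  also have "\<dots> = (\<integral>x. 34 * (inner (sgn x) (y + z)^6 - inner (sgn x) (y - z)^6) -
      (inner (sgn x) (2 *\<^sub>R y + z)^6 - inner (sgn x) (2 *\<^sub>R y - z)^6) -
      (inner (sgn x) (y + 2 *\<^sub>R z)^6 - inner (sgn x) (y - 2 *\<^sub>R z)^6) \<partial>mu)"
    unfolding p by (simp add: inner_add_right inner_diff_right)
  also have "\<dots> = 34 * ((inner (y + z) (y + z))^3 * (5/64) - (inner (y - z) (y - z))^3 * (5/64)) -
      ((inner (2 *\<^sub>R y + z) (2 *\<^sub>R y + z))^3 * (5/64) - (inner (2 *\<^sub>R y - z) (2 *\<^sub>R y - z))^3 * (5/64)) -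
      ((inner (y + 2 *\<^sub>R z) (y + 2 *\<^sub>R z))^3 * (5/64) - (inner (y - 2 *\<^sub>R z) (y - 2 *\<^sub>R z))^3 * (5/64))"
    unfolding inner_moments[symmetric]
    by (subst Bochner_Integration.integral_diff Bochner_Integration.integral_mult_right | auto intro!: integrable_mu_cont continuous_intros)+
  also have "\<dots> = 720 * ((9 * inner y y * inner z z * inner y z + 6 * (inner y z)^3) / 192)"
  proof -
    have e1: "inner (y + z) (y + z) = inner y y + inner z z + 2 * inner y z"
      "inner (y - z) (y - z) = inner y y + inner z z - 2 * inner y z"
      "inner (2 *\<^sub>R y + z) (2 *\<^sub>R y + z) = 4 * inner y y + inner z z + 4 * inner y z"
      "inner (2 *\<^sub>R y - z) (2 *\<^sub>R y - z) = 4 * inner y y + inner z z - 4 * inner y z"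
      "inner (y + 2 *\<^sub>R z) (y + 2 *\<^sub>R z) = inner y y + 4 * inner z z + 4 * inner y z"
      "inner (y - 2 *\<^sub>R z) (y - 2 *\<^sub>R z) = inner y y + 4 * inner z z - 4 * inner y z"
      by (simp_all add: inner_simps inner_commute)
    have "34 * ((a + b + 2 * c) ^ 3 * (5/64) - (a + b - 2 * c) ^ 3 * (5/64)) -
      ((4 * a + b + 4 * c) ^ 3 * (5/64) - (4 * a + b - 4 * c) ^ 3 * (5/64)) -
      ((a + 4 * b + 4 * c) ^ 3 * (5/64) - (a + 4 * b - 4 * c) ^ 3 * (5/64)) =
      720 * ((9 * a * b * c + 6 * c ^ 3) / 192)" for a b c :: real
    proof -
      have d: "(u + v) ^ 3 - (u - v) ^ 3 = 6 * (u * u * v) + 2 * (v * v * v)" for u v :: real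
        by (simp add: power3_eq_cube algebra_simps)
      show ?thesis unfolding left_diff_distrib[symmetric] d by (simp add: power3_eq_cube field_simps)
    qed
    then show ?thesis unfolding e1 .
  qed
  finally show ?thesis by simp
qed

text \<open>The reproducing kernel of the spherical harmonics of degree 3: four times the Chebyshev polynomial \<open>U\<^sub>3\<close>.\<close>

definition K3 :: "real \<Rightarrow> real" where
  "K3 s = 32 * s^3 - 16 * s"

text \<open>A direct check from the moments. At \<open>y = z\<close> the value is
  \<open>K3 1 = 16\<close>, the dimension of the space of cubic harmonics in four variables.\<close>

lemma K3_reproducing:
  fixes y z :: V
  assumes "inner y y = 1" "inner z z = 1"
  shows "(\<integral>x. K3 (inner (sgn x) y) * K3 (inner (sgn x) z) \<partial>mu) = K3 (inner y z)"
proof -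
  let ?a = "\<lambda>x. inner (sgn x) y" and ?b = "\<lambda>x. inner (sgn x) z"
  have i33: "integrable mu (\<lambda>x. (?a x)^3 * (?b x)^3)"
    by (rule integrable_mu_cont[where F="\<lambda>x. inner x y ^ 3 * inner x z ^ 3"]) (intro continuous_intros)
  have i31: "integrable mu (\<lambda>x. (?a x)^3 * ?b x)"
    by (rule integrable_mu_cont[where F="\<lambda>x. inner x y ^ 3 * inner x z"]) (intro continuous_intros)
  have i13: "integrable mu (\<lambda>x. (?b x)^3 * ?a x)"
    by (rule integrable_mu_cont[where F="\<lambda>x. inner x z ^ 3 * inner x y"]) (intro continuous_intros)
  have i11: "integrable mu (\<lambda>x. ?a x * ?b x)"
    by (rule integrable_mu_cont[where F="\<lambda>x. inner x y * inner x z"]) (intro continuous_intros)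
  have K: "K3 a * K3 b = 1024 * (a^3 * b^3) - 512 * (a^3 * b) - 512 * (b^3 * a) + 256 * (a * b)" for a b
    by (simp add: K3_def algebra_simps)
  note i = integrable_mult_right[OF i33, of 1024] integrable_mult_right[OF i31, of 512]
    integrable_mult_right[OF i13, of 512] integrable_mult_right[OF i11, of 256]
  have "(\<integral>x. K3 (?a x) * K3 (?b x) \<partial>mu) = 1024 * (\<integral>x. (?a x)^3 * (?b x)^3 \<partial>mu) - 512 * (\<integral>x. (?a x)^3 * ?b x \<partial>mu)
     - 512 * (\<integral>x. (?b x)^3 * ?a x \<partial>mu) + 256 * (\<integral>x. ?a x * ?b x \<partial>mu)"
    unfolding K Bochner_Integration.integral_add[OF Bochner_Integration.integrable_diff[OF Bochner_Integration.integrable_diff[OF i(1,2)] i(3)] i(4)]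
      Bochner_Integration.integral_diff[OF Bochner_Integration.integrable_diff[OF i(1,2)] i(3)] Bochner_Integration.integral_diff[OF i(1,2)]
      integral_mult_right_zero ..
  also have "\<dots> = K3 (inner y z)"
    unfolding integral_inner33 integral_inner31 integral_inner11 inner_commute[of z y] assms K3_def
    by (simp add: field_simps)
  finally show ?thesis .
qed

section \<open>The one-dimensional excess inequality\<close>

lemma fst_V_measurable [measurable]: "(\<lambda>x. fst (f x)) \<in> borel_measurable M"
  and snd_V_measurable [measurable]: "(\<lambda>x. snd (f x)) \<in> borel_measurable M"
  if f: "f \<in> borel_measurable M" for f :: "'a \<Rightarrow> V"
  by (intro measurable_compose[OF f] borel_measurable_continuous_onI continuous_intros)+

section \<open>Sine and cosine of the latitude, and integration against \<open>kap\<close>\<close>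

definition tt :: "real \<Rightarrow> real" where "tt \<tau> = \<tau> / sqrt (1 + \<tau>\<^sup>2)"
definition rr :: "real \<Rightarrow> real" where "rr \<tau> = 1 / sqrt (1 + \<tau>\<^sup>2)"

lemma tt_measurable [measurable]: "tt \<in> borel_measurable borel" unfolding tt_def[abs_def] by measurable
lemma rr_measurable [measurable]: "rr \<in> borel_measurable borel" unfolding rr_def[abs_def] by measurable

lemma Th_eq: "Th \<tau> \<xi> = (tt \<tau>, rr \<tau> *\<^sub>R \<xi>)"
  by (simp add: Th_def tt_def rr_def)

lemma tt_minus [simp]: "tt (- \<tau>) = - tt \<tau>" and rr_minus [simp]: "rr (- \<tau>) = rr \<tau>"
  by (simp_all add: tt_def rr_def)

lemma rr_sq: "(rr \<tau>)\<^sup>2 = 1 / (1 + \<tau>\<^sup>2)"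
  using sqrt1_pos[of \<tau>] by (simp add: rr_def power_divide)

lemma rr_4: "rr \<tau> ^ 4 = 1 / (1 + \<tau>\<^sup>2)\<^sup>2"
proof -
  have "rr \<tau> ^ 4 = ((rr \<tau>)\<^sup>2)\<^sup>2" by (simp flip: power_mult)
  then show ?thesis by (simp add: rr_sq power_divide)
qed

lemma tt_rr: "(tt \<tau>)\<^sup>2 = 1 - (rr \<tau>)\<^sup>2"
proof -
  have "1 + \<tau>\<^sup>2 \<noteq> 0" by (smt (verit) zero_le_power2)
  then show ?thesis using sqrt1_pos[of \<tau>]
    by (simp add: rr_sq tt_def power_divide field_simps)
qed

lemma rr_pos: "0 < rr \<tau>" using sqrt1_pos[of \<tau>] by (simp add: rr_def)
lemma rr_le: "rr \<tau> \<le> 1"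
proof -
  have "1 \<le> sqrt (1 + \<tau>\<^sup>2)" by simp
  then show ?thesis unfolding rr_def by (rule divide_le_eq_1_pos[THEN iffD2, OF sqrt1_pos])
qed
lemma tt_nonneg: "0 \<le> \<tau> \<Longrightarrow> 0 \<le> tt \<tau>" by (simp add: tt_def)
lemma tt_le: "tt \<tau> \<le> 1" and tt_ge: "-1 \<le> tt \<tau>"
proof -
  have "(tt \<tau>)\<^sup>2 \<le> 1" by (simp add: tt_rr)
  then have "\<bar>tt \<tau>\<bar> \<le> 1" by (simp add: abs_square_le_1)
  then show "tt \<tau> \<le> 1" "-1 \<le> tt \<tau>" by auto
qed

lemma DERIV_rr: "(rr has_real_derivative - (tt \<tau> * (rr \<tau>)\<^sup>2)) (at \<tau>)"
proof -
  have p: "1 + \<tau>\<^sup>2 > 0" by (simp add: add_pos_nonneg)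
  have s: "sqrt (1 + \<tau>\<^sup>2) * sqrt (1 + \<tau>\<^sup>2) = 1 + \<tau>\<^sup>2" using p by simp
  have d: "((\<lambda>x. sqrt (1 + x\<^sup>2)) has_real_derivative \<tau> / sqrt (1 + \<tau>\<^sup>2)) (at \<tau>)"
    using p by (auto intro!: derivative_eq_intros simp: field_simps)
  have "((\<lambda>x. inverse (sqrt (1 + x\<^sup>2))) has_real_derivative
      - (inverse (sqrt (1 + \<tau>\<^sup>2)) * (\<tau> / sqrt (1 + \<tau>\<^sup>2)) * inverse (sqrt (1 + \<tau>\<^sup>2)))) (at \<tau>)"
    by (rule DERIV_inverse'[OF d]) (use sqrt1_pos[of \<tau>] in simp)
  then show ?thesis
    unfolding rr_def[abs_def] tt_def inverse_eq_divide by (simp add: power2_eq_square field_simps)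
qed

lemma DERIV_tt: "(tt has_real_derivative rr \<tau> ^ 3) (at \<tau>)"
proof -
  have "((\<lambda>x. x * rr x) has_real_derivative 1 * rr \<tau> + (- (tt \<tau> * (rr \<tau>)\<^sup>2)) * \<tau>) (at \<tau>)"
    by (rule DERIV_mult) (auto intro!: DERIV_rr)
  moreover have "1 * rr \<tau> + (- (tt \<tau> * (rr \<tau>)\<^sup>2)) * \<tau> = rr \<tau> ^ 3"
  proof -
    have tr: "\<tau> * rr \<tau> = tt \<tau>" by (simp add: tt_def rr_def)
    have "1 * rr \<tau> + (- (tt \<tau> * (rr \<tau>)\<^sup>2)) * \<tau> = rr \<tau> * (1 - tt \<tau> * (\<tau> * rr \<tau>))"
      by (simp add: power2_eq_square algebra_simps)
    also have "\<dots> = rr \<tau> * (1 - (tt \<tau>)\<^sup>2)" unfolding tr by (simp add: power2_eq_square)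
    also have "\<dots> = rr \<tau> ^ 3" unfolding tt_rr by (simp add: power2_eq_square power3_eq_cube)
    finally show ?thesis .
  qed
  moreover have "tt = (\<lambda>x. x * rr x)" by (auto simp: tt_def rr_def)
  ultimately show ?thesis by simp
qed

lemma rr_lim: "(rr \<longlongrightarrow> 0) at_top" unfolding rr_def[abs_def] by real_asymp
lemma tt_lim: "(tt \<longlongrightarrow> 1) at_top" unfolding tt_def[abs_def] by real_asymp

lemma tt_0 [simp]: "tt 0 = 0" and rr_0 [simp]: "rr 0 = 1" by (simp_all add: tt_def rr_def)

text \<open>\<open>kap\<close> has density \<open>4 / pi * rr^4\<close>, so \<open>Q\<close> is an
  antiderivative up to the factor \<open>4 / pi\<close>. Nonnegativity of \<open>g\<close> makes
  \<open>Q\<close> increasing and yields integrability along with the value.\<close>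

lemma kap_FTC:
  assumes [measurable]: "g \<in> borel_measurable borel"
    and g0: "\<And>\<tau>. 0 \<le> \<tau> \<Longrightarrow> 0 \<le> g \<tau>"
    and Q: "\<And>\<tau>. 0 \<le> \<tau> \<Longrightarrow> (Q has_real_derivative g \<tau> * rr \<tau> ^ 4) (at \<tau>)"
    and L: "(Q \<longlongrightarrow> L) at_top"
  shows "integrable kap g" "(\<integral>\<tau>. g \<tau> \<partial>kap) = 4 / pi * (L - Q 0)"
proof -
  define c where "c = 4 / pi"
  have c: "0 \<le> c" by (simp add: c_def)
  have "(\<integral>\<^sup>+\<tau>. ennreal (g \<tau>) \<partial>kap) = (\<integral>\<^sup>+\<tau>. ennreal (c * (g \<tau> * rr \<tau> ^ 4)) * indicator {0..} \<tau> \<partial>lborel)"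
    unfolding kap_def c_def[symmetric] using c by (subst nn_integral_density)
      (auto simp: rr_4 indicator_def g0 ennreal_mult[symmetric] mult_ac intro!: nn_integral_cong)
  also have "\<dots> = ennreal (c * L - c * Q 0)"
  proof (rule nn_integral_FTC_atLeast[where F="\<lambda>\<tau>. c * Q \<tau>"])
    show "((\<lambda>\<tau>. c * Q \<tau>) has_real_derivative c * (g \<tau> * rr \<tau> ^ 4)) (at \<tau>)" if "0 \<le> \<tau>" for \<tau>
      by (rule DERIV_cmult[OF Q[OF that]])
    show "((\<lambda>\<tau>. c * Q \<tau>) \<longlongrightarrow> c * L) at_top" by (rule tendsto_mult[OF tendsto_const L])
    show "0 \<le> c * (g \<tau> * rr \<tau> ^ 4)" if "0 \<le> \<tau>" for \<tau>
      using c g0[OF that] by simp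
  qed measurable
  finally have N: "(\<integral>\<^sup>+\<tau>. ennreal (g \<tau>) \<partial>kap) = ennreal (4 / pi * (L - Q 0))" by (simp only: right_diff_distrib c_def)
  have ae: "AE \<tau> in kap. 0 \<le> g \<tau>" using AE_kap_nonneg by eventually_elim (rule g0)
  have mono: "Q 0 \<le> Q \<tau>" if "0 \<le> \<tau>" for \<tau>
    by (rule DERIV_nonneg_imp_nondecreasing[OF that]) (use Q g0 in force)
  have "Q 0 \<le> L"
    by (rule tendsto_lowerbound[OF L]) (auto intro: eventually_mono[OF eventually_ge_at_top[of 0] mono])
  then have p: "0 \<le> 4 / pi * (L - Q 0)" by simp
  show "integrable kap g"
    by (rule integrableI_nn_integral_finite[OF _ ae N]) measurable
  show "(\<integral>\<tau>. g \<tau> \<partial>kap) = 4 / pi * (L - Q 0)"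
    by (rule integral_eq_nn_integral[OF _ ae, unfolded N, simplified enn2real_ennreal[OF p]]) measurable
qed

lemma integrable_kap_bounded:
  fixes g :: "real \<Rightarrow> real"
  assumes "g \<in> borel_measurable borel" "\<And>\<tau>. \<bar>g \<tau>\<bar> \<le> K"
  shows "integrable kap g"
  by (rule kap.integrable_const_bound[where B=K]) (use assms in auto)

lemma kap_poly [intro, simp]: "integrable kap (\<lambda>\<tau>. tt \<tau> ^ m * rr \<tau> ^ n)"
proof (rule integrable_kap_bounded[where K=1])
  fix \<tau>
  have "\<bar>tt \<tau> ^ m\<bar> \<le> 1" "\<bar>rr \<tau> ^ n\<bar> \<le> 1"
    using tt_le[of \<tau>] tt_ge[of \<tau>] rr_pos[of \<tau>] rr_le[of \<tau>] by (auto simp: power_abs intro!: power_le_one)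
  then show "\<bar>tt \<tau> ^ m * rr \<tau> ^ n\<bar> \<le> 1" by (simp add: abs_mult mult_le_one)
qed measurable

text \<open>Against \<open>kap\<close>, odd powers of \<open>tt\<close> have antiderivatives that
  are polynomials in \<open>rr\<close>. For even powers an \<open>arctan\<close> would appear; these
  are read off from the moments of \<open>mu\<close> instead.\<close>

lemma kap_moments:
  shows kap_t1: "(\<integral>\<tau>. tt \<tau> \<partial>kap) = 4 / (3 * pi)"
    and kap_t3: "(\<integral>\<tau>. tt \<tau> ^ 3 \<partial>kap) = 8 / (15 * pi)"
    and kap_t5: "(\<integral>\<tau>. tt \<tau> ^ 5 \<partial>kap) = 32 / (105 * pi)"
    and kap_t2: "(\<integral>\<tau>. tt \<tau> ^ 2 \<partial>kap) = 1 / 4"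
    and kap_t4: "(\<integral>\<tau>. tt \<tau> ^ 4 \<partial>kap) = 1 / 8"
    and kap_t6: "(\<integral>\<tau>. tt \<tau> ^ 6 \<partial>kap) = 5 / 64"
proof -
  have t3: "tt \<tau> ^ 3 = tt \<tau> * (1 - (rr \<tau>)\<^sup>2)" for \<tau>
    unfolding tt_rr[symmetric] by (simp add: power3_eq_cube power2_eq_square)
  have t5: "tt \<tau> ^ 5 = tt \<tau> * (1 - (rr \<tau>)\<^sup>2)\<^sup>2" for \<tau>
    unfolding tt_rr[symmetric] by (simp add: eval_nat_numeral)
  have l: "((\<lambda>\<tau>. rr \<tau> ^ Suc n) \<longlongrightarrow> 0) at_top" for n
    using tendsto_power[OF rr_lim, of "Suc n"] by simp
  have d: "((\<lambda>\<tau>. rr \<tau> ^ n) has_real_derivative real n * (- (tt \<tau> * (rr \<tau>)\<^sup>2) * rr \<tau> ^ (n - Suc 0))) (at \<tau>)" for n \<tau>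
    by (rule DERIV_power[OF DERIV_rr])
  have "(\<integral>\<tau>. tt \<tau> \<partial>kap) = 4 / pi * (- 1 / 3 * 0 - (- 1 / 3 * rr 0 ^ 3))"
  proof (rule kap_FTC(2))
    show "((\<lambda>\<tau>. - 1 / 3 * rr \<tau> ^ 3) \<longlongrightarrow> - 1 / 3 * 0) at_top"
      using l[of 2] by (intro tendsto_intros) (simp add: numeral_3_eq_3 numeral_2_eq_2)
    show "((\<lambda>\<tau>. - 1 / 3 * rr \<tau> ^ 3) has_real_derivative tt \<tau> * rr \<tau> ^ 4) (at \<tau>)" for \<tau>
      by (rule DERIV_cong[OF DERIV_cmult[OF d[of 3 \<tau>], of "- 1 / 3"]]) (simp add: eval_nat_numeral)
  qed (auto intro: tt_nonneg)
  then show "(\<integral>\<tau>. tt \<tau> \<partial>kap) = 4 / (3 * pi)" by simp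
  have "(\<integral>\<tau>. tt \<tau> ^ 3 \<partial>kap) = 4 / pi * ((- 1 / 3 * 0 + 1 / 5 * 0) - (- 1 / 3 * rr 0 ^ 3 + 1 / 5 * rr 0 ^ 5))"
  proof (rule kap_FTC(2))
    show "((\<lambda>\<tau>. - 1 / 3 * rr \<tau> ^ 3 + 1 / 5 * rr \<tau> ^ 5) \<longlongrightarrow> - 1 / 3 * 0 + 1 / 5 * 0) at_top"
      using l[of 2] l[of 4] by (intro tendsto_intros) (simp_all add: eval_nat_numeral)
    show "((\<lambda>\<tau>. - 1 / 3 * rr \<tau> ^ 3 + 1 / 5 * rr \<tau> ^ 5) has_real_derivative tt \<tau> ^ 3 * rr \<tau> ^ 4) (at \<tau>)" for \<tau>
      unfolding t3 by (rule DERIV_cong[OF DERIV_add[OF DERIV_cmult[OF d[of 3 \<tau>], of "- 1 / 3"] DERIV_cmult[OF d[of 5 \<tau>], of "1 / 5"]]])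
        (simp add: eval_nat_numeral algebra_simps)
  qed (auto intro: tt_nonneg)
  then show "(\<integral>\<tau>. tt \<tau> ^ 3 \<partial>kap) = 8 / (15 * pi)" by simp
  have "(\<integral>\<tau>. tt \<tau> ^ 5 \<partial>kap) = 4 / pi * ((- 1 / 3 * 0 + 2 / 5 * 0 + - 1 / 7 * 0) - (- 1 / 3 * rr 0 ^ 3 + 2 / 5 * rr 0 ^ 5 + - 1 / 7 * rr 0 ^ 7))"
  proof (rule kap_FTC(2))
    show "((\<lambda>\<tau>. - 1 / 3 * rr \<tau> ^ 3 + 2 / 5 * rr \<tau> ^ 5 + - 1 / 7 * rr \<tau> ^ 7) \<longlongrightarrow> - 1 / 3 * 0 + 2 / 5 * 0 + - 1 / 7 * 0) at_top"
      using l[of 2] l[of 4] l[of 6] by (intro tendsto_intros) (simp_all add: eval_nat_numeral)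
    show "((\<lambda>\<tau>. - 1 / 3 * rr \<tau> ^ 3 + 2 / 5 * rr \<tau> ^ 5 + - 1 / 7 * rr \<tau> ^ 7) has_real_derivative tt \<tau> ^ 5 * rr \<tau> ^ 4) (at \<tau>)" for \<tau>
      unfolding t5 by (rule DERIV_cong[OF DERIV_add[OF DERIV_add[OF DERIV_cmult[OF d[of 3 \<tau>], of "- 1 / 3"] DERIV_cmult[OF d[of 5 \<tau>], of "2 / 5"]] DERIV_cmult[OF d[of 7 \<tau>], of "- 1 / 7"]]])
        (simp add: eval_nat_numeral algebra_simps)
  qed (auto intro: tt_nonneg)
  then show "(\<integral>\<tau>. tt \<tau> ^ 5 \<partial>kap) = 32 / (105 * pi)" by simp
  have ev: "(\<integral>x. fst (sgn x) ^ (2 * k) \<partial>mu) = (\<integral>\<tau>. tt \<tau> ^ (2 * k) \<partial>kap)" for k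
  proof -
    have b: "\<bar>fst x ^ (2 * k)\<bar> \<le> 1" if "norm x \<le> 1" for x :: V
    proof -
      have "\<bar>fst x\<bar> \<le> 1" using norm_fst_le[of "fst x" "snd x"] that by simp
      then show ?thesis by (simp add: power_abs power_le_one)
    qed
    have e: "(- x) ^ (2 * k) = x ^ (2 * k)" for x :: real by (simp add: power_mult)
    have "(\<integral>x. fst (sgn x) ^ (2 * k) \<partial>mu) =
      (\<integral>\<tau>. (\<integral>\<zeta>. (fst (Th \<tau> (sgn \<zeta>)) ^ (2 * k) + fst (Th (-\<tau>) (sgn \<zeta>)) ^ (2 * k)) / 2 \<partial>nu) \<partial>kap)"
      by (rule polar[where F="\<lambda>x. fst x ^ (2 * k)", OF _ b])
        (intro borel_measurable_continuous_onI continuous_intros)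
    then show ?thesis using nu.prob_space by (simp add: Th_eq e)
  qed
  show "(\<integral>\<tau>. tt \<tau> ^ 2 \<partial>kap) = 1 / 4" "(\<integral>\<tau>. tt \<tau> ^ 4 \<partial>kap) = 1 / 8" "(\<integral>\<tau>. tt \<tau> ^ 6 \<partial>kap) = 5 / 64"
    using ev[of 1] ev[of 2] ev[of 3] moments by simp_all
qed

text \<open>The exponent is at least 2, so the kink of the positive part at \<open>x = T\<close> is
  smoothed out.\<close>

lemma DERIV_max0: "((\<lambda>x. (max 0 (T - x)) ^ (n + 2)) has_real_derivative - (real (n + 2) * (max 0 (T - x)) ^ (n + 1))) (at x)"
proof -
  consider "x < T" | "x > T" | "x = T" by linarith
  then show ?thesis
  proof cases
    case 1
    have "((\<lambda>x. T - x) has_real_derivative -1) (at x)" by (auto intro!: derivative_eq_intros)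
    from DERIV_power[OF this, of "n + 2"]
    have "((\<lambda>x. (T - x) ^ (n + 2)) has_real_derivative - (real (n + 2) * (T - x) ^ (n + 1))) (at x)" by simp
    then have "((\<lambda>x. (max 0 (T - x)) ^ (n + 2)) has_real_derivative - (real (n + 2) * (T - x) ^ (n + 1))) (at x)"
      by (rule has_field_derivative_transform_within_open[where S="{..<T}"]) (use 1 in \<open>auto simp: max_def\<close>)
    then show ?thesis using 1 by (simp add: max_def)
  next
    case 2
    have "((\<lambda>x. 0) has_real_derivative 0) (at x)" by simp
    then have "((\<lambda>x. (max 0 (T - x)) ^ (n + 2)) has_real_derivative 0) (at x)"
      by (rule has_field_derivative_transform_within_open[where S="{T<..}"]) (use 2 in auto)
    then show ?thesis using 2 by simp
  next
    case 3
    have "((\<lambda>h. (max 0 (T - (x + h)) ^ (n + 2) - max 0 (T - x) ^ (n + 2)) / h) \<longlongrightarrow> 0) (at 0)"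
    proof (rule Lim_null_comparison)
      show "\<forall>\<^sub>F h in at 0. norm ((max 0 (T - (x + h)) ^ (n + 2) - max 0 (T - x) ^ (n + 2)) / h) \<le> \<bar>h\<bar> ^ (n + 1)"
      proof (rule always_eventually, rule allI)
        fix h :: real
        have "max 0 (- h) ^ (n + 2) \<le> \<bar>h\<bar> ^ (n + 2)" by (rule power_mono) auto
        then show "norm ((max 0 (T - (x + h)) ^ (n + 2) - max 0 (T - x) ^ (n + 2)) / h) \<le> \<bar>h\<bar> ^ (n + 1)"
          using 3 by (cases "h = 0") (auto simp: field_simps power_abs)
      qed
      have "((\<lambda>h::real. \<bar>h\<bar> ^ (n + 1)) \<longlongrightarrow> \<bar>0\<bar> ^ (n + 1)) (at 0)" by (intro tendsto_intros)
      then show "((\<lambda>h::real. \<bar>h\<bar> ^ (n + 1)) \<longlongrightarrow> 0) (at 0)" by simp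
    qed
    then show ?thesis using 3 by (simp add: DERIV_def)
  qed
qed

text \<open>The derivative of \<open>tt\<close> is \<open>rr\<^sup>3\<close>, so one of the four factors \<open>rr\<close> in the density of \<open>kap\<close> is spent on \<open>g\<close>.\<close>

lemma kap_truncated:
  fixes u v T :: real
  assumes uv: "0 \<le> u" "0 \<le> v" "0 \<le> T" and [measurable]: "g \<in> borel_measurable borel" and i: "integrable kap g"
    and g: "\<And>\<tau>. 0 \<le> \<tau> \<Longrightarrow> g \<tau> * rr \<tau> \<le> u * max 0 (T - tt \<tau>) + v * (max 0 (T - tt \<tau>))\<^sup>2"
  shows "(\<integral>\<tau>. g \<tau> \<partial>kap) \<le> 4 / pi * (u * T\<^sup>2 / 2 + v * T ^ 3 / 3)"
proof -
  define P where "P t = - (u / 2 * (max 0 (T - t))\<^sup>2 + v / 3 * (max 0 (T - t)) ^ 3)" for t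
  define p where "p t = u * max 0 (T - t) + v * (max 0 (T - t))\<^sup>2" for t
  have p0: "0 \<le> p t" for t using uv by (simp add: p_def)
  have D2: "((\<lambda>x. (max 0 (T - x))\<^sup>2) has_real_derivative - (2 * max 0 (T - x))) (at x)" for x
    using DERIV_max0[of T 0 x] by (simp add: numeral_2_eq_2)
  have D3: "((\<lambda>x. (max 0 (T - x)) ^ 3) has_real_derivative - (3 * (max 0 (T - x))\<^sup>2)) (at x)" for x
    using DERIV_max0[of T 1 x] by (simp add: numeral_2_eq_2 numeral_3_eq_3)
  have P: "(P has_real_derivative p t) (at t)" for t
  proof -
    have "(P has_real_derivative - (u / 2 * (- (2 * max 0 (T - t))) + v / 3 * (- (3 * (max 0 (T - t))\<^sup>2)))) (at t)"
      unfolding P_def[abs_def] by (intro DERIV_minus DERIV_add DERIV_cmult D2 D3)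
    then show ?thesis by (rule DERIV_cong) (simp add: p_def)
  qed
  have [measurable]: "p \<in> borel_measurable borel" unfolding p_def[abs_def] by measurable
  \<comment> \<open>Division by \<open>rr\<close> turns the weight \<open>rr^4\<close> into
    \<open>rr^3\<close>, the derivative of \<open>tt\<close>; hence \<open>P (tt \<tau>)\<close> is
    the antiderivative needed.\<close>
  define q where "q \<tau> = p (tt \<tau>) / rr \<tau>" for \<tau>
  have q: "(\<lambda>\<tau>. q \<tau>) \<in> borel_measurable borel" unfolding q_def by measurable
  have q0: "0 \<le> q \<tau>" for \<tau> using p0 rr_pos[of \<tau>] by (simp add: q_def)
  have Q: "((\<lambda>\<tau>. P (tt \<tau>)) has_real_derivative q \<tau> * rr \<tau> ^ 4) (at \<tau>)" for \<tau>
  proof -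
    have "((\<lambda>\<tau>. P (tt \<tau>)) has_real_derivative p (tt \<tau>) * rr \<tau> ^ 3) (at \<tau>)"
      by (rule DERIV_chain2[OF P DERIV_tt])
    moreover have "p (tt \<tau>) * rr \<tau> ^ 3 = q \<tau> * rr \<tau> ^ 4"
      using rr_pos[of \<tau>] by (simp add: q_def eval_nat_numeral)
    ultimately show ?thesis by simp
  qed
  have L: "((\<lambda>\<tau>. P (tt \<tau>)) \<longlongrightarrow> P 1) at_top"
    by (rule isCont_tendsto_compose[OF DERIV_isCont[OF P] tt_lim])
  have "(\<integral>\<tau>. g \<tau> \<partial>kap) \<le> (\<integral>\<tau>. q \<tau> \<partial>kap)"
  proof (rule integral_mono_AE[OF i kap_FTC(1)[OF q q0 Q L]])
    show "AE \<tau> in kap. g \<tau> \<le> q \<tau>"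
      using AE_kap_nonneg by eventually_elim (use g rr_pos in \<open>simp add: q_def p_def pos_le_divide_eq\<close>)
  qed
  also have "\<dots> = 4 / pi * (P 1 - P (tt 0))" by (rule kap_FTC(2)[OF q q0 Q L])
  also have "\<dots> \<le> 4 / pi * (u * T\<^sup>2 / 2 + v * T ^ 3 / 3)"
  proof (rule mult_left_mono)
    \<comment> \<open>\<open>T\<close> may exceed 1, the supremum of \<open>tt\<close>, and then
      \<open>P 1\<close> does not vanish; its sign is enough.\<close>
    have "0 \<le> u / 2 * (max 0 (T - 1))\<^sup>2 + v / 3 * (max 0 (T - 1)) ^ 3"
      using uv by (intro add_nonneg_nonneg mult_nonneg_nonneg) auto
    then have "P 1 \<le> 0" unfolding P_def by linarith
    moreover have "P (tt 0) = - (u * T\<^sup>2 / 2 + v * T ^ 3 / 3)" using uv by (simp add: P_def)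
    ultimately show "P 1 - P (tt 0) \<le> u * T\<^sup>2 / 2 + v * T ^ 3 / 3" by linarith
  qed simp
  finally show ?thesis .
qed

lemma kap_cont:
  fixes F :: "real \<Rightarrow> real \<Rightarrow> real"
  assumes "continuous_on UNIV (\<lambda>p. F (fst p) (snd p))"
  shows "integrable kap (\<lambda>\<tau>. F (tt \<tau>) (rr \<tau>))"
proof -
  let ?G = "\<lambda>p. F (fst p) (snd p)"
  have "compact (?G ` ({-1..1} \<times> {0..1}))"
    by (rule compact_continuous_image[OF continuous_on_subset[OF assms]]) (auto intro!: compact_Times)
  then have "bounded (?G ` ({-1..1} \<times> {0..1}))" by (rule compact_imp_bounded)
  then obtain K where K: "\<And>y. y \<in> ?G ` ({-1..1} \<times> {0..1}) \<Longrightarrow> norm y \<le> K" unfolding bounded_iff by blast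
  have [measurable]: "?G \<in> borel_measurable borel" by (rule borel_measurable_continuous_onI[OF assms])
  show ?thesis
  proof (rule integrable_kap_bounded)
    have "(\<lambda>\<tau>. ?G (tt \<tau>, rr \<tau>)) \<in> borel_measurable borel" by measurable
    then show "(\<lambda>\<tau>. F (tt \<tau>) (rr \<tau>)) \<in> borel_measurable borel" by simp
    have "(tt \<tau>, rr \<tau>) \<in> {-1..1} \<times> {0..1}" for \<tau>
      using tt_le[of \<tau>] tt_ge[of \<tau>] rr_pos[of \<tau>] rr_le[of \<tau>] by simp
    from K[OF imageI[OF this]] show "\<bar>F (tt \<tau>) (rr \<tau>)\<bar> \<le> K" for \<tau> by simp
  qed
qed

section \<open>The excess of the even part over the latitude\<close>

lemma max0_abs_add_le:
  fixes a b c e t :: real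
  shows "0 \<le> a + b \<Longrightarrow> b \<le> c + e \<Longrightarrow> 0 \<le> e \<Longrightarrow> max 0 (\<bar>a + b\<bar> - t) \<le> max 0 (a - t + c) + e"
  by (auto simp: max_def)

lemma max0_abs_diff_le:
  fixes a b e t :: real
  shows "0 \<le> a \<Longrightarrow> 0 \<le> b \<Longrightarrow> b - t \<le> e \<Longrightarrow> 0 \<le> e \<Longrightarrow> max 0 (\<bar>a - b\<bar> - t) \<le> max 0 (a - t) + e"
  by (auto simp: max_def abs_if)

lemma two_over_pi: "2 / pi \<le> (6367 / 10000)" "2 / (35 * pi) \<le> (182 / 10000)"
  using pi_approx by (simp_all add: field_simps)

lemma rr3_le: "rr \<tau> ^ 3 \<le> 1 - (tt \<tau>)\<^sup>2"
proof -
  have "rr \<tau> ^ 3 \<le> (rr \<tau>)\<^sup>2" by (rule power_decreasing) (use rr_pos[of \<tau>] rr_le[of \<tau>] in auto)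
  then show ?thesis by (simp add: tt_rr)
qed

lemma max0_mult_le: "0 \<le> r \<Longrightarrow> r \<le> 1 \<Longrightarrow> max 0 x * r \<le> max 0 (x::real)"
  using mult_left_le[of r "max 0 x"] by simp

text \<open>Bounding the powers of \<open>rr\<close> by 1 leaves the triangle \<open>D - t\<close>.
  The constant is asymptotically exact as \<open>D\<close> tends to 0.\<close>

lemma excess_D:
  assumes D: "0 \<le> D"
  shows "(\<integral>\<tau>. max 0 (D * rr \<tau> ^ 3 - tt \<tau>) \<partial>kap) \<le> 2 / pi * D\<^sup>2"
proof -
  have "(\<integral>\<tau>. max 0 (D * rr \<tau> ^ 3 - tt \<tau>) \<partial>kap) \<le> 4 / pi * (1 * D\<^sup>2 / 2 + 0 * D ^ 3 / 3)"
  proof (rule kap_truncated)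
    show "integrable kap (\<lambda>\<tau>. max 0 (D * rr \<tau> ^ 3 - tt \<tau>))"
      by (rule kap_cont[where F="\<lambda>t r. max 0 (D * r ^ 3 - t)"]) (intro continuous_intros)
    fix \<tau> :: real assume "0 \<le> \<tau>"
    have "D * rr \<tau> ^ 3 \<le> D * 1"
      by (rule mult_left_mono[OF _ D]) (use rr_pos[of \<tau>] rr_le[of \<tau>] in \<open>auto intro: power_le_one\<close>)
    then have "max 0 (D * rr \<tau> ^ 3 - tt \<tau>) \<le> max 0 (D - tt \<tau>)" by auto
    moreover have "max 0 (D * rr \<tau> ^ 3 - tt \<tau>) * rr \<tau> \<le> max 0 (D * rr \<tau> ^ 3 - tt \<tau>)"
      by (rule max0_mult_le) (use rr_pos[of \<tau>] rr_le[of \<tau>] in auto)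
    ultimately show "max 0 (D * rr \<tau> ^ 3 - tt \<tau>) * rr \<tau> \<le> 1 * max 0 (D - tt \<tau>) + 0 * (max 0 (D - tt \<tau>))\<^sup>2"
      by simp
  qed (use D in auto)
  then show ?thesis by simp
qed

text \<open>
  Since \<open>rr\<^sup>3 \<le> 1 - tt\<^sup>2\<close>, the integrand is dominated by a quadratic in \<open>tt\<close>, which is
  integrated exactly up to its smaller root \<open>T\<close>. The parameter \<open>0.815\<close> is the budget handed over
  from the \<open>B\<close>-term in the next lemma.
\<close>

lemma excess_Dk:
  assumes D: "0 \<le> D"
  shows "(\<integral>\<tau>. max 0 (D * rr \<tau> ^ 3 - tt \<tau> + (815 / 1000) * (tt \<tau>)\<^sup>2) \<partial>kap) \<le> (7348 / 10000) * D\<^sup>2"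
proof -
  let ?g = "\<lambda>\<tau>. max 0 (D * rr \<tau> ^ 3 - tt \<tau> + (815 / 1000) * (tt \<tau>)\<^sup>2)"
  have i: "integrable kap ?g"
    by (rule kap_cont[where F="\<lambda>t r. max 0 (D * r ^ 3 - t + (815 / 1000) * t\<^sup>2)"]) (intro continuous_intros)
  define \<kappa> where "\<kappa> = (815 / 1000) - D"
  have le: "?g \<tau> * rr \<tau> \<le> max 0 (D - tt \<tau> + \<kappa> * (tt \<tau>)\<^sup>2)" for \<tau>
  proof -
    have "D * rr \<tau> ^ 3 \<le> D * (1 - (tt \<tau>)\<^sup>2)" by (rule mult_left_mono[OF rr3_le D])
    then have "D * rr \<tau> ^ 3 - tt \<tau> + (815 / 1000) * (tt \<tau>)\<^sup>2 \<le> D - tt \<tau> + \<kappa> * (tt \<tau>)\<^sup>2"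
      by (simp add: \<kappa>_def algebra_simps)
    then have "?g \<tau> \<le> max 0 (D - tt \<tau> + \<kappa> * (tt \<tau>)\<^sup>2)" by auto
    moreover have "?g \<tau> * rr \<tau> \<le> ?g \<tau>" by (rule max0_mult_le) (use rr_pos[of \<tau>] rr_le[of \<tau>] in auto)
    ultimately show ?thesis by linarith
  qed
  show ?thesis
  proof (cases "\<kappa> \<le> 0")
    case True
    have "(\<integral>\<tau>. ?g \<tau> \<partial>kap) \<le> 4 / pi * (1 * D\<^sup>2 / 2 + 0 * D ^ 3 / 3)"
    proof (rule kap_truncated[OF _ _ _ _ i])
      fix \<tau> :: real
      have "\<kappa> * (tt \<tau>)\<^sup>2 \<le> 0" using True by (simp add: mult_nonpos_nonneg)
      then show "?g \<tau> * rr \<tau> \<le> 1 * max 0 (D - tt \<tau>) + 0 * (max 0 (D - tt \<tau>))\<^sup>2"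
        using le[of \<tau>] by auto
    qed (use D in auto)
    also have "\<dots> = 2 / pi * D\<^sup>2" by simp
    also have "\<dots> \<le> (7348 / 10000) * D\<^sup>2" by (rule mult_right_mono) (use two_over_pi in auto)
    finally show ?thesis .
  next
    case False
    then have \<kappa>: "0 < \<kappa>" by simp
    define \<delta> where "\<delta> = sqrt (1 - 4 * \<kappa> * D)"
    \<comment> \<open>\<open>\<kappa> + D = 0.815\<close>, so this is AM-GM; and
      \<open>1 - 0.815^2\<close> lies just above \<open>0.579^2\<close>.\<close>
    have "4 * \<kappa> * D \<le> (815 / 1000)\<^sup>2"
      using zero_le_power2[of "\<kappa> - D"] by (simp add: \<kappa>_def power2_eq_square algebra_simps)
    then have q: "(579 / 1000)\<^sup>2 \<le> 1 - 4 * \<kappa> * D" by (simp add: power2_eq_square)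
    have \<delta>: "(579 / 1000) \<le> \<delta>" unfolding \<delta>_def by (rule real_le_rsqrt[OF q])
    have \<delta>2: "\<delta>\<^sup>2 = 1 - 4 * \<kappa> * D" unfolding \<delta>_def by (rule real_sqrt_pow2) (use q in \<open>simp add: power2_eq_square\<close>)
    define T where "T = 2 * D / (1 + \<delta>)"
    have T0: "0 \<le> T" using D \<delta> by (simp add: T_def)
    have TD: "(1 + \<delta>) * T = 2 * D" using \<delta> by (simp add: T_def)
    have \<kappa>T: "\<kappa> * T = (1 - \<delta>) / 2"
    proof -
      have "(1 + \<delta>) * (\<kappa> * T) = \<kappa> * (2 * D)" using TD by (metis mult.left_commute)
      also have "\<dots> = (1 + \<delta>) * ((1 - \<delta>) / 2)" using \<delta>2 by (simp add: power2_eq_square field_simps)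
      finally show ?thesis using \<delta> by simp
    qed
    have fac: "D - t + \<kappa> * t\<^sup>2 = (t - T) * (\<kappa> * (t - T) - \<delta>)" for t
    proof -
      have "(t - T) * (\<kappa> * (t - T) - \<delta>) = \<kappa> * t\<^sup>2 - 2 * t * (\<kappa> * T) + T * (\<kappa> * T) - \<delta> * t + \<delta> * T"
        by (simp add: power2_eq_square algebra_simps)
      also have "\<dots> = \<kappa> * t\<^sup>2 - t + (1 + \<delta>) * T / 2" unfolding \<kappa>T by (simp add: field_simps)
      finally show ?thesis by (simp add: TD)
    qed
    have I: "(\<integral>\<tau>. ?g \<tau> \<partial>kap) \<le> 4 / pi * (\<delta> * T\<^sup>2 / 2 + \<kappa> * T ^ 3 / 3)"
    proof (rule kap_truncated[OF _ _ T0 _ i])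
      fix \<tau> :: real
      let ?t = "tt \<tau>"
      have "max 0 (D - ?t + \<kappa> * ?t\<^sup>2) \<le> \<delta> * max 0 (T - ?t) + \<kappa> * (max 0 (T - ?t))\<^sup>2"
      proof (cases "?t \<le> T")
        case True
        have "\<delta> * (T - ?t) + \<kappa> * (T - ?t)\<^sup>2 = D - ?t + \<kappa> * ?t\<^sup>2"
          unfolding fac by (simp add: power2_eq_square algebra_simps)
        moreover have "0 \<le> \<delta> * (T - ?t) + \<kappa> * (T - ?t)\<^sup>2" using True \<kappa> \<delta> by simp
        ultimately show ?thesis using True by (simp add: max_def)
      next
        case False
        then have T1: "T < 1" using tt_le[of \<tau>] by linarith
        \<comment> \<open>At \<open>t = 1\<close> the quadratic equals \<open>0.815 - 1 < 0\<close>,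
          so its larger root lies beyond the range of \<open>tt\<close>, and it stays negative to
          the right of \<open>T\<close>.\<close>
        have "(1 - T) * (\<kappa> * (1 - T) - \<delta>) < 0" using fac[of 1] by (simp add: \<kappa>_def)
        then have "\<kappa> * (1 - T) < \<delta>" using T1 by (simp add: mult_less_0_iff)
        moreover have "\<kappa> * (?t - T) \<le> \<kappa> * (1 - T)" using \<kappa> tt_le[of \<tau>] by simp
        ultimately have "(?t - T) * (\<kappa> * (?t - T) - \<delta>) \<le> 0" using False by (intro mult_nonneg_nonpos) auto
        then have "D - ?t + \<kappa> * ?t\<^sup>2 \<le> 0" unfolding fac .
        then show ?thesis using False by simp
      qed
      then show "?g \<tau> * rr \<tau> \<le> \<delta> * max 0 (T - ?t) + \<kappa> * (max 0 (T - ?t))\<^sup>2" using le[of \<tau>] by linarith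
    qed (use \<delta> \<kappa> in auto)
    have "\<delta> * T\<^sup>2 / 2 + \<kappa> * T ^ 3 / 3 = (1 + 2 * \<delta>) * T\<^sup>2 / 6"
    proof -
      have "\<kappa> * T ^ 3 = (\<kappa> * T) * T\<^sup>2" by (simp add: power2_eq_square power3_eq_cube)
      then show ?thesis unfolding \<kappa>T by (simp add: field_simps)
    qed
    \<comment> \<open>\<open>(1 + 2 * \<delta>) / (1 + \<delta>)^2\<close> decreases for positive
      \<open>\<delta>\<close>; its value at 0.579 is just below 0.8656.\<close>
    also have "(1 + 2 * \<delta>) * T\<^sup>2 / 6 \<le> (8656 / 10000) * ((1 + \<delta>)\<^sup>2 * T\<^sup>2) / 6"
    proof -
      have "0 \<le> (\<delta> - (579 / 1000)) * ((8656 / 10000) * (\<delta> + (579 / 1000)) - (2688 / 10000))" using \<delta> by simp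
      also have "\<dots> = (8656 / 10000) * (\<delta> * \<delta>) - (2688 / 10000) * \<delta> - (1345494096 / 10000000000)" by (simp add: field_simps)
      finally have "(1344 / 10000) + (2688 / 10000) * \<delta> \<le> (8656 / 10000) * (\<delta> * \<delta>)" by simp
      moreover have "(8656 / 10000) * (1 + \<delta>)\<^sup>2 = (8656 / 10000) + (17312 / 10000) * \<delta> + (8656 / 10000) * (\<delta> * \<delta>)"
        by (simp add: power2_eq_square field_simps)
      ultimately have "1 + 2 * \<delta> \<le> (8656 / 10000) * (1 + \<delta>)\<^sup>2" by linarith
      then have "(1 + 2 * \<delta>) * T\<^sup>2 \<le> ((8656 / 10000) * (1 + \<delta>)\<^sup>2) * T\<^sup>2" by (rule mult_right_mono) simp
      then have "(1 + 2 * \<delta>) * T\<^sup>2 \<le> (8656 / 10000) * ((1 + \<delta>)\<^sup>2 * T\<^sup>2)" by (simp only: mult.assoc)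
      then show ?thesis by (rule divide_right_mono) simp
    qed
    also have "(1 + \<delta>)\<^sup>2 * T\<^sup>2 = 4 * D\<^sup>2"
      unfolding power_mult_distrib[symmetric] TD by simp
    finally have J: "\<delta> * T\<^sup>2 / 2 + \<kappa> * T ^ 3 / 3 \<le> (8656 / 10000) * (4 * D\<^sup>2) / 6" .
    have "(\<integral>\<tau>. ?g \<tau> \<partial>kap) \<le> 4 / pi * ((8656 / 10000) * (4 * D\<^sup>2) / 6)"
      by (rule order_trans[OF I mult_left_mono[OF J]]) simp
    also have "\<dots> = (4 / pi * ((8656 / 10000) * 4 / 6)) * D\<^sup>2" by simp
    also have "\<dots> \<le> (7348 / 10000) * D\<^sup>2"
      by (rule mult_right_mono) (use pi_approx in \<open>simp_all add: field_simps\<close>)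
    finally show ?thesis .
  qed
qed

text \<open>The mean of \<open>D * B\<close> over the equator will turn out to be nonpositive
  (\<open>nu_cDB\<close>), so a large coefficient of the cross term is welcome. For \<open>B\<close>
  nonnegative it is given away. For \<open>B\<close> negative it must be paid for, but there the two
  parts of the even function have opposite signs, and the estimate has room to spare.\<close>

lemma excess_even_nonneg:
  assumes D: "0 \<le> D"
  shows "(\<integral>\<tau>. max 0 (\<bar>D * rr \<tau> ^ 3 + B * ((tt \<tau>)\<^sup>2 * rr \<tau>)\<bar> - tt \<tau>) \<partial>kap)
    \<le> (7348 / 10000) * D\<^sup>2 + (868 / 10000) * (D * B) + B\<^sup>2 / (2608 / 100)"
proof -
  let ?f = "\<lambda>\<tau>. max 0 (\<bar>D * rr \<tau> ^ 3 + B * ((tt \<tau>)\<^sup>2 * rr \<tau>)\<bar> - tt \<tau>)"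
  have i: "integrable kap ?f"
    by (rule kap_cont[where F="\<lambda>t r. max 0 (\<bar>D * r ^ 3 + B * (t\<^sup>2 * r)\<bar> - t)"]) (intro continuous_intros)
  show ?thesis
  proof (cases "0 \<le> B")
    case True
    let ?g = "\<lambda>\<tau>. max 0 (D * rr \<tau> ^ 3 - tt \<tau> + (815 / 1000) * (tt \<tau>)\<^sup>2)"
    have ig: "integrable kap ?g"
      by (rule kap_cont[where F="\<lambda>t r. max 0 (D * r ^ 3 - t + (815 / 1000) * t\<^sup>2)"]) (intro continuous_intros)
    have "(\<integral>\<tau>. ?f \<tau> \<partial>kap) \<le> (\<integral>\<tau>. ?g \<tau> + B\<^sup>2 / (326 / 100) * (tt \<tau> ^ 2 * rr \<tau> ^ 2) \<partial>kap)"
    proof (rule integral_mono[OF i])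
      show "integrable kap (\<lambda>\<tau>. ?g \<tau> + B\<^sup>2 / (326 / 100) * (tt \<tau> ^ 2 * rr \<tau> ^ 2))"
        by (intro Bochner_Integration.integrable_add ig integrable_mult_right) (rule kap_poly)
      fix \<tau>
      have "0 \<le> D * rr \<tau> ^ 3 + B * ((tt \<tau>)\<^sup>2 * rr \<tau>)" using D True rr_pos[of \<tau>] by simp
      \<comment> \<open>AM-GM in the form \<open>B * rr \<le> 0.815 + B^2 * rr^2 / 3.26\<close>,
        with equality at \<open>B * rr = 1.63\<close>. Since \<open>tt^2 * rr^2\<close> has mean
        1/8, the quadratic part yields \<open>B^2 / 26.08\<close>.\<close>
      moreover have "B * ((tt \<tau>)\<^sup>2 * rr \<tau>) \<le> (815 / 1000) * (tt \<tau>)\<^sup>2 + B\<^sup>2 / (326 / 100) * (tt \<tau> ^ 2 * rr \<tau> ^ 2)"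
      proof -
        have "0 \<le> (B * rr \<tau> - (163 / 100))\<^sup>2" by simp
        then have "B * rr \<tau> \<le> (815 / 1000) + B\<^sup>2 / (326 / 100) * (rr \<tau>)\<^sup>2" by (simp add: power2_eq_square algebra_simps)
        then have "(tt \<tau>)\<^sup>2 * (B * rr \<tau>) \<le> (tt \<tau>)\<^sup>2 * ((815 / 1000) + B\<^sup>2 / (326 / 100) * (rr \<tau>)\<^sup>2)"
          by (rule mult_left_mono) simp
        then show ?thesis by (simp add: algebra_simps)
      qed
      moreover have "0 \<le> B\<^sup>2 / (326 / 100) * (tt \<tau> ^ 2 * rr \<tau> ^ 2)" by simp
      ultimately show "?f \<tau> \<le> ?g \<tau> + B\<^sup>2 / (326 / 100) * (tt \<tau> ^ 2 * rr \<tau> ^ 2)" by (rule max0_abs_add_le)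
    qed
    also have "\<dots> = (\<integral>\<tau>. ?g \<tau> \<partial>kap) + B\<^sup>2 / (326 / 100) * (\<integral>\<tau>. tt \<tau> ^ 2 * rr \<tau> ^ 2 \<partial>kap)"
      by (subst Bochner_Integration.integral_add[OF ig]) (auto intro!: integrable_mult_right)
    also have "(\<integral>\<tau>. tt \<tau> ^ 2 * rr \<tau> ^ 2 \<partial>kap) = 1 / 8"
    proof -
      have r2: "rr \<tau> ^ 2 = 1 - tt \<tau> ^ 2" for \<tau> using tt_rr[of \<tau>] by simp
      have e: "tt \<tau> ^ 2 * rr \<tau> ^ 2 = tt \<tau> ^ 2 - tt \<tau> ^ 4" for \<tau>
        unfolding r2 by (simp add: eval_nat_numeral algebra_simps)
      show ?thesis unfolding e using kap_poly[of 2 0] kap_poly[of 4 0] by (simp add: kap_t2 kap_t4)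
    qed
    finally have "(\<integral>\<tau>. ?f \<tau> \<partial>kap) \<le> (7348 / 10000) * D\<^sup>2 + B\<^sup>2 / (326 / 100) * (1 / 8)" using excess_Dk[OF D] by linarith
    moreover have "0 \<le> D * B" using D True by simp
    ultimately show ?thesis by simp
  next
    case False
    define b where "b = - B"
    have b: "0 < b" using False by (simp add: b_def)
    let ?g = "\<lambda>\<tau>. max 0 (D * rr \<tau> ^ 3 - tt \<tau>)"
    have ig: "integrable kap ?g"
      by (rule kap_cont[where F="\<lambda>t r. max 0 (D * r ^ 3 - t)"]) (intro continuous_intros)
    \<comment> \<open>A difference of nonnegative numbers exceeds a threshold in absolute value only
      through the larger one, so each part may be compared with the full threshold
      \<open>tt\<close>.\<close>
    have "(\<integral>\<tau>. ?f \<tau> \<partial>kap) \<le> (\<integral>\<tau>. ?g \<tau> + b\<^sup>2 / 4 * (tt \<tau> ^ 3 * rr \<tau> ^ 2) \<partial>kap)"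
    proof (rule integral_mono_AE[OF i])
      show "integrable kap (\<lambda>\<tau>. ?g \<tau> + b\<^sup>2 / 4 * (tt \<tau> ^ 3 * rr \<tau> ^ 2))"
        by (intro Bochner_Integration.integrable_add ig integrable_mult_right) (rule kap_poly)
      show "AE \<tau> in kap. ?f \<tau> \<le> ?g \<tau> + b\<^sup>2 / 4 * (tt \<tau> ^ 3 * rr \<tau> ^ 2)"
        using AE_kap_nonneg
      proof eventually_elim
        fix \<tau> :: real assume "0 \<le> \<tau>"
        then have t: "0 \<le> tt \<tau>" by (rule tt_nonneg)
        have 1: "0 \<le> D * rr \<tau> ^ 3" "0 \<le> b * ((tt \<tau>)\<^sup>2 * rr \<tau>)" using D b rr_pos[of \<tau>] by auto
        have "0 \<le> (b * (tt \<tau> * rr \<tau>) / 2 - 1)\<^sup>2" by simp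
        then have "b * (tt \<tau> * rr \<tau>) - 1 \<le> b\<^sup>2 / 4 * (tt \<tau> ^ 2 * rr \<tau> ^ 2)"
          by (simp add: power2_eq_square algebra_simps)
        then have "tt \<tau> * (b * (tt \<tau> * rr \<tau>) - 1) \<le> tt \<tau> * (b\<^sup>2 / 4 * (tt \<tau> ^ 2 * rr \<tau> ^ 2))"
          by (rule mult_left_mono[OF _ t])
        then have 2: "b * ((tt \<tau>)\<^sup>2 * rr \<tau>) - tt \<tau> \<le> b\<^sup>2 / 4 * (tt \<tau> ^ 3 * rr \<tau> ^ 2)"
          by (simp add: power2_eq_square power3_eq_cube algebra_simps)
        have 3: "0 \<le> b\<^sup>2 / 4 * (tt \<tau> ^ 3 * rr \<tau> ^ 2)" using t by simp
        have "?f \<tau> = max 0 (\<bar>D * rr \<tau> ^ 3 - b * ((tt \<tau>)\<^sup>2 * rr \<tau>)\<bar> - tt \<tau>)" by (simp add: b_def)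
        then show "?f \<tau> \<le> ?g \<tau> + b\<^sup>2 / 4 * (tt \<tau> ^ 3 * rr \<tau> ^ 2)"
          by (simp only:) (rule max0_abs_diff_le[OF 1 2 3])
      qed
    qed
    also have "\<dots> = (\<integral>\<tau>. ?g \<tau> \<partial>kap) + b\<^sup>2 / 4 * (\<integral>\<tau>. tt \<tau> ^ 3 * rr \<tau> ^ 2 \<partial>kap)"
      by (subst Bochner_Integration.integral_add[OF ig]) (auto intro!: integrable_mult_right)
    also have "(\<integral>\<tau>. tt \<tau> ^ 3 * rr \<tau> ^ 2 \<partial>kap) = 8 / (35 * pi)"
    proof -
      have r2: "rr \<tau> ^ 2 = 1 - tt \<tau> ^ 2" for \<tau> using tt_rr[of \<tau>] by simp
      have e: "tt \<tau> ^ 3 * rr \<tau> ^ 2 = tt \<tau> ^ 3 - tt \<tau> ^ 5" for \<tau>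
        unfolding r2 by (simp add: eval_nat_numeral algebra_simps)
      show ?thesis unfolding e using kap_poly[of 3 0] kap_poly[of 5 0] by (simp add: kap_t3 kap_t5 field_simps)
    qed
    finally have "(\<integral>\<tau>. ?f \<tau> \<partial>kap) \<le> 2 / pi * D\<^sup>2 + 2 / (35 * pi) * b\<^sup>2" using excess_D[OF D] by simp
    also have "\<dots> \<le> (6367 / 10000) * D\<^sup>2 + (182 / 10000) * b\<^sup>2"
      by (intro add_mono mult_right_mono) (use two_over_pi in auto)
    \<comment> \<open>The room is \<open>0.0981 * D^2\<close> and \<open>0.0201 * b^2\<close>; it
      absorbs the cross term because \<open>0.0434^2 < 0.0981 * 0.0201\<close>.\<close>
    also have "\<dots> \<le> (7348 / 10000) * D\<^sup>2 - (868 / 10000) * (D * b) + b\<^sup>2 / (2608 / 100)"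
    proof -
      have "0 \<le> ((981 / 10000) * D - (434 / 10000) * b)\<^sup>2 + (8825 / 100000000) * b\<^sup>2" by simp
      also have "\<dots> = (981 / 10000) * ((981 / 10000) * D\<^sup>2 - (868 / 10000) * (D * b) + (201 / 10000) * b\<^sup>2)"
        by (simp add: power2_eq_square algebra_simps)
      finally have "0 \<le> (981 / 10000) * D\<^sup>2 - (868 / 10000) * (D * b) + (201 / 10000) * b\<^sup>2" by simp
      moreover have "(383 / 10000) * b\<^sup>2 \<le> b\<^sup>2 / (2608 / 100)" by simp
      ultimately show ?thesis by linarith
    qed
    finally show ?thesis by (simp add: b_def)
  qed
qed

lemma excess_even:
  "(\<integral>\<tau>. max 0 (\<bar>D * rr \<tau> ^ 3 + B * ((tt \<tau>)\<^sup>2 * rr \<tau>)\<bar> - tt \<tau>) \<partial>kap)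
    \<le> (7348 / 10000) * D\<^sup>2 + (868 / 10000) * (D * B) + B\<^sup>2 / (2608 / 100)"
proof (cases "0 \<le> D")
  case False
  have "\<bar>(- D) * r + (- B) * s\<bar> = \<bar>D * r + B * s\<bar>" for r s by (simp add: abs_if)
  then show ?thesis using False excess_even_nonneg[of "- D" "- B"] by simp
qed (rule excess_even_nonneg)

text \<open>The bound is homogeneous of degree 2 in \<open>(D, B)\<close>, while the excess is
  \<open>\<theta>\<close> times the one for \<open>(D / \<theta>, B / \<theta>)\<close>.\<close>

lemma excess_even_scaled:
  assumes \<theta>: "0 < \<theta>"
  shows "(\<integral>\<tau>. max 0 (\<bar>D * rr \<tau> ^ 3 + B * ((tt \<tau>)\<^sup>2 * rr \<tau>)\<bar> - \<theta> * tt \<tau>) \<partial>kap)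
    \<le> ((7348 / 10000) * D\<^sup>2 + (868 / 10000) * (D * B) + B\<^sup>2 / (2608 / 100)) / \<theta>"
proof -
  have e: "max 0 (\<bar>D * r + B * s\<bar> - \<theta> * t) = \<theta> * max 0 (\<bar>(D / \<theta>) * r + (B / \<theta>) * s\<bar> - t)" for r s t
  proof -
    have "\<bar>D * r + B * s\<bar> = \<theta> * \<bar>(D / \<theta>) * r + (B / \<theta>) * s\<bar>"
      using \<theta> by (simp add: abs_mult[symmetric] abs_of_pos[symmetric] field_simps del: abs_mult)
    then show ?thesis using \<theta> by (simp add: max_def right_diff_distrib[symmetric] zero_le_mult_iff)
  qed
  have "(\<integral>\<tau>. max 0 (\<bar>D * rr \<tau> ^ 3 + B * ((tt \<tau>)\<^sup>2 * rr \<tau>)\<bar> - \<theta> * tt \<tau>) \<partial>kap) =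
    \<theta> * (\<integral>\<tau>. max 0 (\<bar>(D / \<theta>) * rr \<tau> ^ 3 + (B / \<theta>) * ((tt \<tau>)\<^sup>2 * rr \<tau>)\<bar> - tt \<tau>) \<partial>kap)"
    unfolding e by (rule integral_mult_right_zero)
  also have "\<dots> \<le> \<theta> * ((7348 / 10000) * (D / \<theta>)\<^sup>2 + (868 / 10000) * ((D / \<theta>) * (B / \<theta>)) + (B / \<theta>)\<^sup>2 / (2608 / 100))"
    by (rule mult_left_mono[OF excess_even]) (use \<theta> in simp)
  also have "\<dots> = ((7348 / 10000) * D\<^sup>2 + (868 / 10000) * (D * B) + B\<^sup>2 / (2608 / 100)) / \<theta>"
    using \<theta> by (simp add: power2_eq_square field_simps)
  finally show ?thesis .
qed

text \<open>Up to \<open>w = X + t\<close> the second summand on the left is the positive part of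
  \<open>X - w - t\<close>: for \<open>w \<le> e\<close> convexity gives the bound without
  \<open>K\<close>, and beyond \<open>e\<close> only the first summand grows, at rate at most 1,
  which \<open>w - e \<le> 2 * K\<close> covers. For larger \<open>w\<close> the left side is
  \<open>2 * (w - t)\<close>.\<close>

lemma max0_symmetrized:
  fixes X w t e K :: real
  assumes "0 \<le> X" "0 \<le> w" "0 \<le> t" "0 \<le> e" "0 \<le> K" "w - e \<le> 2 * K" "w - t \<le> K"
  shows "max 0 (X + w - t) + max 0 (\<bar>X - w\<bar> - t) \<le> max 0 (X - (t - e)) + max 0 (X - (t + e)) + 2 * K"
  using assms by (auto simp: max_def abs_if)

text \<open>
  Averaging over the two signs of the odd part \<open>t * y\<close> costs a shift of the threshold by
  \<open>\<plusminus> \<eta> * t\<close> and, by AM-GM, a quadratic term in \<open>y\<close>.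
\<close>

lemma excess_symmetrized:
  fixes t \<eta> x y :: real
  assumes t: "0 \<le> t" and \<eta>: "0 < \<eta>" "\<eta> < 1 / 2"
  shows "(max 0 (\<bar>x + t * y\<bar> - t) + max 0 (\<bar>x - t * y\<bar> - t)) / 2 \<le>
    (max 0 (\<bar>x\<bar> - (1 - \<eta>) * t) + max 0 (\<bar>x\<bar> - (1 + \<eta>) * t)) / 2 + t * y\<^sup>2 / (8 * \<eta>)"
proof -
  define z where "z = \<bar>y\<bar>"
  have z: "0 \<le> z" "y\<^sup>2 = z\<^sup>2" by (auto simp: z_def)
  have "4 * \<eta> * (z - \<eta>) \<le> z\<^sup>2"
    using zero_le_power2[of "z - 2 * \<eta>"] by (simp add: power2_eq_square algebra_simps)
  then have "(z - \<eta>) / 2 \<le> z\<^sup>2 / (8 * \<eta>)" using \<eta> by (simp add: field_simps)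
  then have "t * ((z - \<eta>) / 2) \<le> t * (z\<^sup>2 / (8 * \<eta>))" by (rule mult_left_mono[OF _ t])
  then have 1: "(t * z - \<eta> * t) / 2 \<le> t * y\<^sup>2 / (8 * \<eta>)" by (simp add: z algebra_simps)
  \<comment> \<open>The previous estimate is for moderate odd parts; this one is for odd parts that
    exceed the threshold on their own, and it is where \<open>\<eta> < 1 / 2\<close> enters.\<close>
  have "8 * \<eta> * (z - 1) \<le> z\<^sup>2"
  proof -
    have "z\<^sup>2 - 8 * \<eta> * (z - 1) = (z - 4 * \<eta>)\<^sup>2 + 8 * \<eta> * (1 - 2 * \<eta>)" by (simp add: power2_eq_square algebra_simps)
    moreover have "0 \<le> 8 * \<eta> * (1 - 2 * \<eta>)" using \<eta> by simp
    ultimately show ?thesis by (smt (verit) zero_le_power2)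
  qed
  then have "(z - 1) \<le> z\<^sup>2 / (8 * \<eta>)" using \<eta> by (simp add: field_simps)
  then have "t * (z - 1) \<le> t * (z\<^sup>2 / (8 * \<eta>))" by (rule mult_left_mono[OF _ t])
  then have 2: "t * z - t \<le> t * y\<^sup>2 / (8 * \<eta>)" by (simp add: z algebra_simps)
  have 3: "0 \<le> t * y\<^sup>2 / (8 * \<eta>)" using t \<eta> by simp
  define w X where "w = t * z" and "X = \<bar>x\<bar>"
  have wX: "0 \<le> w" "0 \<le> X" using t z by (auto simp: w_def X_def)
  have s: "max 0 (\<bar>x + t * y\<bar> - t) + max 0 (\<bar>x - t * y\<bar> - t) = max 0 (X + w - t) + max 0 (\<bar>X - w\<bar> - t)"
  proof -
    have w: "w = \<bar>t * y\<bar>" using t by (simp add: w_def z_def abs_mult)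
    have "max 0 (\<bar>x + v\<bar> - t) + max 0 (\<bar>x - v\<bar> - t) = max 0 (\<bar>x\<bar> + \<bar>v\<bar> - t) + max 0 (\<bar>\<bar>x\<bar> - \<bar>v\<bar>\<bar> - t)" for v
      by (auto simp: max_def abs_if)
    then show ?thesis unfolding w X_def .
  qed
  have "(1 - \<eta>) * t = t - \<eta> * t" "(1 + \<eta>) * t = t + \<eta> * t" by (auto simp: algebra_simps)
  moreover have "max 0 (X + w - t) + max 0 (\<bar>X - w\<bar> - t) \<le>
      max 0 (X - (t - \<eta> * t)) + max 0 (X - (t + \<eta> * t)) + 2 * (t * y\<^sup>2 / (8 * \<eta>))"
    by (rule max0_symmetrized) (use 1 2 3 wX t \<eta> in \<open>auto simp: w_def\<close>)
  ultimately have "max 0 (X + w - t) + max 0 (\<bar>X - w\<bar> - t) \<le>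
      max 0 (X - (1 - \<eta>) * t) + max 0 (X - (1 + \<eta>) * t) + 2 * (t * y\<^sup>2 / (8 * \<eta>))" by (simp only:)
  moreover have "A / 2 \<le> B / 2 + K" if "A \<le> B + 2 * K" for A B K :: real using that by (simp add: field_simps)
  ultimately show ?thesis unfolding s X_def[symmetric] by blast
qed

section \<open>Cubic harmonics in polar coordinates\<close>

lemma Fubini_bounded:
  fixes f :: "'a \<Rightarrow> 'b \<Rightarrow> real"
  assumes "prob_space M" "prob_space N"
    and [measurable]: "(\<lambda>(x, y). f x y) \<in> borel_measurable (M \<Otimes>\<^sub>M N)" and bd: "\<And>x y. \<bar>f x y\<bar> \<le> K"
  shows "(\<integral>x. (\<integral>y. f x y \<partial>N) \<partial>M) = (\<integral>y. (\<integral>x. f x y \<partial>M) \<partial>N)"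
    and "integrable M (\<lambda>x. \<integral>y. f x y \<partial>N)" and "integrable N (\<lambda>y. \<integral>x. f x y \<partial>M)"
    and "x \<in> space M \<Longrightarrow> integrable N (f x)" and "y \<in> space N \<Longrightarrow> integrable M (\<lambda>x. f x y)"
proof -
  interpret M: prob_space M by fact
  interpret N: prob_space N by fact
  interpret P: pair_prob_space M N ..
  have i: "integrable (M \<Otimes>\<^sub>M N) (\<lambda>(x, y). f x y)"
    by (rule P.P.integrable_const_bound[where B=K]) (use bd in auto)
  show "(\<integral>x. (\<integral>y. f x y \<partial>N) \<partial>M) = (\<integral>y. (\<integral>x. f x y \<partial>M) \<partial>N)"
    by (rule P.Fubini_integral[OF i, symmetric])
  show "integrable M (\<lambda>x. \<integral>y. f x y \<partial>N)" using P.integrable_fst[OF i] .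
  show "integrable N (\<lambda>y. \<integral>x. f x y \<partial>M)" using P.integrable_snd[OF i] .
  show "integrable N (f x)" if "x \<in> space M"
    by (rule N.integrable_const_bound[where B=K]) (use bd that in auto)
  show "integrable M (\<lambda>x. f x y)" if "y \<in> space N"
    by (rule M.integrable_const_bound[where B=K]) (use bd that in auto)
qed

lemmas mu_mu = Fubini_bounded[OF prob_space_mu prob_space_mu]
lemmas kap_nu = Fubini_bounded[OF prob_space_kap prob_space_nu]
lemmas nu_mu = Fubini_bounded[OF prob_space_nu prob_space_mu]

text \<open>Transfers moments from the sphere to the equator: a function whose average over
  \<open>\<plusminus>\<tau>\<close> is homogeneous in the equatorial variable factors into a
  latitude moment and an equatorial one. Thus 1/3 arises as \<open>(1/4) / (3/4)\<close> and 1/5 as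
  \<open>(1/8) / (5/8)\<close>.\<close>

lemma nu_of_mu:
  fixes F :: "V \<Rightarrow> real" and f :: "real^3 \<Rightarrow> real"
  assumes F: "continuous_on UNIV F"
    and Fr: "\<And>\<tau> \<xi>. (F (Th \<tau> \<xi>) + F (Th (-\<tau>) \<xi>)) / 2 = rr \<tau> ^ n * f \<xi>"
  shows "(\<integral>x. F (sgn x) \<partial>mu) = (\<integral>\<tau>. rr \<tau> ^ n \<partial>kap) * (\<integral>\<zeta>. f (sgn \<zeta>) \<partial>nu)"
proof -
  obtain K where K: "\<And>x. norm x \<le> 1 \<Longrightarrow> \<bar>F x\<bar> \<le> K" using bounded_on_unit[OF F] by blast
  have "(\<integral>x. F (sgn x) \<partial>mu) = (\<integral>\<tau>. (\<integral>\<zeta>. rr \<tau> ^ n * f (sgn \<zeta>) \<partial>nu) \<partial>kap)"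
    unfolding Fr[symmetric] by (rule polar[OF borel_measurable_continuous_onI[OF F] K])
  then show ?thesis by simp
qed

lemma kap_r: "(\<integral>\<tau>. rr \<tau> ^ 2 \<partial>kap) = 3 / 4" "(\<integral>\<tau>. rr \<tau> ^ 4 \<partial>kap) = 5 / 8"
proof -
  have 2: "rr \<tau> ^ 2 = 1 - tt \<tau> ^ 2" for \<tau> using tt_rr[of \<tau>] by simp
  have 4: "rr \<tau> ^ 4 = 1 - 2 * tt \<tau> ^ 2 + tt \<tau> ^ 4" for \<tau>
  proof -
    have "rr \<tau> ^ 4 = (rr \<tau> ^ 2) ^ 2" by (simp flip: power_mult)
    then show ?thesis unfolding 2 by (simp add: eval_nat_numeral algebra_simps)
  qed
  show "(\<integral>\<tau>. rr \<tau> ^ 2 \<partial>kap) = 3 / 4" "(\<integral>\<tau>. rr \<tau> ^ 4 \<partial>kap) = 5 / 8"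
    unfolding 2 4 using kap_poly[of 2 0] kap_poly[of 4 0] kap.prob_space by (simp_all add: kap_t2 kap_t4)
qed

lemma nu_inner11: "(\<integral>\<zeta>. inner (sgn \<zeta>) a * inner (sgn \<zeta>) b \<partial>nu) = inner a b / 3"
proof -
  have "(\<integral>x. inner (sgn x) (0::real, a) * inner (sgn x) (0, b) \<partial>mu) =
    (\<integral>\<tau>. rr \<tau> ^ 2 \<partial>kap) * (\<integral>\<zeta>. inner (sgn \<zeta>) a * inner (sgn \<zeta>) b \<partial>nu)"
    by (rule nu_of_mu[where F="\<lambda>x. inner x (0, a) * inner x (0, b)" and f="\<lambda>\<zeta>. inner \<zeta> a * inner \<zeta> b"])
       (auto intro!: continuous_intros simp: Th_eq inner_prod_def power2_eq_square)
  then show ?thesis unfolding integral_inner11 by (simp add: inner_prod_def kap_r)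
qed

lemma nu_inner31: "(\<integral>\<zeta>. (inner (sgn \<zeta>) a) ^ 3 * inner (sgn \<zeta>) b \<partial>nu) = inner a a * inner a b / 5"
proof -
  have "(\<integral>x. (inner (sgn x) (0::real, a)) ^ 3 * inner (sgn x) (0, b) \<partial>mu) =
    (\<integral>\<tau>. rr \<tau> ^ 4 \<partial>kap) * (\<integral>\<zeta>. (inner (sgn \<zeta>) a) ^ 3 * inner (sgn \<zeta>) b \<partial>nu)"
    by (rule nu_of_mu[where F="\<lambda>x. (inner x (0, a)) ^ 3 * inner x (0, b)" and f="\<lambda>\<zeta>. (inner \<zeta> a) ^ 3 * inner \<zeta> b"])
       (auto intro!: continuous_intros simp: Th_eq inner_prod_def power3_eq_cube power4_eq_xxxx)
  then show ?thesis unfolding integral_inner31 by (simp add: inner_prod_def kap_r)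
qed

text \<open>On unit vectors this is the orthogonal projection of \<open>m\<close> to the harmonics
  of degree 3.\<close>

definition conv :: "(V \<Rightarrow> real) \<Rightarrow> V \<Rightarrow> real" where
  "conv m x = (\<integral>y. m y * K3 (inner x (sgn y)) \<partial>mu)"

abbreviation p1 :: "V \<Rightarrow> real" where "p1 y \<equiv> fst (sgn y)"
abbreviation p2 :: "V \<Rightarrow> real^3" where "p2 y \<equiv> snd (sgn y)"

text \<open>
  The coefficients of \<open>conv m (t, r \<xi>)\<close> with respect to \<open>t\<^sup>3\<close>, \<open>t\<^sup>2 r\<close>, \<open>t r\<^sup>2\<close> and
  \<open>r\<^sup>3\<close>, after \<open>K3\<close> has been made homogeneous by means of \<open>t\<^sup>2 + r\<^sup>2 = 1\<close>.
\<close>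

definition cA :: "(V \<Rightarrow> real) \<Rightarrow> real" where
  "cA m = (\<integral>y. m y * (32 * p1 y ^ 3 - 16 * p1 y) \<partial>mu)"
definition cB :: "(V \<Rightarrow> real) \<Rightarrow> real^3 \<Rightarrow> real" where
  "cB m \<xi> = (\<integral>y. m y * ((96 * (p1 y)\<^sup>2 - 16) * inner \<xi> (p2 y)) \<partial>mu)"
definition cC :: "(V \<Rightarrow> real) \<Rightarrow> real^3 \<Rightarrow> real" where
  "cC m \<xi> = (\<integral>y. m y * (96 * p1 y * (inner \<xi> (p2 y))\<^sup>2 - 16 * p1 y) \<partial>mu)"
definition cD :: "(V \<Rightarrow> real) \<Rightarrow> real^3 \<Rightarrow> real" where
  "cD m \<xi> = (\<integral>y. m y * (32 * (inner \<xi> (p2 y)) ^ 3 - 16 * inner \<xi> (p2 y)) \<partial>mu)"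

lemma abs_p1: "\<bar>p1 y\<bar> \<le> 1" and norm_p2: "norm (p2 y) \<le> 1"
proof -
  have n: "norm (sgn y) \<le> 1" by (simp add: norm_sgn)
  show "\<bar>p1 y\<bar> \<le> 1" using norm_fst_le[of "p1 y" "p2 y"] n by simp
  show "norm (p2 y) \<le> 1" using norm_snd_le[of "p2 y" "p1 y"] n by simp
qed

lemma abs_inner_le1: "norm x \<le> 1 \<Longrightarrow> norm y \<le> 1 \<Longrightarrow> \<bar>inner x y\<bar> \<le> 1" for x y :: "'a::real_inner"
  using Cauchy_Schwarz_ineq2[of x y] mult_le_one[of "norm x" "norm y"] by simp

lemma abs_diff_le: "\<bar>a\<bar> \<le> K \<Longrightarrow> \<bar>b\<bar> \<le> L \<Longrightarrow> \<bar>a - b\<bar> \<le> K + L" for a b K L :: real by linarith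

lemma abs_mult_pow:
  fixes c x :: real
  assumes "\<bar>x\<bar> \<le> 1" "0 \<le> c" shows "\<bar>c * x ^ n\<bar> \<le> c" "\<bar>c * x\<bar> \<le> c"
proof -
  have "\<bar>x\<bar> ^ n \<le> 1" using assms by (simp add: power_le_one)
  then show "\<bar>c * x ^ n\<bar> \<le> c" "\<bar>c * x\<bar> \<le> c" using assms by (simp_all add: abs_mult power_abs mult_left_le)
qed

lemma abs_K3: "\<bar>s\<bar> \<le> 1 \<Longrightarrow> \<bar>K3 s\<bar> \<le> 48"
  using abs_diff_le[OF abs_mult_pow(1)[of s 32 3] abs_mult_pow(2)[of s 16]] by (simp add: K3_def)

lemma K3_measurable [measurable]: "K3 \<in> borel_measurable borel" unfolding K3_def[abs_def] by measurable

lemma abs_mult_le1: "\<bar>a\<bar> \<le> 1 \<Longrightarrow> \<bar>b\<bar> \<le> K \<Longrightarrow> \<bar>a * b\<bar> \<le> K" for a b K :: real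
  using mult_mono[of "\<bar>a\<bar>" 1 "\<bar>b\<bar>" K] by (simp add: abs_mult)

lemma abs_mu_le:
  fixes f :: "V \<Rightarrow> real"
  assumes "\<And>y. \<bar>f y\<bar> \<le> K"
  shows "\<bar>\<integral>y. f y \<partial>mu\<bar> \<le> K"
proof (cases "integrable mu f")
  case True
  have "\<bar>\<integral>y. f y \<partial>mu\<bar> \<le> (\<integral>y. \<bar>f y\<bar> \<partial>mu)" by (rule integral_abs_bound)
  also have "\<dots> \<le> K" by (rule mu.integral_le_const) (use True assms in auto)
  finally show ?thesis .
qed (use assms[of 0] in \<open>auto simp: not_integrable_integral_eq\<close>)

text \<open>The class is stable under rotations and under multiplication by constants in
  \<open>[-1, 1]\<close>; both operations are applied to \<open>m\<close> later.\<close>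

locale test_fun =
  fixes m :: "V \<Rightarrow> real"
  assumes m_meas [measurable]: "m \<in> borel_measurable borel" and m_le: "\<And>y. \<bar>m y\<bar> \<le> 1"
begin

lemma integrable_m: "continuous_on UNIV F \<Longrightarrow> integrable mu (\<lambda>y. m y * F (sgn y))" for F :: "V \<Rightarrow> real"
proof -
  assume F: "continuous_on UNIV F"
  then obtain K where K: "\<And>x. norm x \<le> 1 \<Longrightarrow> \<bar>F x\<bar> \<le> K" using bounded_on_unit[OF F] by blast
  have [measurable]: "F \<in> borel_measurable borel" by (rule borel_measurable_continuous_onI[OF F])
  have "\<bar>m y * F (sgn y)\<bar> \<le> K" for y by (rule abs_mult_le1[OF m_le K]) (simp add: norm_sgn)
  then show ?thesis by (intro mu.integrable_const_bound[where B=K]) auto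
qed

lemma conv_measurable [measurable]: "conv m \<in> borel_measurable borel"
  unfolding conv_def[abs_def] by measurable
lemma cB_measurable [measurable]: "cB m \<in> borel_measurable borel"
  unfolding cB_def[abs_def] by measurable
lemma cC_measurable [measurable]: "cC m \<in> borel_measurable borel"
  unfolding cC_def[abs_def] by measurable
lemma cD_measurable [measurable]: "cD m \<in> borel_measurable borel"
  unfolding cD_def[abs_def] by measurable

lemma abs_conv: "norm x \<le> 1 \<Longrightarrow> \<bar>conv m x\<bar> \<le> 48"
  unfolding conv_def
  by (intro abs_mu_le abs_mult_le1 m_le abs_K3 abs_inner_le1) (auto simp: norm_sgn)

text \<open>Crude bounds whose purpose is integrability and the exchange of integrals.\<close>

lemma abs_coeffs:
  assumes "norm \<xi> \<le> 1"
  shows abs_cA: "\<bar>cA m\<bar> \<le> 48" and abs_cB: "\<bar>cB m \<xi>\<bar> \<le> 112" and abs_cC: "\<bar>cC m \<xi>\<bar> \<le> 112" and abs_cD: "\<bar>cD m \<xi>\<bar> \<le> 48"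
proof -
  have h: "\<bar>inner \<xi> (p2 y)\<bar> \<le> 1" for y by (rule abs_inner_le1[OF assms norm_p2])
  have "\<bar>32 * p1 y ^ 3 - 16 * p1 y\<bar> \<le> 32 + 16" for y
    by (intro abs_diff_le abs_mult_pow abs_p1) auto
  then show "\<bar>cA m\<bar> \<le> 48" unfolding cA_def by (intro abs_mu_le abs_mult_le1 m_le) auto
  have "\<bar>32 * (inner \<xi> (p2 y)) ^ 3 - 16 * inner \<xi> (p2 y)\<bar> \<le> 32 + 16" for y
    by (intro abs_diff_le abs_mult_pow h) auto
  then show "\<bar>cD m \<xi>\<bar> \<le> 48" unfolding cD_def by (intro abs_mu_le abs_mult_le1 m_le) auto
  have "\<bar>96 * (p1 y)\<^sup>2 - 16\<bar> \<le> 96 + 16" for y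
    by (intro abs_diff_le abs_mult_pow abs_p1) auto
  then have "\<bar>inner \<xi> (p2 y) * (96 * (p1 y)\<^sup>2 - 16)\<bar> \<le> 112" for y
    by (intro abs_mult_le1 h) auto
  then have "\<bar>(96 * (p1 y)\<^sup>2 - 16) * inner \<xi> (p2 y)\<bar> \<le> 112" for y
    by (simp only: mult.commute)
  from abs_mult_le1[OF m_le this] show "\<bar>cB m \<xi>\<bar> \<le> 112" unfolding cB_def by (rule abs_mu_le)
  have "\<bar>p1 y * (96 * (inner \<xi> (p2 y))\<^sup>2 - 16)\<bar> \<le> 96 + 16" for y
    by (intro abs_mult_le1 abs_p1 abs_diff_le abs_mult_pow h) auto
  then have "\<bar>96 * p1 y * (inner \<xi> (p2 y))\<^sup>2 - 16 * p1 y\<bar> \<le> 112" for y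
    by (simp add: algebra_simps)
  then show "\<bar>cC m \<xi>\<bar> \<le> 112" unfolding cC_def by (intro abs_mu_le abs_mult_le1 m_le) auto
qed

lemma conv_Th:
  "conv m (Th \<tau> \<xi>) = (cD m \<xi> * rr \<tau> ^ 3 + cB m \<xi> * ((tt \<tau>)\<^sup>2 * rr \<tau>)) + tt \<tau> * (cC m \<xi> * (rr \<tau>)\<^sup>2 + cA m * (tt \<tau>)\<^sup>2)"
proof -
  define t r where "t = tt \<tau>" and "r = rr \<tau>"
  have tr: "t\<^sup>2 + r\<^sup>2 = 1" by (simp add: t_def r_def tt_rr)
  have e: "K3 (t * a + r * h) = (32 * h ^ 3 - 16 * h) * r ^ 3 + ((96 * a\<^sup>2 - 16) * h) * (t\<^sup>2 * r)
     + (96 * a * h\<^sup>2 - 16 * a) * (t * r\<^sup>2) + (32 * a ^ 3 - 16 * a) * t ^ 3" for a h :: real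
  proof -
    have "K3 (t * a + r * h) = 32 * (t * a + r * h) ^ 3 - 16 * (t * a + r * h) * (t\<^sup>2 + r\<^sup>2)"
      unfolding tr by (simp add: K3_def)
    then show ?thesis by (simp add: power2_eq_square power3_eq_cube algebra_simps)
  qed
  have i: "inner (Th \<tau> \<xi>) (sgn y) = t * p1 y + r * inner \<xi> (p2 y)" for y
    by (simp add: Th_eq inner_prod_def t_def r_def)
  have "conv m (Th \<tau> \<xi>) = (\<integral>y. (m y * (32 * (inner \<xi> (p2 y)) ^ 3 - 16 * inner \<xi> (p2 y))) * r ^ 3
      + (m y * ((96 * (p1 y)\<^sup>2 - 16) * inner \<xi> (p2 y))) * (t\<^sup>2 * r)
      + (m y * (96 * p1 y * (inner \<xi> (p2 y))\<^sup>2 - 16 * p1 y)) * (t * r\<^sup>2)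
      + (m y * (32 * p1 y ^ 3 - 16 * p1 y)) * t ^ 3 \<partial>mu)"
    unfolding conv_def i e by (intro Bochner_Integration.integral_cong refl) (simp only: distrib_left mult.assoc)
  also have "\<dots> = cD m \<xi> * r ^ 3 + cB m \<xi> * (t\<^sup>2 * r) + cC m \<xi> * (t * r\<^sup>2) + cA m * t ^ 3"
  proof -
    have 1: "integrable mu (\<lambda>y. m y * (32 * (inner \<xi> (p2 y)) ^ 3 - 16 * inner \<xi> (p2 y)))"
      by (rule integrable_m[where F="\<lambda>y. 32 * (inner \<xi> (snd y)) ^ 3 - 16 * inner \<xi> (snd y)"]) (intro continuous_intros)
    have 2: "integrable mu (\<lambda>y. m y * ((96 * (p1 y)\<^sup>2 - 16) * inner \<xi> (p2 y)))"
      by (rule integrable_m[where F="\<lambda>y. (96 * (fst y)\<^sup>2 - 16) * inner \<xi> (snd y)"]) (intro continuous_intros)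
    have 3: "integrable mu (\<lambda>y. m y * (96 * p1 y * (inner \<xi> (p2 y))\<^sup>2 - 16 * p1 y))"
      by (rule integrable_m[where F="\<lambda>y. 96 * fst y * (inner \<xi> (snd y))\<^sup>2 - 16 * fst y"]) (intro continuous_intros)
    have 4: "integrable mu (\<lambda>y. m y * (32 * p1 y ^ 3 - 16 * p1 y))"
      by (rule integrable_m[where F="\<lambda>y. 32 * fst y ^ 3 - 16 * fst y"]) (intro continuous_intros)
    note 5 = integrable_mult_left[OF 1] integrable_mult_left[OF 2] integrable_mult_left[OF 3] integrable_mult_left[OF 4]
    show ?thesis
      unfolding cA_def cB_def cC_def cD_def
      by (simp only: 5 Bochner_Integration.integral_add Bochner_Integration.integrable_add integral_mult_left_zero)
  qed
  finally show ?thesis by (simp add: t_def r_def power2_eq_square power3_eq_cube algebra_simps)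
qed

text \<open>\<open>cB m\<close> is linear on the equatorial space; this is the vector that
  represents it, so its equatorial means reduce to the moments of \<open>nu\<close>.\<close>

definition vB :: "real^3" where
  "vB = (\<integral>y. (m y * (96 * (p1 y)\<^sup>2 - 16)) *\<^sub>R p2 y \<partial>mu)"

lemma integrable_vB: "integrable mu (\<lambda>y. (m y * (96 * (p1 y)\<^sup>2 - 16)) *\<^sub>R p2 y)"
proof (rule mu.integrable_const_bound[where B=112])
  have "\<bar>96 * (p1 y)\<^sup>2 - 16\<bar> \<le> 96 + 16" for y
    by (intro abs_diff_le abs_mult_pow abs_p1) auto
  then have "\<bar>m y * (96 * (p1 y)\<^sup>2 - 16)\<bar> \<le> 112" for y by (intro abs_mult_le1 m_le) auto
  then have "\<bar>m y * (96 * (p1 y)\<^sup>2 - 16)\<bar> * norm (p2 y) \<le> 112 * 1" for y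
    by (rule mult_mono) (auto intro: norm_p2)
  then show "AE y in mu. norm ((m y * (96 * (p1 y)\<^sup>2 - 16)) *\<^sub>R p2 y) \<le> 112" by simp
qed measurable

lemma cB_eq: "cB m \<xi> = inner \<xi> vB"
proof -
  have "inner \<xi> vB = (\<integral>y. inner \<xi> ((m y * (96 * (p1 y)\<^sup>2 - 16)) *\<^sub>R p2 y) \<partial>mu)"
    unfolding vB_def by (rule integral_inner_right[symmetric]) (rule integrable_vB)
  then show ?thesis by (simp add: cB_def mult.assoc)
qed

lemma AE_p2: "AE y in mu. inner (p2 y) (p2 y) = 1 - (p1 y)\<^sup>2"
  using AE_inner_sgn by eventually_elim (simp add: inner_prod_def power2_eq_square)

lemma sgn3_le: "norm (sgn \<zeta>) \<le> 1" for \<zeta> :: "real^3" by (simp add: norm_sgn)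

lemma nu_integrable:
  fixes f :: "real^3 \<Rightarrow> real"
  assumes "f \<in> borel_measurable borel" "\<And>\<zeta>. \<bar>f \<zeta>\<bar> \<le> K"
  shows "integrable nu f"
  by (rule nu.integrable_const_bound[where B=K]) (use assms in auto)

lemma nu_cB2: "(\<integral>\<zeta>. (cB m (sgn \<zeta>))\<^sup>2 \<partial>nu) = inner vB vB / 3"
  using nu_inner11[of vB vB] by (simp add: cB_eq power2_eq_square)

text \<open>A trace of harmonicity: averaging a cubic harmonic around the pole leaves a multiple of
  \<open>t^3 - t * r^2 = 2 * t^3 - t\<close>, hence of \<open>K3\<close>. In the computation the
  average replaces the squared equatorial product by \<open>(1 - p1^2) / 3\<close>.\<close>

lemma nu_cC: "(\<integral>\<zeta>. cC m (sgn \<zeta>) \<partial>nu) = - cA m"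
proof -
  let ?f = "\<lambda>\<zeta> y. m y * (96 * p1 y * (inner (sgn \<zeta>) (p2 y))\<^sup>2 - 16 * p1 y)"
  have b: "\<bar>?f \<zeta> y\<bar> \<le> 112" for \<zeta> y
  proof -
    have "\<bar>p1 y * (96 * (inner (sgn \<zeta>) (p2 y))\<^sup>2 - 16)\<bar> \<le> 96 + 16"
      by (intro abs_mult_le1 abs_p1 abs_diff_le abs_mult_pow abs_inner_le1 norm_p2 sgn3_le) auto
    then have "\<bar>96 * p1 y * (inner (sgn \<zeta>) (p2 y))\<^sup>2 - 16 * p1 y\<bar> \<le> 112" by (simp add: algebra_simps)
    then show ?thesis by (intro abs_mult_le1 m_le)
  qed
  have "(\<integral>\<zeta>. cC m (sgn \<zeta>) \<partial>nu) = (\<integral>y. (\<integral>\<zeta>. ?f \<zeta> y \<partial>nu) \<partial>mu)"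
    unfolding cC_def by (rule nu_mu(1)[OF _ b]) measurable
  also have "\<dots> = (\<integral>y. - (m y * (32 * p1 y ^ 3 - 16 * p1 y)) \<partial>mu)"
  proof (rule integral_cong_AE)
    show "AE y in mu. (\<integral>\<zeta>. ?f \<zeta> y \<partial>nu) = - (m y * (32 * p1 y ^ 3 - 16 * p1 y))"
      using AE_p2
    proof eventually_elim
      fix y assume y: "inner (p2 y) (p2 y) = 1 - (p1 y)\<^sup>2"
      have i: "integrable nu (\<lambda>\<zeta>. 96 * p1 y * (inner (sgn \<zeta>) (p2 y) * inner (sgn \<zeta>) (p2 y)))"
        by (intro integrable_mult_right nu_integrable[where K=1] abs_mult_le1 abs_inner_le1 norm_p2 sgn3_le) measurable
      have "(\<integral>\<zeta>. ?f \<zeta> y \<partial>nu) = m y * ((\<integral>\<zeta>. 96 * p1 y * (inner (sgn \<zeta>) (p2 y) * inner (sgn \<zeta>) (p2 y)) - 16 * p1 y \<partial>nu))"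
        unfolding power2_eq_square by (rule integral_mult_right_zero)
      also have "(\<integral>\<zeta>. 96 * p1 y * (inner (sgn \<zeta>) (p2 y) * inner (sgn \<zeta>) (p2 y)) - 16 * p1 y \<partial>nu)
        = 96 * p1 y * (inner (p2 y) (p2 y) / 3) - 16 * p1 y"
        unfolding nu_inner11[symmetric] by (subst Bochner_Integration.integral_diff[OF i]) (use nu.prob_space in simp_all)
      finally show "(\<integral>\<zeta>. ?f \<zeta> y \<partial>nu) = - (m y * (32 * p1 y ^ 3 - 16 * p1 y))"
        unfolding y by (simp add: power2_eq_square power3_eq_cube algebra_simps)
    qed
  qed measurable
  finally show ?thesis by (simp add: cA_def)
qed

text \<open>The second trace of harmonicity: for a linear form \<open>l\<close> on the equatorial
  space, the harmonic cubic built from it is \<open>l * (t^2 - r^2 / 5)\<close>. So the linear part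
  of \<open>cD\<close> is \<open>-1/5\<close> times \<open>cB\<close>, and \<open>cB\<close> has
  mean square \<open>inner vB vB / 3\<close>.\<close>

lemma nu_cDB: "(\<integral>\<zeta>. cD m (sgn \<zeta>) * cB m (sgn \<zeta>) \<partial>nu) = - (inner vB vB / 15)"
proof -
  let ?f = "\<lambda>\<zeta> y. (m y * (32 * (inner (sgn \<zeta>) (p2 y)) ^ 3 - 16 * inner (sgn \<zeta>) (p2 y))) * inner (sgn \<zeta>) vB"
  have b: "\<bar>?f \<zeta> y\<bar> \<le> 48 * 112" for \<zeta> y
  proof -
    have "\<bar>32 * (inner (sgn \<zeta>) (p2 y)) ^ 3 - 16 * inner (sgn \<zeta>) (p2 y)\<bar> \<le> 32 + 16"
      by (intro abs_diff_le abs_mult_pow abs_inner_le1 norm_p2 sgn3_le) auto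
    then have "\<bar>m y * (32 * (inner (sgn \<zeta>) (p2 y)) ^ 3 - 16 * inner (sgn \<zeta>) (p2 y))\<bar> \<le> 48"
      by (intro abs_mult_le1 m_le) auto
    then show ?thesis using abs_cB[OF sgn3_le] unfolding abs_mult cB_eq by (intro mult_mono) auto
  qed
  have "(\<integral>\<zeta>. cD m (sgn \<zeta>) * cB m (sgn \<zeta>) \<partial>nu) = (\<integral>\<zeta>. (\<integral>y. ?f \<zeta> y \<partial>mu) \<partial>nu)"
    unfolding cD_def cB_eq by simp
  also have "\<dots> = (\<integral>y. (\<integral>\<zeta>. ?f \<zeta> y \<partial>nu) \<partial>mu)"
    by (rule nu_mu(1)[OF _ b]) measurable
  also have "\<dots> = (\<integral>y. - (m y * ((96 * (p1 y)\<^sup>2 - 16) * inner vB (p2 y)) / 15) \<partial>mu)"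
  proof (rule integral_cong_AE)
    show "AE y in mu. (\<integral>\<zeta>. ?f \<zeta> y \<partial>nu) = - (m y * ((96 * (p1 y)\<^sup>2 - 16) * inner vB (p2 y)) / 15)"
      using AE_p2
    proof eventually_elim
      fix y assume y: "inner (p2 y) (p2 y) = 1 - (p1 y)\<^sup>2"
      have B: "\<bar>inner (sgn \<zeta>) vB\<bar> \<le> 112" for \<zeta> using abs_cB[OF sgn3_le] unfolding cB_eq .
      have i1: "integrable nu (\<lambda>\<zeta>. inner (sgn \<zeta>) (p2 y) * inner (sgn \<zeta>) vB)"
        by (intro nu_integrable[where K=112] abs_mult_le1 abs_inner_le1 norm_p2 sgn3_le B) measurable
      have i3: "integrable nu (\<lambda>\<zeta>. inner (sgn \<zeta>) (p2 y) ^ 3 * inner (sgn \<zeta>) vB)"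
      proof (intro nu_integrable[where K=112] abs_mult_le1 B)
        show "\<bar>inner (sgn \<zeta>) (p2 y) ^ 3\<bar> \<le> 1" for \<zeta>
          using abs_mult_pow(1)[OF abs_inner_le1[OF sgn3_le norm_p2], of 1 \<zeta> y 3] by simp
      qed measurable
      have "(\<integral>\<zeta>. ?f \<zeta> y \<partial>nu) = (\<integral>\<zeta>. m y * 32 * (inner (sgn \<zeta>) (p2 y) ^ 3 * inner (sgn \<zeta>) vB) -
          m y * 16 * (inner (sgn \<zeta>) (p2 y) * inner (sgn \<zeta>) vB) \<partial>nu)"
        by (intro Bochner_Integration.integral_cong refl) (simp add: algebra_simps)
      also have "\<dots> = m y * 32 * (inner (p2 y) (p2 y) * inner (p2 y) vB / 5) - m y * 16 * (inner (p2 y) vB / 3)"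
        unfolding nu_inner11[symmetric] nu_inner31[symmetric]
        by (subst Bochner_Integration.integral_diff) (use i1 i3 in simp_all)
      finally show "(\<integral>\<zeta>. ?f \<zeta> y \<partial>nu) = - (m y * ((96 * (p1 y)\<^sup>2 - 16) * inner vB (p2 y)) / 15)"
        unfolding y by (simp add: inner_commute[of vB] field_simps)
    qed
  qed measurable
  also have "\<dots> = - (cB m vB / 15)" by (simp add: cB_def)
  finally show ?thesis by (simp add: cB_eq)
qed

end

section \<open>The excess inequality for cubic harmonics\<close>

lemma kap_products:
  shows kap_r6: "(\<integral>\<tau>. rr \<tau> ^ 6 \<partial>kap) = 35 / 64"
    and kap_t2r4: "(\<integral>\<tau>. tt \<tau> ^ 2 * rr \<tau> ^ 4 \<partial>kap) = 5 / 64"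
    and kap_t4r2: "(\<integral>\<tau>. tt \<tau> ^ 4 * rr \<tau> ^ 2 \<partial>kap) = 3 / 64"
    and kap_t1r4: "(\<integral>\<tau>. tt \<tau> * rr \<tau> ^ 4 \<partial>kap) = 4 / (7 * pi)"
    and kap_t3r2: "(\<integral>\<tau>. tt \<tau> ^ 3 * rr \<tau> ^ 2 \<partial>kap) = 8 / (35 * pi)"
proof -
  have r2: "rr \<tau> ^ 2 = 1 - tt \<tau> ^ 2" for \<tau> using tt_rr[of \<tau>] by simp
  have r4: "rr \<tau> ^ 4 = (1 - tt \<tau> ^ 2) ^ 2" for \<tau> unfolding r2[symmetric] by (simp flip: power_mult)
  have r6: "rr \<tau> ^ 6 = (1 - tt \<tau> ^ 2) ^ 3" for \<tau> unfolding r2[symmetric] by (simp flip: power_mult)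
  have i: "integrable kap (\<lambda>\<tau>. tt \<tau> ^ n)" for n using kap_poly[of n 0] by simp
  have i1: "integrable kap tt" using i[of 1] by simp
  have e6: "rr \<tau> ^ 6 = 1 - 3 * tt \<tau> ^ 2 + 3 * tt \<tau> ^ 4 - tt \<tau> ^ 6" for \<tau>
    unfolding r6 by (simp add: eval_nat_numeral algebra_simps)
  show "(\<integral>\<tau>. rr \<tau> ^ 6 \<partial>kap) = 35 / 64"
    unfolding e6 using kap.prob_space by (simp add: i kap_t2 kap_t4 kap_t6)
  have e: "tt \<tau> ^ 2 * rr \<tau> ^ 4 = tt \<tau> ^ 2 - 2 * tt \<tau> ^ 4 + tt \<tau> ^ 6" for \<tau>
    unfolding r4 by (simp add: eval_nat_numeral algebra_simps)
  show "(\<integral>\<tau>. tt \<tau> ^ 2 * rr \<tau> ^ 4 \<partial>kap) = 5 / 64"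
    unfolding e by (simp add: i kap_t2 kap_t4 kap_t6)
  have e: "tt \<tau> ^ 4 * rr \<tau> ^ 2 = tt \<tau> ^ 4 - tt \<tau> ^ 6" for \<tau>
    unfolding r2 by (simp add: eval_nat_numeral algebra_simps)
  show "(\<integral>\<tau>. tt \<tau> ^ 4 * rr \<tau> ^ 2 \<partial>kap) = 3 / 64"
    unfolding e by (simp add: i kap_t4 kap_t6)
  have e: "tt \<tau> * rr \<tau> ^ 4 = tt \<tau> - 2 * tt \<tau> ^ 3 + tt \<tau> ^ 5" for \<tau>
    unfolding r4 by (simp add: eval_nat_numeral algebra_simps)
  show "(\<integral>\<tau>. tt \<tau> * rr \<tau> ^ 4 \<partial>kap) = 4 / (7 * pi)"
    unfolding e by (simp add: i i1 kap_t1 kap_t3 kap_t5 field_simps)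
  have e: "tt \<tau> ^ 3 * rr \<tau> ^ 2 = tt \<tau> ^ 3 - tt \<tau> ^ 5" for \<tau>
    unfolding r2 by (simp add: eval_nat_numeral algebra_simps)
  show "(\<integral>\<tau>. tt \<tau> ^ 3 * rr \<tau> ^ 2 \<partial>kap) = 8 / (35 * pi)"
    unfolding e by (simp add: i kap_t3 kap_t5 field_simps)
qed

lemma abs_pow: "\<bar>x\<bar> \<le> 1 \<Longrightarrow> \<bar>x ^ n\<bar> \<le> 1" for x :: real
  by (simp add: power_abs power_le_one)

lemma abs_max0: "x \<le> K \<Longrightarrow> 0 \<le> K \<Longrightarrow> \<bar>max 0 x\<bar> \<le> K" for x K :: real by simp

lemma abs_half: "\<bar>a\<bar> \<le> K \<Longrightarrow> \<bar>b\<bar> \<le> K \<Longrightarrow> \<bar>(a + b) / 2\<bar> \<le> K" for a b K :: real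
  by (auto simp: abs_le_iff field_simps)

lemma abs_add_le: "\<bar>a\<bar> \<le> K \<Longrightarrow> \<bar>b\<bar> \<le> L \<Longrightarrow> \<bar>a + b\<bar> \<le> K + L" for a b K L :: real by linarith

lemma abs_mult_le1': "\<bar>a\<bar> \<le> K \<Longrightarrow> \<bar>b\<bar> \<le> 1 \<Longrightarrow> \<bar>a * b\<bar> \<le> K" for a b K :: real
  using abs_mult_le1[of b a K] by (simp add: mult.commute)

lemma sq_le: "\<bar>x\<bar> \<le> K \<Longrightarrow> \<bar>x\<^sup>2\<bar> \<le> K * K" for x K :: real
  using mult_mono[of "\<bar>x\<bar>" K "\<bar>x\<bar>" K] by (simp add: power2_eq_square abs_mult)

lemma abs_tt: "\<bar>tt \<tau>\<bar> \<le> 1" and abs_rr: "\<bar>rr \<tau>\<bar> \<le> 1"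
  using tt_le[of \<tau>] tt_ge[of \<tau>] rr_pos[of \<tau>] rr_le[of \<tau>] by auto

context test_fun
begin

definition evn :: "real \<Rightarrow> real^3 \<Rightarrow> real" where
  "evn \<tau> \<zeta> = cD m (sgn \<zeta>) * rr \<tau> ^ 3 + cB m (sgn \<zeta>) * ((tt \<tau>)\<^sup>2 * rr \<tau>)"
definition odd' :: "real \<Rightarrow> real^3 \<Rightarrow> real" where
  "odd' \<tau> \<zeta> = cC m (sgn \<zeta>) * (rr \<tau>)\<^sup>2 + cA m * (tt \<tau>)\<^sup>2"

lemma evn_measurable [measurable]: "(\<lambda>x. evn (f x) (g x)) \<in> borel_measurable M"
  if [measurable]: "f \<in> borel_measurable M" "g \<in> borel_measurable M"
  unfolding evn_def by measurable

lemma odd_measurable [measurable]: "(\<lambda>x. odd' (f x) (g x)) \<in> borel_measurable M"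
  if [measurable]: "f \<in> borel_measurable M" "g \<in> borel_measurable M"
  unfolding odd'_def by measurable

lemma abs_evn: "\<bar>evn \<tau> \<zeta>\<bar> \<le> 160"
proof -
  have "\<bar>evn \<tau> \<zeta>\<bar> \<le> 48 + 112" unfolding evn_def
    by (intro abs_add_le abs_mult_le1' abs_cD abs_cB sgn3_le abs_pow abs_rr abs_mult_le1 abs_tt)
  then show ?thesis by simp
qed

lemma abs_odd: "\<bar>odd' \<tau> \<zeta>\<bar> \<le> 160"
proof -
  have "\<bar>odd' \<tau> \<zeta>\<bar> \<le> 112 + 48" unfolding odd'_def
    by (intro abs_add_le abs_mult_le1' abs_cA[of 0] abs_cC sgn3_le abs_pow abs_rr abs_tt) simp
  then show ?thesis by simp
qed

lemma conv_evn_odd: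
  "conv m (Th \<tau> (sgn \<zeta>)) = evn \<tau> \<zeta> + tt \<tau> * odd' \<tau> \<zeta>"
  "conv m (Th (- \<tau>) (sgn \<zeta>)) = evn \<tau> \<zeta> - tt \<tau> * odd' \<tau> \<zeta>"
  by (simp_all add: conv_Th evn_def odd'_def)

lemma abs_tt_odd: "\<bar>tt \<tau> * odd' \<tau> \<zeta>\<bar> \<le> 160" by (rule abs_mult_le1[OF abs_tt abs_odd])

lemma nu_int:
  "integrable nu (\<lambda>\<zeta>. (cD m (sgn \<zeta>))\<^sup>2)" "integrable nu (\<lambda>\<zeta>. (cB m (sgn \<zeta>))\<^sup>2)" "integrable nu (\<lambda>\<zeta>. (cC m (sgn \<zeta>))\<^sup>2)"
  "integrable nu (\<lambda>\<zeta>. cD m (sgn \<zeta>) * cB m (sgn \<zeta>))" "integrable nu (\<lambda>\<zeta>. cC m (sgn \<zeta>))"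
proof -
  note b = abs_cB[OF sgn3_le] abs_cC[OF sgn3_le] abs_cD[OF sgn3_le]
  show "integrable nu (\<lambda>\<zeta>. (cD m (sgn \<zeta>))\<^sup>2)" by (rule nu_integrable[OF _ sq_le[OF b(3)]]) measurable
  show "integrable nu (\<lambda>\<zeta>. (cB m (sgn \<zeta>))\<^sup>2)" by (rule nu_integrable[OF _ sq_le[OF b(1)]]) measurable
  show "integrable nu (\<lambda>\<zeta>. (cC m (sgn \<zeta>))\<^sup>2)" by (rule nu_integrable[OF _ sq_le[OF b(2)]]) measurable
  show "integrable nu (\<lambda>\<zeta>. cC m (sgn \<zeta>))" by (rule nu_integrable[OF _ b(2)]) measurable
  have "\<bar>cD m (sgn \<zeta>) * cB m (sgn \<zeta>)\<bar> \<le> 48 * 112" for \<zeta>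
    unfolding abs_mult by (rule mult_mono[OF b(3) b(1)]) auto
  then show "integrable nu (\<lambda>\<zeta>. cD m (sgn \<zeta>) * cB m (sgn \<zeta>))" by (intro nu_integrable) measurable
qed

text \<open>The product of even and odd part cancels between \<open>\<tau>\<close> and
  \<open>-\<tau>\<close>; the two mixed equatorial means are then eliminated by
  \<open>nu_cDB\<close> and \<open>nu_cC\<close>, which leaves a diagonal form.\<close>

lemma conv_sq_expand:
  "(\<integral>x. (conv m (sgn x))\<^sup>2 \<partial>mu) = 35 / 64 * (\<integral>\<zeta>. (cD m (sgn \<zeta>))\<^sup>2 \<partial>nu) + 1 / 64 * (\<integral>\<zeta>. (cB m (sgn \<zeta>))\<^sup>2 \<partial>nu)
    + 5 / 64 * (\<integral>\<zeta>. (cC m (sgn \<zeta>))\<^sup>2 \<partial>nu) - 1 / 64 * (cA m)\<^sup>2"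
proof -
  let ?G = "\<lambda>\<tau> \<zeta>. (evn \<tau> \<zeta>)\<^sup>2 + (tt \<tau> * odd' \<tau> \<zeta>)\<^sup>2"
  have kG: "(\<integral>\<tau>. ?G \<tau> \<zeta> \<partial>kap) = 35 / 64 * (cD m (sgn \<zeta>))\<^sup>2 + 10 / 64 * (cD m (sgn \<zeta>) * cB m (sgn \<zeta>)) + 3 / 64 * (cB m (sgn \<zeta>))\<^sup>2
      + 5 / 64 * (cC m (sgn \<zeta>))\<^sup>2 + 6 / 64 * cA m * cC m (sgn \<zeta>) + 5 / 64 * (cA m)\<^sup>2" for \<zeta>
  proof -
    define D B C A where "D = cD m (sgn \<zeta>)" and "B = cB m (sgn \<zeta>)" and "C = cC m (sgn \<zeta>)" and "A = cA m"
    have "(D * r ^ 3 + B * (t\<^sup>2 * r))\<^sup>2 + (t * (C * r\<^sup>2 + A * t\<^sup>2))\<^sup>2 =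
      D\<^sup>2 * r ^ 6 + (2 * (D * B) + C\<^sup>2) * (t ^ 2 * r ^ 4) + (B\<^sup>2 + 2 * C * A) * (t ^ 4 * r ^ 2) + A\<^sup>2 * t ^ 6" for t r
      by (simp add: eval_nat_numeral algebra_simps)
    then have "(\<integral>\<tau>. ?G \<tau> \<zeta> \<partial>kap) = (\<integral>\<tau>. D\<^sup>2 * rr \<tau> ^ 6 + (2 * (D * B) + C\<^sup>2) * (tt \<tau> ^ 2 * rr \<tau> ^ 4) +
        (B\<^sup>2 + 2 * C * A) * (tt \<tau> ^ 4 * rr \<tau> ^ 2) + A\<^sup>2 * tt \<tau> ^ 6 \<partial>kap)"
      unfolding evn_def odd'_def D_def[symmetric] B_def[symmetric] C_def[symmetric] A_def[symmetric] by simp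
    also have "\<dots> = D\<^sup>2 * (35 / 64) + (2 * (D * B) + C\<^sup>2) * (5 / 64) + (B\<^sup>2 + 2 * C * A) * (3 / 64) + A\<^sup>2 * (5 / 64)"
      using kap_poly[of 0 6] kap_poly[of 2 4] kap_poly[of 4 2] kap_poly[of 6 0]
      by (simp add: kap_r6 kap_t2r4 kap_t4r2 kap_t6)
    finally show ?thesis unfolding D_def B_def C_def A_def by (simp add: algebra_simps)
  qed
  have "(\<integral>x. (conv m (sgn x))\<^sup>2 \<partial>mu) =
      (\<integral>\<tau>. (\<integral>\<zeta>. ((conv m (Th \<tau> (sgn \<zeta>)))\<^sup>2 + (conv m (Th (-\<tau>) (sgn \<zeta>)))\<^sup>2) / 2 \<partial>nu) \<partial>kap)"
    by (rule polar[where F="\<lambda>x. (conv m x)\<^sup>2", OF _ sq_le[OF abs_conv]]) measurable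
  also have "\<dots> = (\<integral>\<tau>. (\<integral>\<zeta>. ?G \<tau> \<zeta> \<partial>nu) \<partial>kap)"
    unfolding conv_evn_odd(2) unfolding conv_evn_odd(1) by (intro Bochner_Integration.integral_cong refl) (simp add: power2_eq_square field_simps)
  also have "\<dots> = (\<integral>\<zeta>. (\<integral>\<tau>. ?G \<tau> \<zeta> \<partial>kap) \<partial>nu)"
    by (rule kap_nu(1)[OF _ abs_add_le[OF sq_le[OF abs_evn] sq_le[OF abs_tt_odd]]]) measurable
  also have "\<dots> =
    35 / 64 * (\<integral>\<zeta>. (cD m (sgn \<zeta>))\<^sup>2 \<partial>nu) + 10 / 64 * (\<integral>\<zeta>. cD m (sgn \<zeta>) * cB m (sgn \<zeta>) \<partial>nu) + 3 / 64 * (\<integral>\<zeta>. (cB m (sgn \<zeta>))\<^sup>2 \<partial>nu)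
      + 5 / 64 * (\<integral>\<zeta>. (cC m (sgn \<zeta>))\<^sup>2 \<partial>nu) + 6 / 64 * cA m * (\<integral>\<zeta>. cC m (sgn \<zeta>) \<partial>nu) + 5 / 64 * (cA m)\<^sup>2"
    unfolding kG using nu_int nu.prob_space by simp
  finally show ?thesis unfolding nu_cDB nu_cC nu_cB2 by (simp add: power2_eq_square)
qed

text \<open>The right-hand side of \<open>excess_symmetrized\<close> for the shift 0.2073.\<close>

definition exc :: "real \<Rightarrow> real^3 \<Rightarrow> real" where
  "exc \<tau> \<zeta> = (max 0 (\<bar>evn \<tau> \<zeta>\<bar> - (1 - (2073 / 10000)) * tt \<tau>) + max 0 (\<bar>evn \<tau> \<zeta>\<bar> - (1 + (2073 / 10000)) * tt \<tau>)) / 2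
     + tt \<tau> * (odd' \<tau> \<zeta>)\<^sup>2 / (8 * (2073 / 10000))"

lemma exc_measurable [measurable]: "(\<lambda>x. exc (f x) (g x)) \<in> borel_measurable M"
  if [measurable]: "f \<in> borel_measurable M" "g \<in> borel_measurable M"
  unfolding exc_def by measurable

lemma abs_exc: "\<bar>exc \<tau> \<zeta>\<bar> \<le> 20000"
proof -
  have "\<bar>tt \<tau> * (odd' \<tau> \<zeta>)\<^sup>2\<bar> \<le> 160 * 160" by (rule abs_mult_le1[OF abs_tt sq_le[OF abs_odd]])
  then have 1: "\<bar>tt \<tau> * (odd' \<tau> \<zeta>)\<^sup>2 / (8 * (2073 / 10000))\<bar> \<le> 16000" by (simp add: abs_divide)
  define s where "s = tt \<tau> * (odd' \<tau> \<zeta>)\<^sup>2 / (8 * (2073 / 10000))"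
  have "\<bar>max 0 (\<bar>evn \<tau> \<zeta>\<bar> - \<theta> * tt \<tau>)\<bar> \<le> 162" if "\<bar>\<theta>\<bar> \<le> 2" for \<theta>
  proof -
    have "\<bar>\<theta> * tt \<tau>\<bar> \<le> 2" by (rule abs_mult_le1'[OF that abs_tt])
    then show ?thesis using abs_evn[of \<tau> \<zeta>] by (intro abs_max0) auto
  qed
  note M = this
  have \<theta>: "\<bar>1 - 2073 / 10000\<bar> \<le> (2::real)" "\<bar>1 + 2073 / 10000\<bar> \<le> (2::real)" by simp_all
  have "\<bar>exc \<tau> \<zeta>\<bar> \<le> 162 + 16000"
    unfolding exc_def by (rule abs_add_le[OF abs_half[OF M[OF \<theta>(1)] M[OF \<theta>(2)]] 1])
  then show ?thesis by simp
qed

text \<open>The thresholds \<open>(1 - \<eta>) * t\<close> and \<open>(1 + \<eta>) * t\<close> cost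
  \<open>q / (1 - \<eta>)\<close> and \<open>q / (1 + \<eta>)\<close>, with average
  \<open>q / (1 - \<eta>^2)\<close>. The odd part is integrated exactly.\<close>

lemma kap_exc:
  "(\<integral>\<tau>. exc \<tau> \<zeta> \<partial>kap) \<le>
    ((7348 / 10000) * (cD m (sgn \<zeta>))\<^sup>2 + (868 / 10000) * (cD m (sgn \<zeta>) * cB m (sgn \<zeta>)) + (cB m (sgn \<zeta>))\<^sup>2 / (2608 / 100)) / (1 - (2073 / 10000)\<^sup>2) +
    ((cC m (sgn \<zeta>))\<^sup>2 * (4 / (7 * pi)) + cC m (sgn \<zeta>) * (cA m * (16 / (35 * pi))) + (cA m)\<^sup>2 * (32 / (105 * pi))) / (8 * (2073 / 10000))"
proof -
  define D B C A where "D = cD m (sgn \<zeta>)" and "B = cB m (sgn \<zeta>)" and "C = cC m (sgn \<zeta>)" and "A = cA m"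
  define q where "q = (7348 / 10000) * D\<^sup>2 + (868 / 10000) * (D * B) + B\<^sup>2 / (2608 / 100)"
  define M where "M \<theta> \<tau> = max 0 (\<bar>evn \<tau> \<zeta>\<bar> - \<theta> * tt \<tau>)" for \<theta> \<tau>
  have iM: "integrable kap (M \<theta>)" for \<theta>
  proof (rule integrable_kap_bounded[where K="160 + \<bar>\<theta>\<bar>"])
    show "M \<theta> \<in> borel_measurable borel" unfolding M_def by measurable
    fix \<tau>
    have "\<bar>\<theta> * tt \<tau>\<bar> \<le> \<bar>\<theta>\<bar>" by (rule abs_mult_le1'[OF order_refl abs_tt])
    then show "\<bar>M \<theta> \<tau>\<bar> \<le> 160 + \<bar>\<theta>\<bar>" using abs_evn[of \<tau> \<zeta>] unfolding M_def by (intro abs_max0) auto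
  qed
  have le: "(\<integral>\<tau>. M \<theta> \<tau> \<partial>kap) \<le> q / \<theta>" if "0 < \<theta>" for \<theta>
    using excess_even_scaled[OF that, of D B] unfolding M_def evn_def q_def D_def B_def .
  have e: "tt \<tau> * (odd' \<tau> \<zeta>)\<^sup>2 = C\<^sup>2 * (tt \<tau> * rr \<tau> ^ 4) + C * A * 2 * (tt \<tau> ^ 3 * rr \<tau> ^ 2) + A\<^sup>2 * tt \<tau> ^ 5" for \<tau>
    unfolding odd'_def C_def[symmetric] A_def[symmetric] by (simp add: eval_nat_numeral algebra_simps)
  have o: "(\<integral>\<tau>. tt \<tau> * (odd' \<tau> \<zeta>)\<^sup>2 \<partial>kap) = C\<^sup>2 * (4 / (7 * pi)) + C * A * 2 * (8 / (35 * pi)) + A\<^sup>2 * (32 / (105 * pi))"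
    unfolding e using kap_poly[of 1 4] kap_poly[of 3 2] kap_poly[of 5 0]
    by (simp add: kap_t1r4 kap_t3r2 kap_t5)
  have io: "integrable kap (\<lambda>\<tau>. tt \<tau> * (odd' \<tau> \<zeta>)\<^sup>2)"
    by (rule integrable_kap_bounded[OF _ abs_mult_le1[OF abs_tt sq_le[OF abs_odd]]]) measurable
  have "(\<integral>\<tau>. exc \<tau> \<zeta> \<partial>kap) = ((\<integral>\<tau>. M (1 - (2073 / 10000)) \<tau> \<partial>kap) + (\<integral>\<tau>. M (1 + (2073 / 10000)) \<tau> \<partial>kap)) / 2 +
      (\<integral>\<tau>. tt \<tau> * (odd' \<tau> \<zeta>)\<^sup>2 \<partial>kap) / (8 * (2073 / 10000))"
    unfolding exc_def M_def[symmetric] using iM io by simp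
  also have "\<dots> \<le> (q / (1 - (2073 / 10000)) + q / (1 + (2073 / 10000))) / 2 + (\<integral>\<tau>. tt \<tau> * (odd' \<tau> \<zeta>)\<^sup>2 \<partial>kap) / (8 * (2073 / 10000))"
    by (intro add_mono divide_right_mono le order_refl) auto
  also have "(q / (1 - (2073 / 10000)) + q / (1 + (2073 / 10000))) / 2 = q / (1 - (2073 / 10000)\<^sup>2)"
    by (simp add: power2_eq_square field_simps)
  finally show ?thesis unfolding o q_def D_def B_def C_def A_def by (simp add: field_simps)
qed

text \<open>
  The constant is \<open>1.1704 / (2 * 0.4168)\<close>; the shift \<open>0.2073\<close> is chosen such that the odd part uses up
  exactly the coefficient of \<open>cC\<^sup>2\<close> on the right-hand side.
\<close>

lemma excess_bound:
  "(\<integral>x. max 0 (\<bar>conv m (sgn x)\<bar> - \<bar>p1 x\<bar>) \<partial>mu) \<le> 1463 / 1042 * (\<integral>x. (conv m (sgn x))\<^sup>2 \<partial>mu)"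
proof -
  let ?F = "\<lambda>x. max 0 (\<bar>conv m x\<bar> - \<bar>fst x\<bar>)"
  let ?L = "\<lambda>\<tau> \<zeta>. (max 0 (\<bar>evn \<tau> \<zeta> + tt \<tau> * odd' \<tau> \<zeta>\<bar> - \<bar>tt \<tau>\<bar>) + max 0 (\<bar>evn \<tau> \<zeta> - tt \<tau> * odd' \<tau> \<zeta>\<bar> - \<bar>tt \<tau>\<bar>)) / 2"
  have bL: "\<bar>?L \<tau> \<zeta>\<bar> \<le> 320" for \<tau> \<zeta>
    using abs_evn[of \<tau> \<zeta>] abs_tt_odd[of \<tau> \<zeta>] by (intro abs_half abs_max0) auto
  have mL: "(\<lambda>(\<tau>, \<zeta>). ?L \<tau> \<zeta>) \<in> borel_measurable (kap \<Otimes>\<^sub>M nu)" by measurable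
  have mE: "(\<lambda>(\<tau>, \<zeta>). exc \<tau> \<zeta>) \<in> borel_measurable (kap \<Otimes>\<^sub>M nu)" by measurable
  have "(\<integral>x. max 0 (\<bar>conv m (sgn x)\<bar> - \<bar>p1 x\<bar>) \<partial>mu) = (\<integral>\<tau>. (\<integral>\<zeta>. (?F (Th \<tau> (sgn \<zeta>)) + ?F (Th (-\<tau>) (sgn \<zeta>))) / 2 \<partial>nu) \<partial>kap)"
  proof (rule polar[where F="?F" and K=48])
    show "?F \<in> borel_measurable borel" by measurable
    show "\<bar>?F x\<bar> \<le> 48" if "norm x \<le> 1" for x :: V using abs_conv[OF that] by (intro abs_max0) auto
  qed
  also have "\<dots> = (\<integral>\<tau>. (\<integral>\<zeta>. ?L \<tau> \<zeta> \<partial>nu) \<partial>kap)"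
    unfolding conv_evn_odd(2) unfolding conv_evn_odd(1) by (simp add: Th_eq)
  also have "\<dots> \<le> (\<integral>\<tau>. (\<integral>\<zeta>. exc \<tau> \<zeta> \<partial>nu) \<partial>kap)"
  proof (rule integral_mono_AE[OF kap_nu(2)[OF mL bL] kap_nu(2)[OF mE abs_exc]])
    show "AE \<tau> in kap. (\<integral>\<zeta>. ?L \<tau> \<zeta> \<partial>nu) \<le> (\<integral>\<zeta>. exc \<tau> \<zeta> \<partial>nu)"
      using AE_kap_nonneg
    proof eventually_elim
      fix \<tau> :: real assume "0 \<le> \<tau>"
      then have t: "0 \<le> tt \<tau>" by (rule tt_nonneg)
      show "(\<integral>\<zeta>. ?L \<tau> \<zeta> \<partial>nu) \<le> (\<integral>\<zeta>. exc \<tau> \<zeta> \<partial>nu)"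
      proof (rule integral_mono)
        show "integrable nu (?L \<tau>)" by (rule kap_nu(4)[OF mL bL]) simp
        show "integrable nu (exc \<tau>)" by (rule kap_nu(4)[OF mE abs_exc]) simp
        show "?L \<tau> \<zeta> \<le> exc \<tau> \<zeta>" for \<zeta>
          using excess_symmetrized[OF t, of "(2073 / 10000)" "evn \<tau> \<zeta>" "odd' \<tau> \<zeta>"] t unfolding exc_def by simp
      qed
    qed
  qed
  \<comment> \<open>With the latitude as inner variable, the coefficients are constants for the
    one-dimensional inequality; their relations hold only in the mean over \<open>\<zeta>\<close>
    and are used afterwards.\<close>
  also have "\<dots> = (\<integral>\<zeta>. (\<integral>\<tau>. exc \<tau> \<zeta> \<partial>kap) \<partial>nu)" by (rule kap_nu(1)[OF mE abs_exc])
  also have "\<dots> \<le> (\<integral>\<zeta>. ((7348 / 10000) * (cD m (sgn \<zeta>))\<^sup>2 + (868 / 10000) * (cD m (sgn \<zeta>) * cB m (sgn \<zeta>)) + (cB m (sgn \<zeta>))\<^sup>2 / (2608 / 100)) / (1 - (2073 / 10000)\<^sup>2) +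
    ((cC m (sgn \<zeta>))\<^sup>2 * (4 / (7 * pi)) + cC m (sgn \<zeta>) * (cA m * (16 / (35 * pi))) + (cA m)\<^sup>2 * (32 / (105 * pi))) / (8 * (2073 / 10000)) \<partial>nu)"
    by (rule integral_mono[OF kap_nu(3)[OF mE abs_exc] _ kap_exc])
       (intro Bochner_Integration.integrable_add integrable_divide integrable_mult_right integrable_mult_left nu_int nu.integrable_const)
  also have "\<dots> = ((7348 / 10000) * (\<integral>\<zeta>. (cD m (sgn \<zeta>))\<^sup>2 \<partial>nu) + (868 / 10000) * (\<integral>\<zeta>. cD m (sgn \<zeta>) * cB m (sgn \<zeta>) \<partial>nu) + (\<integral>\<zeta>. (cB m (sgn \<zeta>))\<^sup>2 \<partial>nu) / (2608 / 100)) / (1 - (2073 / 10000)\<^sup>2) +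
    ((\<integral>\<zeta>. (cC m (sgn \<zeta>))\<^sup>2 \<partial>nu) * (4 / (7 * pi)) + (\<integral>\<zeta>. cC m (sgn \<zeta>) \<partial>nu) * (cA m * (16 / (35 * pi))) + (cA m)\<^sup>2 * (32 / (105 * pi))) / (8 * (2073 / 10000))"
    using nu_int nu.prob_space by simp
  also have "\<dots> \<le> 1463 / 1042 * (\<integral>x. (conv m (sgn x))\<^sup>2 \<partial>mu)"
  proof -
    define d b c a where "d = (\<integral>\<zeta>. (cD m (sgn \<zeta>))\<^sup>2 \<partial>nu)" and "b = (\<integral>\<zeta>. (cB m (sgn \<zeta>))\<^sup>2 \<partial>nu)"
      and "c = (\<integral>\<zeta>. (cC m (sgn \<zeta>))\<^sup>2 \<partial>nu)" and "a = (cA m)\<^sup>2"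
    have nn: "0 \<le> d" "0 \<le> b" "0 \<le> c" "0 \<le> a" unfolding d_def b_def c_def a_def by simp_all
    have db: "(\<integral>\<zeta>. cD m (sgn \<zeta>) * cB m (sgn \<zeta>) \<partial>nu) = - b / 5" unfolding nu_cDB b_def nu_cB2 by simp
    have ca: "(\<integral>\<zeta>. cC m (sgn \<zeta>) \<partial>nu) * (cA m * (16 / (35 * pi))) = - a * (16 / (35 * pi))"
      unfolding nu_cC a_def by (simp add: power2_eq_square)
    \<comment> \<open>Nearly tight in both variables: about 0.76780 against 0.76783 for
      \<open>d\<close>, and 0.02193 against 0.02194 for \<open>b\<close>. The term
      \<open>- b / 5\<close> from the cross term is what brings the coefficient of \<open>b\<close>
      down.\<close>
    have 1: "((7348 / 10000) * d + (868 / 10000) * (- b / 5) + b / (2608 / 100)) / (1 - (2073 / 10000)\<^sup>2) \<le> 1463 / 1042 * (35 / 64 * d + 1 / 64 * b)"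
      using nn by (simp add: power2_eq_square field_simps)
    have 2: "(c * (4 / (7 * pi)) + - a * (16 / (35 * pi)) + a * (32 / (105 * pi))) / (8 * (2073 / 10000)) \<le> 1463 / 1042 * (5 / 64 * c - 1 / 64 * a)"
    proof -
      \<comment> \<open>Nearly tight for \<open>c\<close>. For \<open>a\<close> both coefficients
        are negative, and the left one is clearly larger in absolute value.\<close>
      have c: "4 / (7 * pi) / (8 * (2073 / 10000)) \<le> 1463 / 1042 * (5 / 64)" using pi_approx by (simp add: field_simps)
      have a: "1463 / 1042 * (1 / 64) \<le> 16 / (105 * pi) / (8 * (2073 / 10000))" using pi_approx by (simp add: field_simps)
      have "(c * (4 / (7 * pi)) + - a * (16 / (35 * pi)) + a * (32 / (105 * pi))) / (8 * (2073 / 10000)) =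
          (4 / (7 * pi) / (8 * (2073 / 10000))) * c - (16 / (105 * pi) / (8 * (2073 / 10000))) * a"
        by (simp add: field_simps)
      also have "\<dots> \<le> 1463 / 1042 * (5 / 64) * c - 1463 / 1042 * (1 / 64) * a"
        by (intro diff_mono mult_right_mono c a nn)
      finally show ?thesis by simp
    qed
    show ?thesis unfolding conv_sq_expand db ca d_def[symmetric] b_def[symmetric] c_def[symmetric] a_def[symmetric]
      by (rule order_trans[OF add_mono[OF 1 2] eq_refl]) (simp add: field_simps)
  qed
  finally show ?thesis .
qed

end

section \<open>The bilinear form on sign functions\<close>

lemma test_funI: "m \<in> borel_measurable borel \<Longrightarrow> (\<And>y. \<bar>m y\<bar> \<le> 1) \<Longrightarrow> test_fun m"
  by (simp add: test_fun_def)

lemma K3_inner_bd: "\<bar>K3 (inner (sgn x) (sgn y))\<bar> \<le> 48" for x y :: V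
  by (intro abs_K3 abs_inner_le1) (auto simp: norm_sgn)

lemma mu_integrable:
  fixes f :: "V \<Rightarrow> real"
  assumes "f \<in> borel_measurable borel" "\<And>x. \<bar>f x\<bar> \<le> K"
  shows "integrable mu f"
  by (rule mu.integrable_const_bound[where B=K]) (use assms in auto)

lemma sgnV_le: "norm (sgn x) \<le> 1" for x :: V by (simp add: norm_sgn)

context test_fun
begin

lemma conv_sq_int: "integrable mu (\<lambda>x. (conv m (sgn x))\<^sup>2)"
  by (rule mu_integrable[OF _ sq_le[OF abs_conv[OF sgnV_le]]]) measurable

lemma conv_reproduces:
  assumes w: "inner w w = 1"
  shows "(\<integral>x. K3 (inner (sgn x) w) * conv m (sgn x) \<partial>mu) = conv m w"
proof -
  have nw: "norm w \<le> 1" using w by (simp add: norm_eq_sqrt_inner)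
  let ?f = "\<lambda>x z. m z * (K3 (inner (sgn x) w) * K3 (inner (sgn x) (sgn z)))"
  have b: "\<bar>?f x z\<bar> \<le> 48 * 48" for x z
  proof (rule abs_mult_le1[OF m_le])
    have "\<bar>K3 (inner (sgn x) w)\<bar> \<le> 48" by (intro abs_K3 abs_inner_le1 nw sgnV_le)
    then show "\<bar>K3 (inner (sgn x) w) * K3 (inner (sgn x) (sgn z))\<bar> \<le> 48 * 48"
      unfolding abs_mult by (intro mult_mono K3_inner_bd) auto
  qed
  have "(\<integral>x. K3 (inner (sgn x) w) * conv m (sgn x) \<partial>mu) = (\<integral>x. (\<integral>z. ?f x z \<partial>mu) \<partial>mu)"
  proof (rule Bochner_Integration.integral_cong[OF refl])
    fix x
    have "K3 (inner (sgn x) w) * conv m (sgn x) = (\<integral>z. K3 (inner (sgn x) w) * (m z * K3 (inner (sgn x) (sgn z))) \<partial>mu)"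
      unfolding conv_def by (rule integral_mult_right_zero[symmetric])
    then show "K3 (inner (sgn x) w) * conv m (sgn x) = (\<integral>z. ?f x z \<partial>mu)" by (simp only: mult.left_commute)
  qed
  also have "\<dots> = (\<integral>z. (\<integral>x. ?f x z \<partial>mu) \<partial>mu)" by (rule mu_mu(1)[OF _ b]) measurable
  also have "\<dots> = (\<integral>z. m z * K3 (inner w (sgn z)) \<partial>mu)"
  proof (rule integral_cong_AE)
    show "AE z in mu. (\<integral>x. ?f x z \<partial>mu) = m z * K3 (inner w (sgn z))"
      using AE_inner_sgn
    proof eventually_elim
      fix z :: V assume z: "inner (sgn z) (sgn z) = 1"
      show "(\<integral>x. ?f x z \<partial>mu) = m z * K3 (inner w (sgn z))"
        unfolding integral_mult_right_zero K3_reproducing[OF w z] ..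
    qed
  qed measurable
  finally show ?thesis by (simp only: conv_def)
qed

text \<open>Symmetry and the reproducing property make \<open>conv\<close> a self-adjoint
  idempotent.\<close>

lemma pairing_eq_norm: "(\<integral>x. m x * conv m (sgn x) \<partial>mu) = (\<integral>x. (conv m (sgn x))\<^sup>2 \<partial>mu)"
proof -
  let ?f = "\<lambda>x y. m x * (K3 (inner (sgn y) (sgn x)) * conv m (sgn y))"
  have b: "\<bar>?f x y\<bar> \<le> 48 * 48" for x y
  proof (rule abs_mult_le1[OF m_le])
    show "\<bar>K3 (inner (sgn y) (sgn x)) * conv m (sgn y)\<bar> \<le> 48 * 48"
      unfolding abs_mult by (intro mult_mono K3_inner_bd abs_conv sgnV_le) auto
  qed
  have "(\<integral>x. m x * conv m (sgn x) \<partial>mu) = (\<integral>x. (\<integral>y. ?f x y \<partial>mu) \<partial>mu)"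
  proof (rule integral_cong_AE)
    show "AE x in mu. m x * conv m (sgn x) = (\<integral>y. ?f x y \<partial>mu)"
      using AE_inner_sgn
    proof eventually_elim
      fix x :: V assume x: "inner (sgn x) (sgn x) = 1"
      show "m x * conv m (sgn x) = (\<integral>y. ?f x y \<partial>mu)"
        unfolding integral_mult_right_zero conv_reproduces[OF x] ..
    qed
  qed measurable
  also have "\<dots> = (\<integral>y. (\<integral>x. ?f x y \<partial>mu) \<partial>mu)" by (rule mu_mu(1)[OF _ b]) measurable
  also have "\<dots> = (\<integral>y. (conv m (sgn y))\<^sup>2 \<partial>mu)"
  proof (rule Bochner_Integration.integral_cong[OF refl])
    fix y
    have "(\<integral>x. ?f x y \<partial>mu) = (\<integral>x. (m x * K3 (inner (sgn y) (sgn x))) * conv m (sgn y) \<partial>mu)"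
      by (simp only: mult.assoc)
    also have "\<dots> = conv m (sgn y) * conv m (sgn y)"
      unfolding integral_mult_left_zero conv_def[symmetric] ..
    finally show "(\<integral>x. ?f x y \<partial>mu) = (conv m (sgn y))\<^sup>2" by (simp only: power2_eq_square)
  qed
  finally show ?thesis .
qed

lemma m_sq_int: "integrable mu (\<lambda>x. (m x)\<^sup>2)"
  by (rule mu_integrable[OF _ sq_le[OF m_le]]) measurable

lemma m_conv_int: "integrable mu (\<lambda>x. m x * conv m (sgn x))"
  by (rule mu_integrable[OF _ abs_mult_le1[OF m_le abs_conv[OF sgnV_le]]]) measurable

lemma bessel_conv: "(\<integral>x. (conv m (sgn x))\<^sup>2 \<partial>mu) \<le> (\<integral>x. (m x)\<^sup>2 \<partial>mu)"
proof -
  have "0 \<le> (\<integral>x. (m x - conv m (sgn x))\<^sup>2 \<partial>mu)" by simp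
  also have "\<dots> = (\<integral>x. (m x)\<^sup>2 - 2 * (m x * conv m (sgn x)) + (conv m (sgn x))\<^sup>2 \<partial>mu)"
    by (intro Bochner_Integration.integral_cong refl) (simp add: power2_eq_square algebra_simps)
  also have "\<dots> = (\<integral>x. (m x)\<^sup>2 \<partial>mu) - 2 * (\<integral>x. m x * conv m (sgn x) \<partial>mu) + (\<integral>x. (conv m (sgn x))\<^sup>2 \<partial>mu)"
    unfolding Bochner_Integration.integral_add[OF Bochner_Integration.integrable_diff[OF m_sq_int integrable_mult_right[OF m_conv_int]] conv_sq_int]
      Bochner_Integration.integral_diff[OF m_sq_int integrable_mult_right[OF m_conv_int]] integral_mult_right_zero ..
  finally show ?thesis unfolding pairing_eq_norm by simp
qed

text \<open>Compares \<open>conv m\<close> with the multiple \<open>\<beta>\<close> of the zonal function \<open>K3 (inner x w)\<close>, of squared norm 16.\<close>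

lemma conv_sq_lower:
  assumes w: "inner w w = 1"
  shows "2 * \<beta> * conv m w - 16 * \<beta>\<^sup>2 \<le> (\<integral>x. (conv m (sgn x))\<^sup>2 \<partial>mu)"
proof -
  let ?k = "\<lambda>x. K3 (inner (sgn x) w)" and ?e = "\<lambda>x. conv m (sgn x)"
  have nw: "norm w \<le> 1" using w by (simp add: norm_eq_sqrt_inner)
  have bk: "\<bar>?k x\<bar> \<le> 48" for x by (intro abs_K3 abs_inner_le1 nw sgnV_le)
  have ik: "integrable mu (\<lambda>x. ?k x * ?k x)"
    by (rule mu_integrable[OF _ sq_le[OF bk, unfolded power2_eq_square]]) measurable
  have "\<bar>?k x * ?e x\<bar> \<le> 48 * 48" for x
    unfolding abs_mult by (rule mult_mono[OF bk abs_conv[OF sgnV_le]]) auto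
  then have ike: "integrable mu (\<lambda>x. ?k x * ?e x)" by (intro mu_integrable) measurable
  have "0 \<le> (\<integral>x. (?e x - \<beta> * ?k x)\<^sup>2 \<partial>mu)" by simp
  also have "\<dots> = (\<integral>x. (?e x)\<^sup>2 - 2 * \<beta> * (?k x * ?e x) + \<beta>\<^sup>2 * (?k x * ?k x) \<partial>mu)"
    by (intro Bochner_Integration.integral_cong refl) (simp add: power2_eq_square algebra_simps)
  also have "\<dots> = (\<integral>x. (?e x)\<^sup>2 \<partial>mu) - 2 * \<beta> * (\<integral>x. ?k x * ?e x \<partial>mu) + \<beta>\<^sup>2 * (\<integral>x. ?k x * ?k x \<partial>mu)"
    unfolding Bochner_Integration.integral_add[OF Bochner_Integration.integrable_diff[OF conv_sq_int integrable_mult_right[OF ike]] integrable_mult_right[OF ik]]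
      Bochner_Integration.integral_diff[OF conv_sq_int integrable_mult_right[OF ike]] integral_mult_right_zero ..
  also have "(\<integral>x. ?k x * ?k x \<partial>mu) = 16" unfolding K3_reproducing[OF w w] w by (simp add: K3_def)
  finally show ?thesis unfolding conv_reproduces[OF w] by simp
qed

definition U :: V where "U = (\<integral>x. m x *\<^sub>R sgn x \<partial>mu)"

lemma U_int: "integrable mu (\<lambda>x. m x *\<^sub>R sgn x)"
proof (rule mu.integrable_const_bound[where B=1])
  have "norm (m x *\<^sub>R sgn x) \<le> 1" for x
    unfolding norm_scaleR by (rule mult_le_one) (use m_le sgnV_le in auto)
  then show "AE x in mu. norm (m x *\<^sub>R sgn x) \<le> 1" by (intro AE_I2)
qed measurable

lemma inner_U: "(\<integral>x. m x * inner (sgn x) w \<partial>mu) = inner U w"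
proof -
  have "inner U w = (\<integral>x. inner (m x *\<^sub>R sgn x) w \<partial>mu)"
    unfolding U_def by (rule integral_inner_left[symmetric]) (rule U_int)
  then show ?thesis by (simp only: inner_scaleR_left)
qed

lemma inner_int: "integrable mu (\<lambda>x. m x * inner (sgn x) w)"
  by (rule integrable_m[where F="\<lambda>x. inner x w"]) (intro continuous_intros)

text \<open>The coordinates have second moment 1/4, so \<open>4 * inner (sgn x) U\<close> is the
  projection of \<open>m\<close> to the linear functions, and the left side is its squared
  norm.\<close>

lemma bessel_U: "4 * inner U U \<le> (\<integral>x. (m x)\<^sup>2 \<partial>mu)"
proof -
  let ?t = "\<lambda>x. inner (sgn x) U"
  have it: "integrable mu (\<lambda>x. ?t x * ?t x)"
    by (rule integrable_mu_cont[where F="\<lambda>x. inner x U * inner x U"]) (intro continuous_intros)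
  have "0 \<le> (\<integral>x. (m x - 4 * ?t x)\<^sup>2 \<partial>mu)" by simp
  also have "\<dots> = (\<integral>x. (m x)\<^sup>2 - 8 * (m x * ?t x) + 16 * (?t x * ?t x) \<partial>mu)"
    by (intro Bochner_Integration.integral_cong refl) (simp add: power2_eq_square algebra_simps)
  also have "\<dots> = (\<integral>x. (m x)\<^sup>2 \<partial>mu) - 8 * (\<integral>x. m x * ?t x \<partial>mu) + 16 * (\<integral>x. ?t x * ?t x \<partial>mu)"
    unfolding Bochner_Integration.integral_add[OF Bochner_Integration.integrable_diff[OF m_sq_int integrable_mult_right[OF inner_int]] integrable_mult_right[OF it]]
      Bochner_Integration.integral_diff[OF m_sq_int integrable_mult_right[OF inner_int]] integral_mult_right_zero ..
  finally show ?thesis unfolding inner_U integral_inner11 by simp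
qed

text \<open>\<open>conv\<close> commutes with rotations, because \<open>K3\<close> only sees inner
  products; so \<open>w\<close> may be rotated to the pole.\<close>

lemma excess_bound_dir:
  assumes w: "inner w w = 1"
  shows "(\<integral>x. max 0 (\<bar>conv m (sgn x)\<bar> - \<bar>inner (sgn x) w\<bar>) \<partial>mu) \<le> 1463 / 1042 * (\<integral>x. (conv m (sgn x))\<^sup>2 \<partial>mu)"
proof -
  have "norm w = 1" unfolding norm_eq_sqrt_inner w by simp
  moreover have "norm (1::real, 0::real^3) = 1" by (simp add: norm_prod_def)
  ultimately have "norm (1::real, 0::real^3) = norm w" by (simp only:)
  then obtain T :: "V \<Rightarrow> V" where T: "linear T" "T \<in> borel_measurable borel" "\<And>x y. inner (T x) (T y) = inner x y"
    "T (1, 0) = w" "distr lborel borel T = lborel"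
    using rotation_V[of "(1, 0)" w] by blast
  note [measurable] = T(2)
  have nT: "norm (T x) = norm x" for x by (simp only: norm_eq_sqrt_inner T(3))
  have sT: "sgn (T x) = T (sgn x)" for x by (simp only: sgn_div_norm nT linear_scale[OF T(1)])
  interpret m': test_fun "\<lambda>x. m (T x)" by (rule test_funI) (use m_le in auto)
  have c: "conv (\<lambda>x. m (T x)) (sgn x) = conv m (sgn (T x))" for x
  proof -
    have "conv m (sgn (T x)) = (\<integral>y. m (T y) * K3 (inner (sgn (T x)) (sgn (T y))) \<partial>mu)"
      unfolding conv_def
      by (rule mu_rotation[OF T(2) _ T(3,5), symmetric, where F="\<lambda>y. m y * K3 (inner (sgn (T x)) (sgn y))"]) measurable
    then show ?thesis by (simp only: conv_def sT T(3))
  qed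
  have i: "inner (sgn (T x)) w = p1 x" for x
  proof -
    have "inner (sgn (T x)) w = inner (T (sgn x)) (T (1, 0))" by (simp only: sT T(4))
    also have "\<dots> = inner (sgn x) (1, 0)" by (rule T(3))
    finally show ?thesis by (simp add: inner_prod_def)
  qed
  have 1: "(\<integral>x. max 0 (\<bar>conv m (sgn x)\<bar> - \<bar>inner (sgn x) w\<bar>) \<partial>mu) =
    (\<integral>x. max 0 (\<bar>conv (\<lambda>x. m (T x)) (sgn x)\<bar> - \<bar>p1 x\<bar>) \<partial>mu)"
    unfolding c i[symmetric]
    by (rule mu_rotation[OF T(2) _ T(3,5), symmetric, where F="\<lambda>x. max 0 (\<bar>conv m (sgn x)\<bar> - \<bar>inner (sgn x) w\<bar>)"]) measurable
  have 2: "(\<integral>x. (conv m (sgn x))\<^sup>2 \<partial>mu) = (\<integral>x. (conv (\<lambda>x. m (T x)) (sgn x))\<^sup>2 \<partial>mu)"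
    unfolding c
    by (rule mu_rotation[OF T(2) _ T(3,5), symmetric, where F="\<lambda>x. (conv m (sgn x))\<^sup>2"]) measurable
  show ?thesis unfolding 1 2 by (rule m'.excess_bound)
qed

text \<open>Apply the bound to \<open>c * m\<close> with \<open>c = 0.4168 / 1.1704 < 1\<close>. The
  factor 1463/1042 is \<open>1 / (2 * c)\<close>, which turns the right side into
  \<open>0.4168\<close> times the squared norm.\<close>

lemma excess_bound_scaled:
  assumes w: "inner w w = 1"
  shows "2 * (\<integral>x. max 0 ((4168 / 10000) * \<bar>conv m (sgn x)\<bar> - (11704 / 10000) * \<bar>inner (sgn x) w\<bar>) \<partial>mu) \<le> (4168 / 10000) * (\<integral>x. (conv m (sgn x))\<^sup>2 \<partial>mu)"
proof -
  define c :: real where "c = (4168 / 10000) / (11704 / 10000)"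
  interpret s: test_fun "\<lambda>x. c * m x"
  proof (rule test_funI)
    show "\<bar>c * m y\<bar> \<le> 1" for y by (rule abs_mult_le1[OF _ m_le]) (simp add: c_def)
  qed measurable
  have cv: "conv (\<lambda>x. c * m x) x = c * conv m x" for x
    unfolding conv_def by (simp only: mult.assoc integral_mult_right_zero)
  have e: "max 0 ((4168 / 10000) * \<bar>u\<bar> - (11704 / 10000) * \<bar>v\<bar>) = (11704 / 10000) * max 0 (\<bar>c * u\<bar> - \<bar>v\<bar>)" for u v
    by (simp add: c_def abs_mult max_def)
  have q: "(c * u)\<^sup>2 = c\<^sup>2 * u\<^sup>2" for u by (rule power_mult_distrib)
  have "2 * (\<integral>x. max 0 ((4168 / 10000) * \<bar>conv m (sgn x)\<bar> - (11704 / 10000) * \<bar>inner (sgn x) w\<bar>) \<partial>mu) =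
      2 * ((11704 / 10000) * (\<integral>x. max 0 (\<bar>conv (\<lambda>x. c * m x) (sgn x)\<bar> - \<bar>inner (sgn x) w\<bar>) \<partial>mu))"
    unfolding e integral_mult_right_zero cv ..
  also have "\<dots> \<le> 2 * ((11704 / 10000) * (1463 / 1042 * (\<integral>x. (conv (\<lambda>x. c * m x) (sgn x))\<^sup>2 \<partial>mu)))"
    by (intro mult_left_mono s.excess_bound_dir w) auto
  also have "\<dots> = (4168 / 10000) * (\<integral>x. (conv m (sgn x))\<^sup>2 \<partial>mu)"
    unfolding cv q integral_mult_right_zero by (simp add: c_def power2_eq_square)
  finally show ?thesis .
qed

end

lemma direction_moments:
  assumes w: "inner w w = 1"
  shows "(\<integral>x. \<bar>inner (sgn x) w\<bar> \<partial>mu) = 4 / (3 * pi)" "(\<integral>x. \<bar>inner (sgn x) w\<bar> ^ 3 \<partial>mu) = 8 / (15 * pi)"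
proof -
  have n: "norm w = 1" using w by (simp add: norm_eq_sqrt_inner)
  have b: "\<bar>\<bar>fst x\<bar> ^ k\<bar> \<le> 1" if "norm x \<le> 1" for x :: V and k
  proof -
    have "\<bar>fst x\<bar> \<le> 1" using norm_fst_le[of "fst x" "snd x"] that by simp
    then show ?thesis by (simp add: power_abs power_le_one)
  qed
  have "(\<integral>x. \<bar>inner (sgn x) w\<bar> ^ k \<partial>mu) = (\<integral>\<tau>. tt \<tau> ^ k \<partial>kap)" for k
  proof -
    have "(\<integral>x. \<bar>inner (sgn x) w\<bar> ^ k \<partial>mu) = (\<integral>x. \<bar>p1 x\<bar> ^ k \<partial>mu)"
      using mu_direction[of "\<lambda>s. \<bar>s\<bar> ^ k" w] unfolding n by simp
    also have "\<dots> = (\<integral>\<tau>. (\<integral>\<zeta>. (\<bar>fst (Th \<tau> (sgn \<zeta>))\<bar> ^ k + \<bar>fst (Th (-\<tau>) (sgn \<zeta>))\<bar> ^ k) / 2 \<partial>nu) \<partial>kap)"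
      by (rule polar[where F="\<lambda>x. \<bar>fst x\<bar> ^ k", OF _ b])
        (intro borel_measurable_continuous_onI continuous_intros)
    also have "\<dots> = (\<integral>\<tau>. \<bar>tt \<tau>\<bar> ^ k \<partial>kap)"
      using nu.prob_space by (simp add: Th_eq)
    also have "\<dots> = (\<integral>\<tau>. tt \<tau> ^ k \<partial>kap)"
    proof (rule integral_cong_AE)
      show "AE \<tau> in kap. \<bar>tt \<tau>\<bar> ^ k = tt \<tau> ^ k"
        using AE_kap_nonneg by eventually_elim (simp add: tt_nonneg)
    qed measurable
    finally show ?thesis .
  qed
  from this[of 1] this[of 3] show "(\<integral>x. \<bar>inner (sgn x) w\<bar> \<partial>mu) = 4 / (3 * pi)" "(\<integral>x. \<bar>inner (sgn x) w\<bar> ^ 3 \<partial>mu) = 8 / (15 * pi)"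
    by (simp_all add: kap_t1 kap_t3)
qed

text \<open>
  The weight \<open>0.4168\<close> of the degree-3 term is close to optimal. The vectors \<open>a\<^sub>x = x\<close>, \<open>b\<^sub>y = y\<close>
  only see the linear term and give the value 1.
\<close>

definition kk :: "real \<Rightarrow> real" where "kk s = 4 * s - (4168 / 10000) * K3 s"

text \<open>
  If \<open>a\<close> is small, Bessel's inequality suffices. Otherwise \<open>a\<^sup>2\<close> is linearised around \<open>a\<close> in direction
  \<open>w\<close> and the cubic term around \<open>\<beta>\<close>; the coefficient \<open>v\<close> of \<open>p\<close> is then at
  least \<open>2 * 1.1704 * \<bar>t\<bar>\<close> in absolute value, and what the coefficient of \<open>m\<close> exceeds it by is controlled by
  the excess bound.
\<close>

lemma quadratic_form_bound:
  assumes p: "test_fun p" and m: "test_fun m" and pm: "\<And>x. \<bar>p x\<bar> + \<bar>m x\<bar> = 1" "\<And>x. (p x)\<^sup>2 + (m x)\<^sup>2 = 1"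
  shows "4 * inner (test_fun.U p) (test_fun.U p) - (4168 / 10000) * (\<integral>x. (conv p (sgn x))\<^sup>2 \<partial>mu) + (4168 / 10000) * (\<integral>x. (conv m (sgn x))\<^sup>2 \<partial>mu) \<le> (67304 / 100000)"
proof -
  interpret p: test_fun p by fact
  interpret m: test_fun m by fact
  define a where "a = 2 * norm p.U"
  have a2: "a\<^sup>2 = 4 * inner p.U p.U" by (simp add: a_def power_mult_distrib power2_norm_eq_inner)
  have a0: "0 \<le> a" by (simp add: a_def)
  define Tp Tm where "Tp = (\<integral>x. (conv p (sgn x))\<^sup>2 \<partial>mu)" and "Tm = (\<integral>x. (conv m (sgn x))\<^sup>2 \<partial>mu)"
  have T0: "0 \<le> Tp" "0 \<le> Tm" by (simp_all add: Tp_def Tm_def)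
  have "a\<^sup>2 - (4168 / 10000) * Tp + (4168 / 10000) * Tm \<le> (67304 / 100000)"
  \<comment> \<open>Bessel gives at most \<open>0.4168 + 0.5832 * a^2\<close>; this reaches 0.67304
    just beyond \<open>a^2 = 0.4393\<close>.\<close>
  proof (cases "a\<^sup>2 \<le> (4393 / 10000)")
    case True
    have "(\<integral>x. (p x)\<^sup>2 \<partial>mu) + (\<integral>x. (m x)\<^sup>2 \<partial>mu) = 1"
      unfolding Bochner_Integration.integral_add[OF p.m_sq_int m.m_sq_int, symmetric] pm(2) using mu.prob_space by simp
    then have "Tm \<le> 1 - a\<^sup>2" using p.bessel_U m.bessel_conv unfolding a2 Tm_def by linarith
    then show ?thesis using True T0 by simp
  next
    case False
    \<comment> \<open>\<open>2 * 0.6 > 1.1704\<close>, so this ensures \<open>0 \<le> s\<close>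
      below; it also makes the direction of \<open>p.U\<close> well defined.\<close>
    have a1: "(6 / 10) \<le> a"
    proof (rule ccontr)
      assume "\<not> (6 / 10) \<le> a"
      then have "a\<^sup>2 \<le> (6 / 10)\<^sup>2" using a0 by (intro power_mono) auto
      then show False using False by (simp add: power2_eq_square)
    qed
    then have nU: "0 < norm p.U" unfolding a_def by linarith
    define w where "w = sgn p.U"
    have w: "inner w w = 1" using nU by (simp add: w_def power2_norm_eq_inner[symmetric] norm_sgn)
    have Uw: "inner p.U w = a / 2"
      using nU by (simp add: w_def sgn_div_norm a_def power2_norm_eq_inner[symmetric] power2_eq_square)
    define s where "s = 2 * a - (11704 / 10000)"
    have s0: "0 \<le> s" using a1 by (simp add: s_def)
    \<comment> \<open>Chosen so that the linear part of \<open>K3\<close> brings the coefficient of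
      \<open>t x\<close> in \<open>v x\<close> down from \<open>4 * a\<close> to exactly
      \<open>2 * 1.1704\<close>. The surplus reappears as the cubic term \<open>4 * s * t^3\<close>,
      of the same sign as \<open>t\<close>.\<close>
    define \<beta> where "\<beta> = - s / (16 * (4168 / 10000))"
    define t where "t x = inner (sgn x) w" for x
    have bt: "\<bar>t x\<bar> \<le> 1" for x unfolding t_def
      by (rule abs_inner_le1[OF sgnV_le]) (use w in \<open>simp add: norm_eq_sqrt_inner\<close>)
    have mt [measurable]: "t \<in> borel_measurable borel" unfolding t_def by measurable
    define v where "v x = 4 * a * t x - 2 * (4168 / 10000) * \<beta> * K3 (t x)" for x
    have v: "v x = 2 * (11704 / 10000) * t x + 4 * s * (t x) ^ 3" for x
      unfolding v_def \<beta>_def K3_def s_def by (simp add: field_simps)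
    define V where "V x = (11704 / 10000) * \<bar>t x\<bar> + 2 * s * \<bar>t x\<bar> ^ 3" for x
    have vV: "\<bar>v x\<bar> \<le> 2 * V x" for x
    proof -
      have "\<bar>v x\<bar> \<le> \<bar>2 * (11704 / 10000) * t x\<bar> + \<bar>4 * s * (t x) ^ 3\<bar>" unfolding v by (rule abs_triangle_ineq)
      also have "\<dots> = 2 * V x" using s0 by (simp add: V_def abs_mult power_abs)
      finally show ?thesis .
    qed
    let ?e = "\<lambda>x. conv m (sgn x)"
    let ?X = "\<lambda>x. max 0 ((4168 / 10000) * \<bar>?e x\<bar> - (11704 / 10000) * \<bar>t x\<bar>)"
    \<comment> \<open>\<open>\<bar>p\<bar>\<close> and \<open>\<bar>m\<bar>\<close> are convex
      weights, so a common upper bound for the two coefficients \<open>\<bar>v x\<bar>\<close> and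
      \<open>2 * 0.4168 * \<bar>?e x\<bar>\<close> bounds the sum.\<close>
    have pt: "p x * v x + 2 * (4168 / 10000) * (m x * ?e x) \<le> 2 * V x + 2 * ?X x" for x
    proof -
      have "p x * v x \<le> \<bar>p x\<bar> * \<bar>v x\<bar>" by (simp add: abs_mult[symmetric])
      also have "\<dots> \<le> \<bar>p x\<bar> * (2 * V x + 2 * ?X x)" by (intro mult_left_mono order_trans[OF vV[of x]]) simp_all
      finally have 1: "p x * v x \<le> \<bar>p x\<bar> * (2 * V x + 2 * ?X x)" .
      have "m x * ?e x \<le> \<bar>m x\<bar> * \<bar>?e x\<bar>" by (simp add: abs_mult[symmetric])
      then have "2 * (4168 / 10000) * (m x * ?e x) \<le> \<bar>m x\<bar> * (2 * ((4168 / 10000) * \<bar>?e x\<bar>))" by simp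
      also have "\<dots> \<le> \<bar>m x\<bar> * (2 * V x + 2 * ?X x)"
      proof (rule mult_left_mono)
        have "(11704 / 10000) * \<bar>t x\<bar> \<le> V x" unfolding V_def using s0 by simp
        moreover have "2 * E \<le> 2 * Z + 2 * max 0 (E - T)" if "T \<le> Z" for E T Z :: real
          using that by (simp add: max_def)
        ultimately show "2 * ((4168 / 10000) * \<bar>?e x\<bar>) \<le> 2 * V x + 2 * ?X x" by blast
      qed simp
      finally have "p x * v x + 2 * (4168 / 10000) * (m x * ?e x) \<le> (\<bar>p x\<bar> + \<bar>m x\<bar>) * (2 * V x + 2 * ?X x)"
        using 1 by (simp only: distrib_right)
      then show ?thesis unfolding pm(1) by simp
    qed
    have it: "integrable mu (\<lambda>x. \<bar>t x\<bar>)" by (rule mu_integrable[where K=1]) (use bt in auto)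
    have it3: "integrable mu (\<lambda>x. \<bar>t x\<bar> ^ 3)" by (rule mu_integrable[where K=1]) (use bt in \<open>auto simp: power_abs power_le_one\<close>)
    have iV: "integrable mu V" unfolding V_def by (intro Bochner_Integration.integrable_add integrable_mult_right it it3)
    have EV: "(\<integral>x. V x \<partial>mu) = (11704 / 10000) * (4 / (3 * pi)) + 2 * s * (8 / (15 * pi))"
      unfolding V_def Bochner_Integration.integral_add[OF integrable_mult_right[OF it] integrable_mult_right[OF it3]] integral_mult_right_zero
      unfolding t_def direction_moments[OF w] ..
    have iX: "integrable mu ?X"
    proof (rule mu_integrable[where K=48])
      show "\<bar>?X x\<bar> \<le> 48" for x using m.abs_conv[OF sgnV_le, of x] by (intro abs_max0) auto
    qed measurable
    have ipt: "integrable mu (\<lambda>x. p x * t x)" unfolding t_def by (rule p.inner_int)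
    have ipk: "integrable mu (\<lambda>x. p x * K3 (t x))"
      by (rule mu_integrable[OF _ abs_mult_le1[OF p.m_le abs_K3[OF bt]]]) measurable
    have pv: "p x * v x = 4 * a * (p x * t x) - 2 * (4168 / 10000) * \<beta> * (p x * K3 (t x))" for x
      by (simp add: v_def algebra_simps)
    have ipv: "integrable mu (\<lambda>x. p x * v x)"
      unfolding pv by (intro Bochner_Integration.integrable_diff integrable_mult_right ipt ipk)
    have Ept: "(\<integral>x. p x * t x \<partial>mu) = a / 2" unfolding t_def p.inner_U Uw ..
    have Epk: "(\<integral>x. p x * K3 (t x) \<partial>mu) = conv p w" unfolding t_def conv_def by (simp only: inner_commute)
    have Epv: "(\<integral>x. p x * v x \<partial>mu) = 2 * a\<^sup>2 - 2 * (4168 / 10000) * \<beta> * conv p w"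
      unfolding pv Bochner_Integration.integral_diff[OF integrable_mult_right[OF ipt] integrable_mult_right[OF ipk]] integral_mult_right_zero Ept Epk
      by (simp add: power2_eq_square)
    have "2 * a\<^sup>2 - 2 * (4168 / 10000) * \<beta> * conv p w + 2 * (4168 / 10000) * Tm = (\<integral>x. p x * v x + 2 * (4168 / 10000) * (m x * ?e x) \<partial>mu)"
      unfolding Bochner_Integration.integral_add[OF ipv integrable_mult_right[OF m.m_conv_int]] integral_mult_right_zero Epv
        m.pairing_eq_norm Tm_def ..
    also have "\<dots> \<le> (\<integral>x. 2 * V x + 2 * ?X x \<partial>mu)"
      by (rule integral_mono[OF _ _ pt])
         (intro Bochner_Integration.integrable_add integrable_mult_right ipv m.m_conv_int iV iX)+
    also have "\<dots> = 2 * (\<integral>x. V x \<partial>mu) + 2 * (\<integral>x. ?X x \<partial>mu)"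
      unfolding Bochner_Integration.integral_add[OF integrable_mult_right[OF iV] integrable_mult_right[OF iX]] integral_mult_right_zero ..
    \<comment> \<open>The left side carries \<open>2 * 0.4168 * Tm\<close> because \<open>m\<close>
      pairs with its projection to \<open>Tm\<close>; half of it is consumed here.\<close>
    also have "2 * (\<integral>x. ?X x \<partial>mu) \<le> (4168 / 10000) * Tm"
      unfolding t_def Tm_def by (rule m.excess_bound_scaled[OF w])
    finally have 1: "2 * a\<^sup>2 - 2 * (4168 / 10000) * \<beta> * conv p w + (4168 / 10000) * Tm \<le> 2 * (\<integral>x. V x \<partial>mu)" by simp
    have 2: "2 * \<beta> * conv p w - 16 * \<beta>\<^sup>2 \<le> Tp" unfolding Tp_def by (rule p.conv_sq_lower[OF w])
    have "a\<^sup>2 - (4168 / 10000) * Tp + (4168 / 10000) * Tm \<le> - a\<^sup>2 + 16 * (4168 / 10000) * \<beta>\<^sup>2 + 2 * (\<integral>x. V x \<partial>mu)"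
      using 1 2 by simp
    also have "\<dots> = - (s + (11704 / 10000))\<^sup>2 / 4 + s\<^sup>2 / (66688 / 10000) + 2 * (11704 / 10000) * (4 / (3 * pi)) + 4 * s * (8 / (15 * pi))"
    proof -
      have a': "a = (s + (11704 / 10000)) / 2" by (simp add: s_def)
      have "- ((s + (11704 / 10000)) / 2)\<^sup>2 + 16 * (4168 / 10000) * (- s / (16 * (4168 / 10000)))\<^sup>2 + 2 * ((11704 / 10000) * x + 2 * s * y) =
          - (s + (11704 / 10000))\<^sup>2 / 4 + s\<^sup>2 / (66688 / 10000) + 2 * (11704 / 10000) * x + 4 * s * y" for x y
        by (simp add: power2_eq_square field_simps)
      then show ?thesis unfolding EV \<beta>_def a' .
    qed
    also have "\<dots> \<le> - (s + (11704 / 10000))\<^sup>2 / 4 + s\<^sup>2 / (66688 / 10000) + 2 * (11704 / 10000) * (4244133 / 10000000) + 4 * s * (1697654 / 10000000)"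
    proof -
      have "4 / (3 * pi) \<le> (4244133 / 10000000)" "8 / (15 * pi) \<le> (1697654 / 10000000)" using pi_approx by (simp_all add: field_simps)
      then show ?thesis using s0 by (intro add_mono mult_left_mono) auto
    qed
    also have "\<dots> \<le> (67304 / 100000)"
    proof -
      \<comment> \<open>Completing the square. The vertex \<open>l / (2 * q)\<close> is about
        0.46908 and is rounded up to 0.4691; with \<open>0 \<le> s\<close> the one-sided condition
        on \<open>z\<close> is enough.\<close>
      have gen: "k + l * s - q * (s * s) \<le> k + q * (z * z)" if "0 \<le> q" "l \<le> q * (2 * z)" for k l q z :: real
      proof -
        have "0 \<le> q * ((s - z) * (s - z))" using that(1) by simp
        also have "\<dots> = q * (s * s) + q * (z * z) - q * (2 * z) * s" by (simp add: algebra_simps)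
        finally have "q * (2 * z) * s - q * (s * s) \<le> q * (z * z)" by simp
        moreover have "l * s \<le> q * (2 * z) * s" by (rule mult_right_mono[OF that(2) s0])
        ultimately show ?thesis by simp
      qed
      have "- (s + (11704 / 10000))\<^sup>2 / 4 + s\<^sup>2 / (66688 / 10000) + 2 * (11704 / 10000) * (4244133 / 10000000) + 4 * s * (1697654 / 10000000) =
        (2 * (11704 / 10000) * (4244133 / 10000000) - (11704 / 10000)\<^sup>2 / 4) + (4 * (1697654 / 10000000) - 11704 / 20000) * s -
          (1 / 4 - 10000 / 66688) * (s * s)"
        by (simp add: power2_eq_square field_simps)
      also have "\<dots> \<le> (2 * (11704 / 10000) * (4244133 / 10000000) - (11704 / 10000)\<^sup>2 / 4) + (1 / 4 - 10000 / 66688) * ((4691 / 10000) * (4691 / 10000))"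
        by (rule gen) simp_all
      also have "\<dots> \<le> 67304 / 100000" by (simp add: power2_eq_square)
      finally show ?thesis .
    qed
    finally show ?thesis .
  qed
  then show ?thesis unfolding a2 Tp_def Tm_def .
qed

text \<open>With \<open>f = p + m\<close> and \<open>g = p - m\<close> the symmetric kernel makes
  the mixed terms cancel. The contribution \<open>- 4 * inner m.U m.U\<close> is nonpositive and is
  discarded.\<close>

lemma bilinear_bound:
  fixes f g :: "V \<Rightarrow> real"
  assumes [measurable]: "f \<in> borel_measurable borel" "g \<in> borel_measurable borel"
    and f: "\<And>x. f x = 1 \<or> f x = -1" and g: "\<And>x. g x = 1 \<or> g x = -1"
  shows "(\<integral>x. (\<integral>y. f x * g y * kk (inner (sgn x) (sgn y)) \<partial>mu) \<partial>mu) \<le> (67304 / 100000)"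
proof -
  define p m where "p x = (f x + g x) / 2" and "m x = (f x - g x) / 2" for x
  have fg: "f = (\<lambda>x. p x + m x)" "g = (\<lambda>x. p x - m x)" by (auto simp: p_def m_def field_simps)
  have pm: "\<bar>p x\<bar> + \<bar>m x\<bar> = 1" "(p x)\<^sup>2 + (m x)\<^sup>2 = 1" "\<bar>p x\<bar> \<le> 1" "\<bar>m x\<bar> \<le> 1" for x
    using f[of x] g[of x] by (auto simp: p_def m_def)
  have [measurable]: "p \<in> borel_measurable borel" "m \<in> borel_measurable borel" unfolding p_def m_def by measurable
  interpret p: test_fun p by (rule test_funI) (use pm in auto)
  interpret m: test_fun m by (rule test_funI) (use pm in auto)
  interpret f: test_fun f by (rule test_funI) (use f in \<open>auto, metis abs_minus_cancel abs_one order_refl\<close>)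
  interpret g: test_fun g by (rule test_funI) (use g in \<open>auto, metis abs_minus_cancel abs_one order_refl\<close>)
  have gi: "(\<integral>y. f x * g y * kk (inner (sgn x) (sgn y)) \<partial>mu) = 4 * (f x * inner (sgn x) g.U) - (4168 / 10000) * (f x * conv g (sgn x))" for x
  proof -
    have i1: "integrable mu (\<lambda>y. g y * inner (sgn y) (sgn x))" by (rule g.inner_int)
    have i2: "integrable mu (\<lambda>y. g y * K3 (inner (sgn x) (sgn y)))"
      by (rule mu_integrable[OF _ abs_mult_le1[OF g.m_le K3_inner_bd]]) measurable
    have "(\<integral>y. f x * g y * kk (inner (sgn x) (sgn y)) \<partial>mu) =
      (\<integral>y. 4 * f x * (g y * inner (sgn y) (sgn x)) - (4168 / 10000) * f x * (g y * K3 (inner (sgn x) (sgn y))) \<partial>mu)"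
      unfolding inner_commute[of "sgn x"] by (intro Bochner_Integration.integral_cong refl) (simp add: kk_def algebra_simps)
    also have "\<dots> = 4 * f x * (\<integral>y. g y * inner (sgn y) (sgn x) \<partial>mu) - (4168 / 10000) * f x * conv g (sgn x)"
      unfolding Bochner_Integration.integral_diff[OF integrable_mult_right[OF i1] integrable_mult_right[OF i2]] integral_mult_right_zero conv_def ..
    finally show ?thesis unfolding g.inner_U by (simp add: inner_commute)
  qed
  have S: "integrable mu (\<lambda>x. h x * conv k (sgn x))" if "test_fun h" "test_fun k" for h k
  proof -
    interpret h: test_fun h by fact
    interpret k: test_fun k by fact
    show ?thesis by (rule mu_integrable[OF _ abs_mult_le1[OF h.m_le k.abs_conv[OF sgnV_le]]]) measurable
  qed
  have e: "4 * (a - b) - c * (x - y) = 4 * a - c * x + c * y - 4 * b" for a b c x y :: real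
    by (simp add: algebra_simps)
  note tf = p.test_fun_axioms m.test_fun_axioms f.test_fun_axioms g.test_fun_axioms
  have "(\<integral>x. (\<integral>y. f x * g y * kk (inner (sgn x) (sgn y)) \<partial>mu) \<partial>mu) = 4 * inner f.U g.U - (4168 / 10000) * (\<integral>x. f x * conv g (sgn x) \<partial>mu)"
    unfolding gi Bochner_Integration.integral_diff[OF integrable_mult_right[OF f.inner_int] integrable_mult_right[OF S[OF tf(3,4)]]] integral_mult_right_zero f.inner_U ..
  also have "inner f.U g.U = inner p.U p.U - inner m.U m.U"
  proof -
    have "f.U = p.U + m.U" unfolding f.U_def p.U_def m.U_def
      by (subst Bochner_Integration.integral_add[OF p.U_int m.U_int, symmetric]) (simp only: fg(1) scaleR_add_left)
    moreover have "g.U = p.U - m.U" unfolding g.U_def p.U_def m.U_def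
      by (subst Bochner_Integration.integral_diff[OF p.U_int m.U_int, symmetric]) (simp only: fg(2) scaleR_diff_left)
    ultimately show ?thesis by (simp add: inner_add_left inner_diff_right inner_commute[of m.U p.U])
  qed
  also have "(\<integral>x. f x * conv g (sgn x) \<partial>mu) = (\<integral>x. p x * conv p (sgn x) \<partial>mu) - (\<integral>x. m x * conv m (sgn x) \<partial>mu)"
  proof -
    have cg: "conv g (sgn x) = conv p (sgn x) - conv m (sgn x)" for x
    proof -
      have i: "integrable mu (\<lambda>y. h y * K3 (inner (sgn x) (sgn y)))" if "test_fun h" for h
        by (rule mu_integrable[OF _ abs_mult_le1[OF test_fun.m_le[OF that] K3_inner_bd]])
          (use test_fun.m_meas[OF that] in measurable)
      show ?thesis unfolding conv_def Bochner_Integration.integral_diff[OF i[OF tf(1)] i[OF tf(2)], symmetric] fg(2)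
        by (simp only: left_diff_distrib)
    qed
    have sym: "(\<integral>x. m x * conv p (sgn x) \<partial>mu) = (\<integral>x. p x * conv m (sgn x) \<partial>mu)"
    proof -
      let ?f = "\<lambda>x y. m x * (p y * K3 (inner (sgn x) (sgn y)))"
      have b: "\<bar>?f x y\<bar> \<le> 48" for x y
        by (intro abs_mult_le1 p.m_le m.m_le K3_inner_bd)
      have "(\<integral>x. m x * conv p (sgn x) \<partial>mu) = (\<integral>x. (\<integral>y. ?f x y \<partial>mu) \<partial>mu)"
        unfolding conv_def integral_mult_right_zero ..
      also have "\<dots> = (\<integral>y. (\<integral>x. ?f x y \<partial>mu) \<partial>mu)" by (rule mu_mu(1)[OF _ b]) measurable
      also have "\<dots> = (\<integral>y. (\<integral>x. p y * (m x * K3 (inner (sgn y) (sgn x))) \<partial>mu) \<partial>mu)"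
      proof -
        have "?f x y = p y * (m x * K3 (inner (sgn y) (sgn x)))" for x y
          unfolding inner_commute[of "sgn x"] by (rule mult.left_commute)
        then show ?thesis by (simp only:)
      qed
      finally show ?thesis unfolding conv_def integral_mult_right_zero .
    qed
    have "(\<integral>x. f x * conv g (sgn x) \<partial>mu) = (\<integral>x. (p x * conv p (sgn x) - p x * conv m (sgn x)) + (m x * conv p (sgn x) - m x * conv m (sgn x)) \<partial>mu)"
      unfolding cg fg(1) by (intro Bochner_Integration.integral_cong refl) (simp add: algebra_simps)
    also have "\<dots> = ((\<integral>x. p x * conv p (sgn x) \<partial>mu) - (\<integral>x. p x * conv m (sgn x) \<partial>mu)) + ((\<integral>x. m x * conv p (sgn x) \<partial>mu) - (\<integral>x. m x * conv m (sgn x) \<partial>mu))"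
      unfolding Bochner_Integration.integral_add[OF Bochner_Integration.integrable_diff[OF S[OF tf(1,1)] S[OF tf(1,2)]] Bochner_Integration.integrable_diff[OF S[OF tf(2,1)] S[OF tf(2,2)]]]
        Bochner_Integration.integral_diff[OF S[OF tf(1,1)] S[OF tf(1,2)]] Bochner_Integration.integral_diff[OF S[OF tf(2,1)] S[OF tf(2,2)]] ..
    finally show ?thesis unfolding sym by simp
  qed
  finally have "(\<integral>x. (\<integral>y. f x * g y * kk (inner (sgn x) (sgn y)) \<partial>mu) \<partial>mu) =
    4 * inner p.U p.U - (4168 / 10000) * (\<integral>x. (conv p (sgn x))\<^sup>2 \<partial>mu) + (4168 / 10000) * (\<integral>x. (conv m (sgn x))\<^sup>2 \<partial>mu) - 4 * inner m.U m.U"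
    unfolding p.pairing_eq_norm m.pairing_eq_norm by (simp only: e)
  also have "\<dots> \<le> (67304 / 100000)"
    using quadratic_form_bound[OF tf(1,2) pm(1,2)] inner_ge_zero[of m.U] by linarith
  finally show ?thesis .
qed

section \<open>Discretisation\<close>

lemma unit_sphere_coords:
  assumes "v \<in> unit_sphere d"
  shows "dim_vec v = d" and "(\<Sum>i<d. (vec_index v i)\<^sup>2) = 1" and "i < d \<Longrightarrow> \<bar>vec_index v i\<bar> \<le> 1"
proof -
  show d: "dim_vec v = d" using assms by (simp add: unit_sphere_def)
  show s: "(\<Sum>i<d. (vec_index v i)\<^sup>2) = 1"
    using assms d by (simp add: unit_sphere_def scalar_prod_def power2_eq_square atLeast0LessThan)
  assume "i < d"
  then have "(vec_index v i)\<^sup>2 \<le> (\<Sum>i<d. (vec_index v i)\<^sup>2)" by (intro member_le_sum) auto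
  then show "\<bar>vec_index v i\<bar> \<le> 1" unfolding s by (simp add: abs_square_le_1)
qed

lemma scalar_prod_unit_sphere:
  assumes "v \<in> unit_sphere d" "w \<in> unit_sphere d"
  shows "scalar_prod v w = (\<Sum>k<d. vec_index v k * vec_index w k)" and "\<bar>scalar_prod v w\<bar> \<le> real d"
proof -
  show e: "scalar_prod v w = (\<Sum>k<d. vec_index v k * vec_index w k)"
    using unit_sphere_coords(1)[OF assms(2)] by (simp add: scalar_prod_def atLeast0LessThan)
  have "\<bar>\<Sum>k<d. vec_index v k * vec_index w k\<bar> \<le> (\<Sum>k<d. \<bar>vec_index v k * vec_index w k\<bar>)" by (rule sum_abs)
  also have "\<dots> \<le> (\<Sum>k<d. 1)"
    by (intro sum_mono abs_mult_le1) (use unit_sphere_coords(3) assms in auto)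
  finally show "\<bar>scalar_prod v w\<bar> \<le> real d" unfolding e by simp
qed

text \<open>Needed before anything can be said about \<open>Sup\<close> in
  \<open>real\<close>.\<close>

lemma SDP_bdd:
  "bdd_above {(\<Sum>x<dim_row M. \<Sum>y<dim_col M. M $$ (x, y) * scalar_prod (a x) (b y)) | a b.
     (\<forall>x<dim_row M. a x \<in> unit_sphere d) \<and> (\<forall>y<dim_col M. b y \<in> unit_sphere d)}"
proof (rule bdd_aboveI)
  fix z assume "z \<in> {(\<Sum>x<dim_row M. \<Sum>y<dim_col M. M $$ (x, y) * scalar_prod (a x) (b y)) | a b.
     (\<forall>x<dim_row M. a x \<in> unit_sphere d) \<and> (\<forall>y<dim_col M. b y \<in> unit_sphere d)}"
  then obtain a b where z: "z = (\<Sum>x<dim_row M. \<Sum>y<dim_col M. M $$ (x, y) * scalar_prod (a x) (b y))"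
    and ab: "\<And>x. x < dim_row M \<Longrightarrow> a x \<in> unit_sphere d" "\<And>y. y < dim_col M \<Longrightarrow> b y \<in> unit_sphere d" by blast
  show "z \<le> (\<Sum>x<dim_row M. \<Sum>y<dim_col M. \<bar>M $$ (x, y)\<bar> * real d)"
    unfolding z
  proof (intro sum_mono)
    fix x y assume "x \<in> {..<dim_row M}" "y \<in> {..<dim_col M}"
    then have "\<bar>scalar_prod (a x) (b y)\<bar> \<le> real d" using ab by (intro scalar_prod_unit_sphere) auto
    then have "\<bar>M $$ (x, y)\<bar> * \<bar>scalar_prod (a x) (b y)\<bar> \<le> \<bar>M $$ (x, y)\<bar> * real d" by (rule mult_left_mono) simp
    then show "M $$ (x, y) * scalar_prod (a x) (b y) \<le> \<bar>M $$ (x, y)\<bar> * real d" by (simp add: abs_mult[symmetric])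
  qed
qed

lemma SDP_upper:
  assumes "\<And>x. x < dim_row M \<Longrightarrow> a x \<in> unit_sphere d" "\<And>y. y < dim_col M \<Longrightarrow> b y \<in> unit_sphere d"
  shows "(\<Sum>x<dim_row M. \<Sum>y<dim_col M. M $$ (x, y) * scalar_prod (a x) (b y)) \<le> SDP d M"
  unfolding SDP_def by (rule cSup_upper[OF _ SDP_bdd]) (use assms in blast)

lemma unit_sphere_nonempty: "0 < d \<Longrightarrow> unit_vec d 0 \<in> unit_sphere d"
  by (simp add: unit_sphere_def)

lemma SDP_least:
  assumes "0 < d"
    and "\<And>a b. (\<And>x. x < dim_row M \<Longrightarrow> a x \<in> unit_sphere d) \<Longrightarrow> (\<And>y. y < dim_col M \<Longrightarrow> b y \<in> unit_sphere d) \<Longrightarrow>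
      (\<Sum>x<dim_row M. \<Sum>y<dim_col M. M $$ (x, y) * scalar_prod (a x) (b y)) \<le> K"
  shows "SDP d M \<le> K"
  unfolding SDP_def
proof (rule cSup_least)
  have "\<exists>a b. (\<forall>x<dim_row M. a x \<in> unit_sphere d) \<and> (\<forall>y<dim_col M. b y \<in> unit_sphere d)"
    using unit_sphere_nonempty[OF assms(1)] by (intro exI[of _ "\<lambda>_. unit_vec d 0"]) simp
  then show "{(\<Sum>x<dim_row M. \<Sum>y<dim_col M. M $$ (x, y) * scalar_prod (a x) (b y)) | a b.
     (\<forall>x<dim_row M. a x \<in> unit_sphere d) \<and> (\<forall>y<dim_col M. b y \<in> unit_sphere d)} \<noteq> {}" by blast
next
  fix z assume "z \<in> {(\<Sum>x<dim_row M. \<Sum>y<dim_col M. M $$ (x, y) * scalar_prod (a x) (b y)) | a b.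
     (\<forall>x<dim_row M. a x \<in> unit_sphere d) \<and> (\<forall>y<dim_col M. b y \<in> unit_sphere d)}"
  then obtain a b where z: "z = (\<Sum>x<dim_row M. \<Sum>y<dim_col M. M $$ (x, y) * scalar_prod (a x) (b y))"
    and ab: "\<And>x. x < dim_row M \<Longrightarrow> a x \<in> unit_sphere d" "\<And>y. y < dim_col M \<Longrightarrow> b y \<in> unit_sphere d" by blast
  show "z \<le> K" unfolding z by (rule assms(2)[OF ab])
qed

lemma signs_le_SDP_1:
  assumes "\<And>x. s x = 1 \<or> s x = -1" "\<And>y. t y = 1 \<or> t y = -1"
  shows "(\<Sum>x<dim_row M. \<Sum>y<dim_col M. M $$ (x, y) * (s x * t y)) \<le> SDP 1 M"
proof -
  have m: "Matrix.vec 1 (\<lambda>_. z) \<in> unit_sphere 1" if "z = 1 \<or> z = -1" for z :: real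
    using that by (auto simp: unit_sphere_def scalar_prod_def)
  have "scalar_prod (Matrix.vec 1 (\<lambda>_. s x)) (Matrix.vec 1 (\<lambda>_. t y)) = s x * t y" for x y
    by (simp add: scalar_prod_def)
  then show ?thesis
    using SDP_upper[of M "\<lambda>x. Matrix.vec 1 (\<lambda>_. s x)" 1 "\<lambda>y. Matrix.vec 1 (\<lambda>_. t y)"] m assms by simp
qed

lemma sgn_pm: "\<exists>\<sigma>. (\<forall>x. \<sigma> x = 1 \<or> \<sigma> x = -1) \<and> (\<forall>x. \<sigma> x * z x = \<bar>z x\<bar>)" for z :: "'a \<Rightarrow> real"
  by (rule exI[of _ "\<lambda>x. if 0 \<le> z x then 1 else -1"]) auto

lemma mult_le_abs: "\<bar>c\<bar> \<le> 1 \<Longrightarrow> c * z \<le> \<bar>z\<bar>" for c z :: real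
  using abs_mult_le1[of c z "\<bar>z\<bar>"] by simp

text \<open>The form is linear in each argument, so replacing first \<open>\<alpha>\<close> by the
  signs of its coefficients, and then \<open>\<beta>\<close> by the signs of the new ones, can only
  increase it.\<close>

lemma box_le_SDP_1:
  assumes \<alpha>: "\<And>x. x < dim_row M \<Longrightarrow> \<bar>\<alpha> x\<bar> \<le> 1" and \<beta>: "\<And>y. y < dim_col M \<Longrightarrow> \<bar>\<beta> y\<bar> \<le> 1"
  shows "(\<Sum>x<dim_row M. \<Sum>y<dim_col M. M $$ (x, y) * (\<alpha> x * \<beta> y)) \<le> SDP 1 M"
proof -
  obtain s where s: "\<And>x. s x = 1 \<or> s x = -1" "\<And>x. s x * (\<Sum>y<dim_col M. M $$ (x, y) * \<beta> y) = \<bar>\<Sum>y<dim_col M. M $$ (x, y) * \<beta> y\<bar>"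
    using sgn_pm[of "\<lambda>x. \<Sum>y<dim_col M. M $$ (x, y) * \<beta> y"] by blast
  obtain t where t: "\<And>y. t y = 1 \<or> t y = -1" "\<And>y. t y * (\<Sum>x<dim_row M. M $$ (x, y) * s x) = \<bar>\<Sum>x<dim_row M. M $$ (x, y) * s x\<bar>"
    using sgn_pm[of "\<lambda>y. \<Sum>x<dim_row M. M $$ (x, y) * s x"] by blast
  have "(\<Sum>x<dim_row M. \<Sum>y<dim_col M. M $$ (x, y) * (\<alpha> x * \<beta> y)) = (\<Sum>x<dim_row M. \<alpha> x * (\<Sum>y<dim_col M. M $$ (x, y) * \<beta> y))"
    by (simp add: sum_distrib_left mult_ac)
  also have "\<dots> \<le> (\<Sum>x<dim_row M. s x * (\<Sum>y<dim_col M. M $$ (x, y) * \<beta> y))"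
    unfolding s(2) by (intro sum_mono mult_le_abs \<alpha>) auto
  also have "\<dots> = (\<Sum>x<dim_row M. \<Sum>y<dim_col M. \<beta> y * (M $$ (x, y) * s x))"
    by (simp add: sum_distrib_left mult_ac)
  also have "\<dots> = (\<Sum>y<dim_col M. \<beta> y * (\<Sum>x<dim_row M. M $$ (x, y) * s x))"
    by (subst sum.swap) (simp add: sum_distrib_left)
  also have "\<dots> \<le> (\<Sum>y<dim_col M. t y * (\<Sum>x<dim_row M. M $$ (x, y) * s x))"
    unfolding t(2) by (intro sum_mono mult_le_abs \<beta>) auto
  also have "\<dots> = (\<Sum>y<dim_col M. \<Sum>x<dim_row M. M $$ (x, y) * (s x * t y))"
    by (simp add: sum_distrib_left mult_ac)
  also have "\<dots> = (\<Sum>x<dim_row M. \<Sum>y<dim_col M. M $$ (x, y) * (s x * t y))" by (rule sum.swap)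
  also have "\<dots> \<le> SDP 1 M" by (rule signs_le_SDP_1[OF s(1) t(1)])
  finally show ?thesis .
qed

lemma SDP_1_nonneg: "0 \<le> SDP 1 M"
  using box_le_SDP_1[of M "\<lambda>_. 0" "\<lambda>_. 0"] by simp

text \<open>Each coordinate of the unit vectors gives an instance of \<open>box_le_SDP_1\<close>.
  The factor \<open>d\<close> is far from sharp, but it bounds the set of ratios and later shows
  that \<open>SDP 1 M\<close> is positive.\<close>

lemma SDP_le_SDP_1:
  assumes "0 < d"
  shows "SDP d M \<le> real d * SDP 1 M"
proof (rule SDP_least[OF assms])
  fix a b assume a: "\<And>x. x < dim_row M \<Longrightarrow> a x \<in> unit_sphere d" and b: "\<And>y. y < dim_col M \<Longrightarrow> b y \<in> unit_sphere d"
  have "(\<Sum>x<dim_row M. \<Sum>y<dim_col M. M $$ (x, y) * scalar_prod (a x) (b y)) =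
    (\<Sum>x<dim_row M. \<Sum>y<dim_col M. \<Sum>k<d. M $$ (x, y) * (vec_index (a x) k * vec_index (b y) k))"
  proof (intro sum.cong refl)
    fix x y assume "x \<in> {..<dim_row M}" "y \<in> {..<dim_col M}"
    then have "a x \<in> unit_sphere d" "b y \<in> unit_sphere d" using a b by simp_all
    then show "M $$ (x, y) * scalar_prod (a x) (b y) = (\<Sum>k<d. M $$ (x, y) * (vec_index (a x) k * vec_index (b y) k))"
      by (simp only: scalar_prod_unit_sphere(1) sum_distrib_left)
  qed
  also have "\<dots> = (\<Sum>x<dim_row M. \<Sum>k<d. \<Sum>y<dim_col M. M $$ (x, y) * (vec_index (a x) k * vec_index (b y) k))"
    by (intro sum.cong refl sum.swap)
  also have "\<dots> = (\<Sum>k<d. \<Sum>x<dim_row M. \<Sum>y<dim_col M. M $$ (x, y) * (vec_index (a x) k * vec_index (b y) k))"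
    by (rule sum.swap)
  also have "\<dots> \<le> (\<Sum>k<d. SDP 1 M)"
  proof (intro sum_mono box_le_SDP_1)
    fix k x assume k: "k \<in> {..<d}" and x: "x < dim_row M"
    show "\<bar>vec_index (a x) k\<bar> \<le> 1" by (rule unit_sphere_coords(3)[OF a[OF x]]) (use k in simp)
  next
    fix k y assume k: "k \<in> {..<d}" and y: "y < dim_col M"
    show "\<bar>vec_index (b y) k\<bar> \<le> 1" by (rule unit_sphere_coords(3)[OF b[OF y]]) (use k in simp)
  qed
  finally show "(\<Sum>x<dim_row M. \<Sum>y<dim_col M. M $$ (x, y) * scalar_prod (a x) (b y)) \<le> real d * SDP 1 M" by simp
qed

lemma ratio_le_grothendieck_constant:
  assumes "0 < d" "M \<noteq> 0\<^sub>m (dim_row M) (dim_col M)"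
  shows "SDP d M / SDP 1 M \<le> K\<^sub>G d"
  unfolding grothendieck_constant_def
proof (rule cSup_upper)
  show "SDP d M / SDP 1 M \<in> {SDP d M / SDP 1 M |M. M \<noteq> 0\<^sub>m (dim_row M) (dim_col M)}" using assms(2) by blast
  show "bdd_above {SDP d M / SDP 1 M |M. M \<noteq> 0\<^sub>m (dim_row M) (dim_col M)}"
  proof (rule bdd_aboveI)
    fix z assume "z \<in> {SDP d M / SDP 1 M |M. M \<noteq> 0\<^sub>m (dim_row M) (dim_col M)}"
    then obtain M where z: "z = SDP d M / SDP 1 M" by blast
    show "z \<le> real d"
    \<comment> \<open>A vanishing denominator makes the quotient 0, which obeys the bound.\<close>
    proof (cases "SDP 1 M = 0")
      case False
      then have "0 < SDP 1 M" using SDP_1_nonneg[of M] by simp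
      then show ?thesis unfolding z using SDP_le_SDP_1[OF assms(1), of M] by (simp add: pos_divide_le_eq)
    qed (simp add: z)
  qed
qed

section \<open>The kernel on the sphere and its cell matrix\<close>

definition v4 :: "V \<Rightarrow> real Matrix.vec" where
  "v4 x = Matrix.vec 4 (\<lambda>i. if i = 0 then fst x else if i = 1 then vec_nth (snd x) 1 else if i = 2 then vec_nth (snd x) 2 else vec_nth (snd x) 3)"

lemma scalar_prod_v4: "scalar_prod (v4 x) (v4 y) = inner x y"
proof -
  have s: "(\<Sum>i\<in>{0..<4}. f i) = f 0 + f 1 + f 2 + f 3" for f :: "nat \<Rightarrow> real"
    by (simp add: eval_nat_numeral)
  have d: "dim_vec (v4 y) = 4" by (simp add: v4_def)
  show ?thesis unfolding scalar_prod_def d s by (simp add: v4_def inner_prod_def inner_vec_def sum_3)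
qed

lemma v4_unit_sphere: "norm x = 1 \<Longrightarrow> v4 x \<in> unit_sphere 4"
  unfolding unit_sphere_def mem_Collect_eq scalar_prod_v4 by (simp add: norm_eq_sqrt_inner v4_def)

abbreviation kxy :: "V \<Rightarrow> V \<Rightarrow> real" where "kxy x y \<equiv> kk (inner (sgn x) (sgn y))"

lemma kk_measurable [measurable]: "kk \<in> borel_measurable borel" unfolding kk_def[abs_def] by measurable

text \<open>\<open>4 + 0.4168 * 48 < 25\<close>; this constant governs the discretisation
  error.\<close>

lemma abs_kxy: "\<bar>kxy x y\<bar> \<le> 25"
proof -
  have "\<bar>inner (sgn x) (sgn y)\<bar> \<le> 1" by (rule abs_inner_le1[OF sgnV_le sgnV_le])
  then show ?thesis using K3_inner_bd[of x y] unfolding kk_def by (simp add: abs_le_iff)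
qed

text \<open>\<open>K3\<close> is orthogonal to linear functions, so only \<open>4 * s^2\<close>
  contributes, with \<open>s^2\<close> of mean 1/4.\<close>

lemma sphere_value: "(\<integral>x. (\<integral>y. inner (sgn x) (sgn y) * kxy x y \<partial>mu) \<partial>mu) = 1"
proof -
  have "(\<integral>x. (\<integral>y. inner (sgn x) (sgn y) * kxy x y \<partial>mu) \<partial>mu) = (\<integral>x. 1 \<partial>mu)"
  proof (rule integral_cong_AE)
    show "AE x in mu. (\<integral>y. inner (sgn x) (sgn y) * kxy x y \<partial>mu) = 1"
      using AE_inner_sgn
    proof eventually_elim
      fix x :: V assume x: "inner (sgn x) (sgn x) = 1"
      let ?t = "\<lambda>y. inner (sgn y) (sgn x)"
      have i1: "integrable mu (\<lambda>y. ?t y * ?t y)"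
        by (rule integrable_mu_cont[where F="\<lambda>y. inner y (sgn x) * inner y (sgn x)"]) (intro continuous_intros)
      have i3: "integrable mu (\<lambda>y. ?t y ^ 3 * ?t y)"
        by (rule integrable_mu_cont[where F="\<lambda>y. inner y (sgn x) ^ 3 * inner y (sgn x)"]) (intro continuous_intros)
      have "(\<integral>y. inner (sgn x) (sgn y) * kxy x y \<partial>mu) =
        (\<integral>y. (4 + 16 * (4168 / 10000)) * (?t y * ?t y) - 32 * (4168 / 10000) * (?t y ^ 3 * ?t y) \<partial>mu)"
        unfolding inner_commute[of "sgn x"]
        by (intro Bochner_Integration.integral_cong refl) (simp add: kk_def K3_def field_simps)
      also have "\<dots> = (4 + 16 * (4168 / 10000)) * (\<integral>y. ?t y * ?t y \<partial>mu) - 32 * (4168 / 10000) * (\<integral>y. ?t y ^ 3 * ?t y \<partial>mu)"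
        unfolding Bochner_Integration.integral_diff[OF integrable_mult_right[OF i1] integrable_mult_right[OF i3]] integral_mult_right_zero ..
      also have "\<dots> = 1" unfolding integral_inner11 integral_inner31 x by simp
      finally show "(\<integral>y. inner (sgn x) (sgn y) * kxy x y \<partial>mu) = 1" .
    qed
  qed measurable
  then show ?thesis using mu.prob_space by simp
qed

text \<open>By compactness finitely many balls cover the sphere; a point belongs to the first ball
  that contains it, which makes the cells measurable and disjoint.\<close>

lemma sphere_cells:
  assumes "0 < \<epsilon>"
  obtains c :: "nat \<Rightarrow> V" and n and cell :: "V \<Rightarrow> nat"
  where "\<And>i. i < n \<Longrightarrow> norm (c i) = 1" "\<And>x. cell x < n" "cell \<in> borel \<rightarrow>\<^sub>M count_space UNIV"
    "\<And>x. x \<noteq> 0 \<Longrightarrow> norm (sgn x - c (cell x)) \<le> \<epsilon>"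
proof -
  have "sphere (0::V) 1 \<subseteq> (\<Union>c\<in>sphere 0 1. ball c \<epsilon>)" using assms by (intro subsetI UN_I) auto
  then obtain C where C: "C \<subseteq> sphere (0::V) 1" "finite C" "sphere 0 1 \<subseteq> (\<Union>c\<in>C. ball c \<epsilon>)"
    by (rule compactE_image[OF compact_sphere, rotated]) simp_all
  obtain cs where cs: "set cs = C" using finite_list[OF C(2)] by blast
  define c n where "c i = cs ! i" and "n = length cs" for i
  have cn: "norm (c i) = 1" if "i < n" for i
  proof -
    have "c i \<in> C" using that by (simp add: c_def n_def cs[symmetric])
    then show ?thesis using C(1) by auto
  qed
  define L where "L x = (LEAST i. norm (sgn x - c i) < \<epsilon>)" for x
  have Lm: "L \<in> borel \<rightarrow>\<^sub>M count_space UNIV"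
    unfolding L_def[abs_def] by (rule measurable_Least) measurable
  have L: "L x < n \<and> norm (sgn x - c (L x)) < \<epsilon>" if "x \<noteq> 0" for x
  proof -
    have "sgn x \<in> sphere 0 1" using that by (simp add: norm_sgn)
    then obtain d where d: "d \<in> C" "sgn x \<in> ball d \<epsilon>" using C(3) by blast
    then obtain i where i: "i < n" "d = c i" by (metis cs in_set_conv_nth c_def n_def)
    then have P: "norm (sgn x - c i) < \<epsilon>" using d(2) by (simp add: dist_norm norm_minus_commute)
    have "L x \<le> i" unfolding L_def by (rule Least_le[of "\<lambda>i. norm (sgn x - c i) < \<epsilon>", OF P])
    moreover have "norm (sgn x - c (L x)) < \<epsilon>" unfolding L_def by (rule LeastI[of "\<lambda>i. norm (sgn x - c i) < \<epsilon>", OF P])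
    ultimately show ?thesis using i(1) by simp
  qed
  have "(1, 0) \<noteq> (0::V)" by (simp add: zero_prod_def)
  from L[OF this] have n0: "0 < n" by simp
  show thesis
  \<comment> \<open>At \<open>x = 0\<close> the least index is not controlled, so indices outside
    the list are sent to 0; that cell exists because \<open>n\<close> is positive.\<close>
  proof (rule that[of n c "\<lambda>x. if L x < n then L x else 0"])
    show "(\<lambda>x. if L x < n then L x else 0) \<in> borel \<rightarrow>\<^sub>M count_space UNIV"
      by (rule measurable_compose[OF Lm, where g="\<lambda>k. if k < n then k else 0"]) simp
    show "norm (sgn x - c (if L x < n then L x else 0)) \<le> \<epsilon>" if "x \<noteq> 0" for x
      using L[OF that] by simp
  qed (use cn n0 in auto)
qed

text \<open>The kernel integrated over pairs of cells: sign vectors then correspond to sign functions constant on cells.\<close>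

definition cell_mat :: "nat \<Rightarrow> (V \<Rightarrow> nat) \<Rightarrow> real Matrix.mat" where
  "cell_mat n cell = Matrix.mat n n (\<lambda>(i, j). \<integral>x. of_bool (cell x = i) * (\<integral>y. of_bool (cell y = j) * kxy x y \<partial>mu) \<partial>mu)"

lemma cell_mat_sum:
  fixes F :: "nat \<Rightarrow> nat \<Rightarrow> real"
  assumes cell: "\<And>x. cell x < n" and [measurable]: "cell \<in> borel \<rightarrow>\<^sub>M count_space UNIV"
  shows "(\<Sum>i<n. \<Sum>j<n. cell_mat n cell $$ (i, j) * F i j) = (\<integral>x. (\<integral>y. F (cell x) (cell y) * kxy x y \<partial>mu) \<partial>mu)"
proof -
  have om [measurable]: "(\<lambda>x. of_bool (cell x = i) :: real) \<in> borel_measurable borel" for i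
    by (rule measurable_compose[OF assms(2)]) simp
  define G where "G j x = (\<integral>y. of_bool (cell y = j) * kxy x y \<partial>mu)" for j x
  have Gm [measurable]: "G j \<in> borel_measurable borel" for j unfolding G_def[abs_def] by measurable
  have b: "\<bar>of_bool (cell y = j) * kxy x y\<bar> \<le> 25" for x y j
    by (intro abs_mult_le1 abs_kxy) simp
  have i1: "integrable mu (\<lambda>y. of_bool (cell y = j) * kxy x y)" for x j
    by (rule mu_integrable[OF _ b]) measurable
  have i2: "integrable mu (\<lambda>x. of_bool (cell x = i) * G j x)" for i j
  proof (rule mu_integrable)
    show "\<bar>of_bool (cell x = i) * G j x\<bar> \<le> 25" for x
      unfolding G_def by (intro abs_mult_le1 abs_mu_le b) simp
  qed measurable
  have d: "h (cell x) = (\<Sum>i<n. h i * of_bool (cell x = i))" for h :: "nat \<Rightarrow> real" and x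
    using cell[of x] by (simp add: of_bool_def if_distrib[of "\<lambda>z. h _ * z"] sum.delta cong: if_cong)
  have "(\<integral>x. (\<integral>y. F (cell x) (cell y) * kxy x y \<partial>mu) \<partial>mu) = (\<integral>x. (\<Sum>j<n. F (cell x) j * G j x) \<partial>mu)"
  proof (rule Bochner_Integration.integral_cong[OF refl])
    fix x
    have "F (cell x) (cell y) * kxy x y = (\<Sum>j<n. F (cell x) j * (of_bool (cell y = j) * kxy x y))" for y
      by (simp only: d[of "F (cell x)" y] sum_distrib_right mult.assoc)
    then have "(\<integral>y. F (cell x) (cell y) * kxy x y \<partial>mu) = (\<integral>y. (\<Sum>j<n. F (cell x) j * (of_bool (cell y = j) * kxy x y)) \<partial>mu)"
      by (simp only:)
    also have "\<dots> = (\<Sum>j<n. F (cell x) j * G j x)"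
      unfolding G_def by (subst Bochner_Integration.integral_sum) (auto intro!: integrable_mult_right i1)
    finally show "(\<integral>y. F (cell x) (cell y) * kxy x y \<partial>mu) = (\<Sum>j<n. F (cell x) j * G j x)" .
  qed
  also have "\<dots> = (\<integral>x. (\<Sum>j<n. \<Sum>i<n. F i j * (of_bool (cell x = i) * G j x)) \<partial>mu)"
  proof (intro Bochner_Integration.integral_cong[OF refl] sum.cong refl)
    fix x j
    show "F (cell x) j * G j x = (\<Sum>i<n. F i j * (of_bool (cell x = i) * G j x))"
      by (simp only: d[of "\<lambda>i. F i j" x] sum_distrib_right mult.assoc)
  qed
  also have "\<dots> = (\<Sum>j<n. \<Sum>i<n. F i j * (\<integral>x. of_bool (cell x = i) * G j x \<partial>mu))"
    by (subst Bochner_Integration.integral_sum, intro Bochner_Integration.integrable_sum integrable_mult_right i2,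
        subst Bochner_Integration.integral_sum, intro integrable_mult_right i2, simp only: integral_mult_right_zero)
  also have "\<dots> = (\<Sum>i<n. \<Sum>j<n. F i j * (\<integral>x. of_bool (cell x = i) * G j x \<partial>mu))" by (rule sum.swap)
  also have "\<dots> = (\<Sum>i<n. \<Sum>j<n. cell_mat n cell $$ (i, j) * F i j)"
    by (intro sum.cong refl) (simp add: cell_mat_def G_def mult.commute)
  finally show ?thesis by simp
qed

text \<open>Unit vectors of length 1 are signs; composed with \<open>cell\<close> they are sign
  functions on the sphere, to which \<open>bilinear_bound\<close> applies with no discretisation
  error.\<close>

lemma SDP_1_cell_mat:
  assumes cell: "\<And>x. cell x < n" and [measurable]: "cell \<in> borel \<rightarrow>\<^sub>M count_space UNIV"
  shows "SDP 1 (cell_mat n cell) \<le> 67304 / 100000"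
proof (rule SDP_least)
  have dm: "dim_row (cell_mat n cell) = n" "dim_col (cell_mat n cell) = n" by (simp_all add: cell_mat_def)
  fix a b assume "\<And>x. x < dim_row (cell_mat n cell) \<Longrightarrow> a x \<in> unit_sphere 1" "\<And>y. y < dim_col (cell_mat n cell) \<Longrightarrow> b y \<in> unit_sphere 1"
  then have ab: "a i \<in> unit_sphere 1" "b i \<in> unit_sphere 1" if "i < n" for i using that by (simp_all add: dm)
  have pm: "vec_index v 0 = 1 \<or> vec_index v 0 = -1" if "v \<in> unit_sphere 1" for v
    using unit_sphere_coords(2)[OF that] by (simp add: power2_eq_1_iff)
  define f g where "f x = vec_index (a (cell x)) 0" and "g x = vec_index (b (cell x)) 0" for x
  have "(\<Sum>x<n. \<Sum>y<n. cell_mat n cell $$ (x, y) * scalar_prod (a x) (b y)) =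
      (\<Sum>x<n. \<Sum>y<n. cell_mat n cell $$ (x, y) * (vec_index (a x) 0 * vec_index (b y) 0))"
  proof (intro sum.cong refl)
    fix i j assume "i \<in> {..<n}" "j \<in> {..<n}"
    then have "a i \<in> unit_sphere 1" "b j \<in> unit_sphere 1" using ab by simp_all
    from scalar_prod_unit_sphere(1)[OF this]
    show "cell_mat n cell $$ (i, j) * scalar_prod (a i) (b j) = cell_mat n cell $$ (i, j) * (vec_index (a i) 0 * vec_index (b j) 0)"
      by simp
  qed
  also have "\<dots> = (\<integral>x. (\<integral>y. f x * g y * kxy x y \<partial>mu) \<partial>mu)"
    unfolding cell_mat_sum[OF assms, of "\<lambda>i j. vec_index (a i) 0 * vec_index (b j) 0"] f_def g_def ..
  also have "\<dots> \<le> 67304 / 100000"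
  proof (rule bilinear_bound)
    show "f \<in> borel_measurable borel" unfolding f_def[abs_def] by (rule measurable_compose[OF assms(2)]) simp
    show "g \<in> borel_measurable borel" unfolding g_def[abs_def] by (rule measurable_compose[OF assms(2)]) simp
    show "f x = 1 \<or> f x = -1" for x unfolding f_def by (rule pm[OF ab(1)[OF cell]])
    show "g x = 1 \<or> g x = -1" for x unfolding g_def by (rule pm[OF ab(2)[OF cell]])
  qed
  finally show "(\<Sum>x<dim_row (cell_mat n cell). \<Sum>y<dim_col (cell_mat n cell). cell_mat n cell $$ (x, y) * scalar_prod (a x) (b y)) \<le> 67304 / 100000"
    unfolding dm .
qed simp

lemma SDP_4_cell_mat:
  assumes cell: "\<And>x. cell x < n" and [measurable]: "cell \<in> borel \<rightarrow>\<^sub>M count_space UNIV"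
    and c: "\<And>i. i < n \<Longrightarrow> norm (c i) = 1" and \<epsilon>: "\<And>x. x \<noteq> 0 \<Longrightarrow> norm (sgn x - c (cell x)) \<le> \<epsilon>"
  shows "1 - 50 * \<epsilon> \<le> SDP 4 (cell_mat n cell)"
proof -
  have dm: "dim_row (cell_mat n cell) = n" "dim_col (cell_mat n cell) = n" by (simp_all add: cell_mat_def)
  define C where "C x = c (cell x)" for x
  have Cm [measurable]: "C \<in> borel_measurable borel" unfolding C_def[abs_def] by (rule measurable_compose[OF assms(2)]) simp
  have C1: "norm (C x) \<le> 1" for x using c[OF cell] by (simp add: C_def)
  have \<epsilon>C: "norm (sgn x - C x) \<le> \<epsilon>" if "x \<noteq> 0" for x using \<epsilon>[OF that] by (simp add: C_def)
  have pt: "inner (sgn x) (sgn y) * kxy x y - 50 * \<epsilon> \<le> inner (C x) (C y) * kxy x y" if "x \<noteq> 0" "y \<noteq> 0" for x y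
  proof -
    have "inner (sgn x) (sgn y) - inner (C x) (C y) = inner (sgn x - C x) (sgn y) + inner (C x) (sgn y - C y)"
      by (simp add: inner_diff_left inner_diff_right)
    moreover have "\<bar>inner (sgn x - C x) (sgn y)\<bar> \<le> \<epsilon> * 1"
      by (rule order_trans[OF Cauchy_Schwarz_ineq2 mult_mono]) (use \<epsilon>C[OF that(1)] order_trans[OF norm_ge_zero \<epsilon>C[OF that(1)]] in \<open>auto simp: sgnV_le\<close>)
    moreover have "\<bar>inner (C x) (sgn y - C y)\<bar> \<le> 1 * \<epsilon>"
      by (rule order_trans[OF Cauchy_Schwarz_ineq2 mult_mono]) (use \<epsilon>C[OF that(2)] C1 in auto)
    ultimately have "\<bar>inner (sgn x) (sgn y) - inner (C x) (C y)\<bar> \<le> 2 * \<epsilon>" by (simp add: abs_le_iff)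
    \<comment> \<open>Each of the two arguments moves by at most \<open>\<epsilon>\<close>, and the
      kernel is bounded by 25.\<close>
    then have "\<bar>inner (sgn x) (sgn y) - inner (C x) (C y)\<bar> * \<bar>kxy x y\<bar> \<le> 2 * \<epsilon> * 25"
      using abs_kxy[of x y] by (intro mult_mono) auto
    then have "(inner (sgn x) (sgn y) - inner (C x) (C y)) * kxy x y \<le> 50 * \<epsilon>"
      by (simp add: abs_mult[symmetric])
    then show ?thesis by (simp add: left_diff_distrib)
  qed
  let ?f = "\<lambda>x y. inner (sgn x) (sgn y) * kxy x y - 50 * \<epsilon>" and ?g = "\<lambda>x y. inner (C x) (C y) * kxy x y"
  have bg: "\<bar>?g x y\<bar> \<le> 25" for x y by (intro abs_mult_le1 abs_inner_le1 C1 abs_kxy)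
  have bh: "\<bar>inner (sgn x) (sgn y) * kxy x y\<bar> \<le> 25" for x y by (intro abs_mult_le1 abs_inner_le1 sgnV_le abs_kxy)
  have bf: "\<bar>?f x y\<bar> \<le> 25 + \<bar>50 * \<epsilon>\<bar>" for x y using bh by (rule abs_diff_le) simp
  have mg: "(\<lambda>(x, y). ?g x y) \<in> borel_measurable (mu \<Otimes>\<^sub>M mu)" by measurable
  have mh: "(\<lambda>(x, y). inner (sgn x) (sgn y) * kxy x y) \<in> borel_measurable (mu \<Otimes>\<^sub>M mu)" by measurable
  have mf: "(\<lambda>(x, y). ?f x y) \<in> borel_measurable (mu \<Otimes>\<^sub>M mu)" by measurable
  have fi: "(\<integral>y. ?f x y \<partial>mu) = (\<integral>y. inner (sgn x) (sgn y) * kxy x y \<partial>mu) - 50 * \<epsilon>" for x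
  proof -
    have "integrable mu (\<lambda>y. inner (sgn x) (sgn y) * kxy x y)" by (rule mu_mu(4)[OF mh bh]) simp
    then show ?thesis using mu.prob_space by (subst Bochner_Integration.integral_diff) simp_all
  qed
  have "1 - 50 * \<epsilon> = (\<integral>x. (\<integral>y. ?f x y \<partial>mu) \<partial>mu)"
    unfolding fi using mu.prob_space by (subst Bochner_Integration.integral_diff[OF mu_mu(2)[OF mh bh]]) (simp_all add: sphere_value)
  also have "\<dots> \<le> (\<integral>x. (\<integral>y. ?g x y \<partial>mu) \<partial>mu)"
  proof (rule integral_mono_AE[OF mu_mu(2)[OF mf bf] mu_mu(2)[OF mg bg]])
    show "AE x in mu. (\<integral>y. ?f x y \<partial>mu) \<le> (\<integral>y. ?g x y \<partial>mu)"
      using AE_mu_nonzero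
    proof eventually_elim
      fix x :: V assume x: "x \<noteq> 0"
      have "AE y in mu. ?f x y \<le> ?g x y" using AE_mu_nonzero by eventually_elim (rule pt[OF x])
      then show "(\<integral>y. ?f x y \<partial>mu) \<le> (\<integral>y. ?g x y \<partial>mu)"
        by (intro integral_mono_AE mu_mu(4)[OF mf bf] mu_mu(4)[OF mg bg]) simp_all
    qed
  qed
  also have "\<dots> = (\<Sum>i<n. \<Sum>j<n. cell_mat n cell $$ (i, j) * inner (c i) (c j))"
    unfolding cell_mat_sum[OF assms(1,2), of "\<lambda>i j. inner (c i) (c j)"] C_def ..
  also have "\<dots> \<le> SDP 4 (cell_mat n cell)"
    using SDP_upper[of "cell_mat n cell" "\<lambda>i. v4 (c i)" 4 "\<lambda>i. v4 (c i)"]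
    unfolding dm scalar_prod_v4 by (simp add: v4_unit_sphere c)
  finally show ?thesis .
qed

theorem mainTheorem2:
  shows "K\<^sub>G 4 \<ge> 1.48579"
proof (rule sphere_cells[of "1 / 100000000"])
  fix c :: "nat \<Rightarrow> V" and n and cell :: "V \<Rightarrow> nat"
  assume c: "\<And>i. i < n \<Longrightarrow> norm (c i) = 1" "\<And>x. cell x < n" "cell \<in> borel \<rightarrow>\<^sub>M count_space UNIV"
    "\<And>x. x \<noteq> 0 \<Longrightarrow> norm (sgn x - c (cell x)) \<le> 1 / 100000000"
  define M where "M = cell_mat n cell"
  \<comment> \<open>\<open>1 - 0.67304 * 1.48579\<close> is about \<open>3.9e-6\<close>, so the loss
    of \<open>5e-7\<close> is affordable.\<close>
  have 4: "1 - 50 / 100000000 \<le> SDP 4 M" unfolding M_def using SDP_4_cell_mat[OF c(2,3,1,4)] by simp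
  have 1: "SDP 1 M \<le> 67304 / 100000" unfolding M_def by (rule SDP_1_cell_mat[OF c(2,3)])
  have pos: "0 < SDP 1 M" using SDP_le_SDP_1[of 4 M] 4 by simp
  have "M \<noteq> 0\<^sub>m (dim_row M) (dim_col M)"
  proof
    assume "M = 0\<^sub>m (dim_row M) (dim_col M)"
    then have z: "M $$ (x, y) = 0" if "x < dim_row M" "y < dim_col M" for x y using that by (metis index_zero_mat(1))
    have "SDP 1 M \<le> 0" by (rule SDP_least) (auto intro!: sum_nonpos simp: z)
    then show False using pos by simp
  qed
  then have "SDP 4 M / SDP 1 M \<le> K\<^sub>G 4" by (intro ratio_le_grothendieck_constant) simp_all
  moreover have "1.48579 \<le> SDP 4 M / SDP 1 M"
    using 1 4 pos by (simp add: pos_le_divide_eq)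
  ultimately show "K\<^sub>G 4 \<ge> 1.48579" by linarith
qed simp

end
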